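(* Let $X$ be a compact complex manifold of complex dimension $n$. Then for every $0\le p\le n$, $$h^{p,0}_{BC}=h^{p,0}_{\bar\partial}-\sum_{j=1}^{p}(-1)^{p+j}\left(h^{j,0}_{\bar\partial}-h_2^{j,0}\right).$$
   Context: Let $C^{\infty\,p,q}$ be the space of smooth complex-valued $(p,q)$-forms on $X$. Define $H^{p,q}_{BC}=(\ker(\partial)\cap\ker(\bar\partial))/\operatorname{im}(\partial\bar\partial)$ and $H^{p,q}_{\bar\partial}=\ker(\bar\partial)/\operatorname{im}(\bar\partial)$ (spaces taken inside $C^{\infty\,p,q}$), with complex dimensions $h^{p,q}_{BC}$ and $h^{p,q}_{\bar\partial}$. Let $E_2^{p,q}=\ker(\partial:H^{p,q}_{\bar\partial}\to H^{p+1,q}_{\bar\partial})/\operatorname{im}(\partial:H^{p-1,q}_{\bar\partial}\to H^{p,q}_{\bar\partial})$ be the second page of the Frölicher spectral sequence and $h_2^{p,q}=\dim_{\mathbb C}E_2^{p,q}$. An empty sum is $0$. *)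

theory Defs
  imports "HOL-Analysis.Analysis" "HOL-Algebra.AbelCoset" "Jordan_Normal_Form.Missing_VectorSpace"
begin

section \<open>Functions on open subsets of complex n-space\<close>

text \<open>As for \<^const>\<open>Euclidean_space\<close>, points of complex \<open>n\<close>-space are sequences that vanish
  from index \<open>n\<close> on, with the topology induced by the product topology. The dimension is thus an
  ordinary natural number, and \<open>n = 0\<close> is allowed.\<close>

definition cspace :: "nat \<Rightarrow> (nat \<Rightarrow> complex) set" where
  "cspace n = {z. \<forall>i\<ge>n. z i = 0}"

text \<open>Real partial derivative in the \<open>i\<close>-th coordinate, in the direction \<open>e\<close>: for
  \<open>z i = x + \<i> y\<close> the choices \<open>e = 1\<close> and \<open>e = \<i>\<close> give the derivatives in \<open>x\<close> and in \<open>y\<close>.\<close>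

definition real_pd :: "nat \<Rightarrow> complex \<Rightarrow> ((nat \<Rightarrow> complex) \<Rightarrow> complex) \<Rightarrow> (nat \<Rightarrow> complex) \<Rightarrow> complex" where
  "real_pd i e f z = vector_derivative (\<lambda>t::real. f (z(i := z i + of_real t * e))) (at 0)"

definition iter_pd :: "(nat \<times> complex) list \<Rightarrow> ((nat \<Rightarrow> complex) \<Rightarrow> complex) \<Rightarrow> (nat \<Rightarrow> complex) \<Rightarrow> complex" where
  "iter_pd ds f = foldr (\<lambda>(i, e). real_pd i e) ds f"

definition smooth_on :: "nat \<Rightarrow> (nat \<Rightarrow> complex) set \<Rightarrow> ((nat \<Rightarrow> complex) \<Rightarrow> complex) \<Rightarrow> bool" where
  "smooth_on n V f \<longleftrightarrow>
    (\<forall>ds. set ds \<subseteq> {..<n} \<times> {1, \<i>} \<longrightarrow>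
      continuous_on V (iter_pd ds f) \<and>
      (\<forall>z\<in>V. \<forall>i<n. \<forall>e\<in>{1, \<i>}.
        (\<lambda>t::real. iter_pd ds f (z(i := z i + of_real t * e))) differentiable (at 0)))"

text \<open>The Wirtinger operators \<open>\<partial>/\<partial>z\<^sub>i\<close> and \<open>\<partial>/\<partial>z\<^sub>i\<close>-bar.\<close>

definition d_z :: "nat \<Rightarrow> ((nat \<Rightarrow> complex) \<Rightarrow> complex) \<Rightarrow> (nat \<Rightarrow> complex) \<Rightarrow> complex" where
  "d_z i f z = (real_pd i 1 f z - \<i> * real_pd i \<i> f z) / 2"

definition d_zbar :: "nat \<Rightarrow> ((nat \<Rightarrow> complex) \<Rightarrow> complex) \<Rightarrow> (nat \<Rightarrow> complex) \<Rightarrow> complex" where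
  "d_zbar i f z = (real_pd i 1 f z + \<i> * real_pd i \<i> f z) / 2"

definition holomorphic_several :: "nat \<Rightarrow> (nat \<Rightarrow> complex) set \<Rightarrow> ((nat \<Rightarrow> complex) \<Rightarrow> complex) \<Rightarrow> bool" where
  "holomorphic_several n V f \<longleftrightarrow>
    continuous_on V f \<and> (\<forall>z\<in>V. \<forall>i<n. (\<lambda>w. f (z(i := w))) field_differentiable (at (z i)))"


section \<open>Complex manifolds\<close>

type_synonym 'a chart = "'a set \<times> ('a \<Rightarrow> nat \<Rightarrow> complex)"

definition chart_image :: "'a chart \<Rightarrow> (nat \<Rightarrow> complex) set" where
  "chart_image c = snd c ` fst c"

definition is_chart :: "nat \<Rightarrow> 'a topology \<Rightarrow> 'a chart \<Rightarrow> bool" where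
  "is_chart n X c \<longleftrightarrow>
    openin X (fst c) \<and>
    openin (top_of_set (cspace n)) (chart_image c) \<and>
    homeomorphic_map (subtopology X (fst c)) (top_of_set (chart_image c)) (snd c)"

definition transition :: "'a chart \<Rightarrow> 'a chart \<Rightarrow> (nat \<Rightarrow> complex) \<Rightarrow> (nat \<Rightarrow> complex)" where
  "transition c d z = snd d (inv_into (fst c) (snd c) z)"

definition overlap :: "'a chart \<Rightarrow> 'a chart \<Rightarrow> (nat \<Rightarrow> complex) set" where
  "overlap c d = snd c ` (fst c \<inter> fst d)"

definition complex_manifold :: "nat \<Rightarrow> 'a topology \<Rightarrow> 'a chart set \<Rightarrow> bool" where
  "complex_manifold n X A \<longleftrightarrow>
    Hausdorff_space X \<and> second_countable X \<and>
    (\<forall>c\<in>A. is_chart n X c) \<and>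
    (\<Union>c\<in>A. fst c) = topspace X \<and>
    (\<forall>c\<in>A. \<forall>d\<in>A. \<forall>k<n. holomorphic_several n (overlap c d) (\<lambda>z. transition c d z k))"


section \<open>Smooth forms of type (p,q)\<close>

text \<open>A form is given by its skew-symmetric components in all charts:
  in the chart \<open>c\<close> with coordinates \<open>z\<close>, the function \<open>\<omega> c I J\<close> on the image of \<open>c\<close> is the
  component with index lists \<open>I = [i\<^sub>1, \<dots>, i\<^sub>p]\<close> and \<open>J = [j\<^sub>1, \<dots>, j\<^sub>q]\<close> in
  \<open>\<omega> = 1/(p! q!) \<Sum> \<omega> c I J dz\<^sub>I \<and> dz\<^sub>J\<close>-bar.
  Components are \<open>0\<close> wherever they have no meaning, so that equality of forms is equality of
  functions. The bidegree is a pair of integers: no list has negative length, so there are no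
  nonzero forms of a negative degree.\<close>

type_synonym 'a form = "'a chart \<Rightarrow> nat list \<Rightarrow> nat list \<Rightarrow> (nat \<Rightarrow> complex) \<Rightarrow> complex"

definition multi_indices :: "nat \<Rightarrow> int \<Rightarrow> nat list set" where
  "multi_indices n k = {I. set I \<subseteq> {..<n} \<and> int (length I) = k}"

definition swap_entries :: "nat \<Rightarrow> nat \<Rightarrow> nat list \<Rightarrow> nat list" where
  "swap_entries a b I = I[a := I ! b, b := I ! a]"

text \<open>\<open>jacobian_prod c d z I K\<close> is the product of the \<open>\<partial>w\<^bsub>k\<^sub>a\<^esub>/\<partial>z\<^bsub>i\<^sub>a\<^esub>\<close>, where \<open>z\<close> and \<open>w\<close> are the
  coordinates of \<open>c\<close> and \<open>d\<close>.\<close>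

definition jacobian_prod :: "'a chart \<Rightarrow> 'a chart \<Rightarrow> (nat \<Rightarrow> complex) \<Rightarrow> nat list \<Rightarrow> nat list \<Rightarrow> complex" where
  "jacobian_prod c d z I K = (\<Prod>a<length I. d_z (I ! a) (\<lambda>u. transition c d u (K ! a)) z)"

definition smooth_forms :: "nat \<Rightarrow> 'a chart set \<Rightarrow> int \<Rightarrow> int \<Rightarrow> 'a form set" where
  "smooth_forms n A p q = {\<omega>.
    (\<forall>c I J z. \<not> (c \<in> A \<and> I \<in> multi_indices n p \<and> J \<in> multi_indices n q \<and> z \<in> chart_image c)
      \<longrightarrow> \<omega> c I J z = 0) \<and>
    (\<forall>c\<in>A. \<forall>I\<in>multi_indices n p. \<forall>J\<in>multi_indices n q.
      smooth_on n (chart_image c) (\<omega> c I J) \<and>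
      (\<forall>a b. a < b \<and> b < length I \<longrightarrow> (\<forall>z. \<omega> c (swap_entries a b I) J z = - \<omega> c I J z)) \<and>
      (\<forall>a b. a < b \<and> b < length J \<longrightarrow> (\<forall>z. \<omega> c I (swap_entries a b J) z = - \<omega> c I J z)) \<and>
      (\<forall>d\<in>A. \<forall>z\<in>overlap c d.
        \<omega> c I J z = (\<Sum>K\<in>multi_indices n p. \<Sum>L\<in>multi_indices n q.
          jacobian_prod c d z I K * cnj (jacobian_prod c d z J L) * \<omega> d K L (transition c d z))))}"

definition remove_entry :: "nat \<Rightarrow> nat list \<Rightarrow> nat list" where
  "remove_entry a I = take a I @ drop (Suc a) I"

text \<open>In components, \<open>\<partial>(f dz\<^sub>I \<and> dz\<^sub>J\<close>-bar\<open>)\<close> is the sum of the \<open>\<partial>f/\<partial>z\<^sub>i dz\<^sub>i \<and> dz\<^sub>I \<and> dz\<^sub>J\<close>-bar. For the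
  conjugate operator, moving \<open>dz\<^sub>j\<close>-bar past \<open>dz\<^sub>I\<close> produces the sign \<open>(-1)\<close> to the power \<open>p\<close>.\<close>

definition del :: "nat \<Rightarrow> 'a chart set \<Rightarrow> 'a form \<Rightarrow> 'a form" where
  "del n A \<omega> c I J z =
    (if c \<in> A \<and> set I \<subseteq> {..<n} \<and> set J \<subseteq> {..<n} \<and> z \<in> chart_image c
     then \<Sum>a<length I. (-1) ^ a * d_z (I ! a) (\<omega> c (remove_entry a I) J) z
     else 0)"

definition delbar :: "nat \<Rightarrow> 'a chart set \<Rightarrow> 'a form \<Rightarrow> 'a form" where
  "delbar n A \<omega> c I J z =
    (if c \<in> A \<and> set I \<subseteq> {..<n} \<and> set J \<subseteq> {..<n} \<and> z \<in> chart_image c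
     then (-1) ^ length I * (\<Sum>b<length J. (-1) ^ b * d_zbar (J ! b) (\<omega> c I (remove_entry b J)) z)
     else 0)"


section \<open>Complex vector spaces and quotients\<close>

definition complex_field :: "complex ring" where
  "complex_field = \<lparr>carrier = UNIV, monoid.mult = (*), one = 1, ring.zero = 0, add = (+)\<rparr>"

text \<open>The record of modules extends that of rings; its ring multiplication and unit play no role.\<close>

definition form_space :: "nat \<Rightarrow> 'a chart set \<Rightarrow> int \<Rightarrow> int \<Rightarrow> (complex, 'a form) module" where
  "form_space n A p q =
    \<lparr>carrier = smooth_forms n A p q, monoid.mult = undefined, one = undefined,
     ring.zero = (\<lambda>c I J z. 0),
     add = (\<lambda>\<omega> \<eta> c I J z. \<omega> c I J z + \<eta> c I J z),
     module.smult = (\<lambda>a \<omega> c I J z. a * \<omega> c I J z)\<rparr>"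

text \<open>The quotient of \<open>V\<close> by a subspace \<open>W\<close>, whose elements are the cosets. Adding \<open>W\<close> in the
  scalar multiplication matters only for the scalar \<open>0\<close>.\<close>

definition quotient_space :: "('k, 'v) module \<Rightarrow> 'v set \<Rightarrow> ('k, 'v set) module" where
  "quotient_space V W =
    \<lparr>carrier = A_RCOSETS V W, monoid.mult = undefined, one = undefined,
     ring.zero = W,
     add = set_add V,
     module.smult = (\<lambda>a S. set_add V W (module.smult V a ` S))\<rparr>"

definition cdim :: "(complex, 'v) module \<Rightarrow> nat" where
  "cdim V = vectorspace.dim complex_field V"


section \<open>Bott-Chern and Dolbeault cohomology, and the second Froelicher page\<close>

definition H_BC :: "nat \<Rightarrow> 'a chart set \<Rightarrow> int \<Rightarrow> int \<Rightarrow> (complex, 'a form set) module" where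
  "H_BC n A p q =
    quotient_space
      ((form_space n A p q)\<lparr>carrier :=
        {\<omega> \<in> smooth_forms n A p q.
          del n A \<omega> = ring.zero (form_space n A (p + 1) q) \<and>
          delbar n A \<omega> = ring.zero (form_space n A p (q + 1))}\<rparr>)
      ((\<lambda>\<eta>. del n A (delbar n A \<eta>)) ` smooth_forms n A (p - 1) (q - 1))"

definition H_delbar :: "nat \<Rightarrow> 'a chart set \<Rightarrow> int \<Rightarrow> int \<Rightarrow> (complex, 'a form set) module" where
  "H_delbar n A p q =
    quotient_space
      ((form_space n A p q)\<lparr>carrier :=
        {\<omega> \<in> smooth_forms n A p q. delbar n A \<omega> = ring.zero (form_space n A p (q + 1))}\<rparr>)
      (delbar n A ` smooth_forms n A p (q - 1))"

text \<open>The map induced by \<open>\<partial>\<close> on the Dolbeault groups: the class of \<open>\<omega>\<close> goes to the class of \<open>\<partial>\<omega>\<close>.\<close>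

definition del_H :: "nat \<Rightarrow> 'a chart set \<Rightarrow> int \<Rightarrow> int \<Rightarrow> 'a form set \<Rightarrow> 'a form set" where
  "del_H n A p q S =
    set_add (form_space n A (p + 1) q) (delbar n A ` smooth_forms n A (p + 1) (q - 1)) (del n A ` S)"

definition E2 :: "nat \<Rightarrow> 'a chart set \<Rightarrow> int \<Rightarrow> int \<Rightarrow> (complex, 'a form set set) module" where
  "E2 n A p q =
    quotient_space
      ((H_delbar n A p q)\<lparr>carrier :=
        {S \<in> carrier (H_delbar n A p q). del_H n A p q S = ring.zero (H_delbar n A (p + 1) q)}\<rparr>)
      (del_H n A (p - 1) q ` carrier (H_delbar n A (p - 1) q))"

definition h_BC :: "nat \<Rightarrow> 'a chart set \<Rightarrow> int \<Rightarrow> int \<Rightarrow> nat" where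
  "h_BC n A p q = cdim (H_BC n A p q)"

definition h_delbar :: "nat \<Rightarrow> 'a chart set \<Rightarrow> int \<Rightarrow> int \<Rightarrow> nat" where
  "h_delbar n A p q = cdim (H_delbar n A p q)"

definition h_2 :: "nat \<Rightarrow> 'a chart set \<Rightarrow> int \<Rightarrow> int \<Rightarrow> nat" where
  "h_2 n A p q = cdim (E2 n A p q)"

end

theory Submission
  imports Defs "HOL-Complex_Analysis.Complex_Analysis"
begin

text \<open>In bidegree \<open>(p,0)\<close> all quotients are by \<open>0\<close>: Dolbeault classes are the holomorphic \<open>p\<close>-forms
  \<open>\<Omega>\<^sup>p\<close>, Bott-Chern classes are the \<open>\<partial>\<close>-closed ones, and \<open>E\<^sub>2\<close> is the cohomology of \<open>(\<Omega>, \<partial>)\<close>. Rank-nullity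
  for \<open>\<partial> : \<Omega>\<^sup>p \<rightarrow> \<Omega>\<^sup>p\<^sup>+\<^sup>1\<close> gives the alternating sum, up to the rank of \<open>\<partial>\<close> on \<open>\<Omega>\<^sup>0\<close>, which is \<open>0\<close>.

  Finite dimension: the components of a holomorphic form, bounded by \<open>B\<close> on a finite cover by small polydiscs,
  are bounded by \<open>C B\<close> on larger polydiscs, hence Lipschitz with constant proportional to \<open>B\<close> by Cauchy's
  estimates. A form vanishing on a fine finite net is then bounded by \<open>B/2\<close>, and so is zero: evaluation on
  the net is injective. Applied to a polynomial in a holomorphic function, the same fact shows that holomorphic
  functions take finitely many values, hence are locally constant.\<close>

section \<open>Polydiscs\<close>

text \<open>Two obstacles shape the proof. Forms are given by components in all charts at once, so
  that \<open>del\<close> maps holomorphic forms to holomorphic forms only if it respects the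
  transformation law. Differentiating that law brings in second derivatives of the coordinate
  changes and the chain rule. Holomorphy is assumed only as continuity together with complex
  differentiability in each variable, so holomorphic and commuting partial derivatives are first
  derived from one-variable Cauchy theory on slices. The other obstacle is that rank-nullity
  requires finite dimension. The usual route goes through Montel's theorem and local compactness of
  a normed space. Here the mesh of the net depends on the cover and on \<open>p\<close> but not on
  the form or on its bound \<open>B\<close>. The same net therefore applies to \<open>B / 2\<close>,
  \<open>B / 4\<close> and so on, and neither a norm nor a convergent subsequence is called for. The
  doubled radius in the cover is what pays for Cauchy's estimates: bounds on the small polydiscs
  spread to the doubled ones through the transformation law, and the margin \<open>r\<close> between
  the two turns them into bounds for derivatives.\<close>

definition polydisc :: "nat \<Rightarrow> (nat \<Rightarrow> complex) \<Rightarrow> real \<Rightarrow> (nat \<Rightarrow> complex) set" where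
  "polydisc n a r = {z \<in> cspace n. \<forall>i<n. z i \<in> ball (a i) r}"

definition cpolydisc :: "nat \<Rightarrow> (nat \<Rightarrow> complex) \<Rightarrow> real \<Rightarrow> (nat \<Rightarrow> complex) set" where
  "cpolydisc n a r = {z \<in> cspace n. \<forall>i<n. z i \<in> cball (a i) r}"

lemma fun_upd_in_cspace: "z \<in> cspace n \<Longrightarrow> i < n \<Longrightarrow> z(i := w) \<in> cspace n"
  by (auto simp: cspace_def)

lemma cspace_eqI: "z \<in> cspace n \<Longrightarrow> w \<in> cspace n \<Longrightarrow> (\<And>i. i < n \<Longrightarrow> z i = w i) \<Longrightarrow> z = w"
  unfolding cspace_def mem_Collect_eq by (rule ext) (metis not_less)

lemma polydisc_subset_cpolydisc: "r \<le> s \<Longrightarrow> polydisc n a r \<subseteq> cpolydisc n a s"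
  unfolding polydisc_def cpolydisc_def by force

text \<open>A basic neighbourhood in the product topology constrains every coordinate, but from
  index \<open>n\<close> on all points agree with the centre, so only finitely many radii have to be
  respected.\<close>

lemma openin_contains_cpolydisc:
  assumes V: "openin (top_of_set (cspace n)) V" and a: "a \<in> V"
  obtains r where "r > 0" "cpolydisc n a r \<subseteq> V"
proof -
  from V obtain U where U: "open U" "V = cspace n \<inter> U"
    by (metis openin_open)
  have "openin (product_topology (\<lambda>i::nat. euclidean::complex topology) UNIV) U"
    using U(1) by (simp add: euclidean_product_topology)
  moreover have "a \<in> U" using a U by auto
  ultimately obtain B where B: "\<And>i. open (B i)" "a \<in> Pi\<^sub>E UNIV B" "Pi\<^sub>E UNIV B \<subseteq> U"
    unfolding openin_product_topology_alt by (metis UNIV_I open_openin)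
  have "\<exists>e>0. cball (a i) e \<subseteq> B i" for i
    using B(1)[of i] B(2) open_contains_cball by (metis PiE_mem UNIV_I)
  then obtain e where e: "\<And>i. e i > 0" "\<And>i. cball (a i) (e i) \<subseteq> B i"
    by metis
  \<comment> \<open>The extra 1 keeps the minimum meaningful for \<open>n = 0\<close>.\<close>
  define r where "r = Min (insert 1 (e ` {..<n}))"
  have r: "r > 0" "\<And>i. i < n \<Longrightarrow> r \<le> e i"
    using e(1) by (auto simp: r_def)
  have "cpolydisc n a r \<subseteq> V"
  proof
    fix z assume z: "z \<in> cpolydisc n a r"
    have "z i \<in> B i" for i
    proof (cases "i < n")
      case True
      then have "z i \<in> cball (a i) (e i)"
        using z r(2)[of i] unfolding cpolydisc_def by force
      then show ?thesis using e(2) by blast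
    next
      case False
      then have "z i = a i"
        using z a U by (simp add: cpolydisc_def cspace_def)
      then show ?thesis using B(2) by auto
    qed
    then have "z \<in> U" using B(3) by auto
    then show "z \<in> V" using z U by (auto simp: cpolydisc_def)
  qed
  with r(1) that show ?thesis by blast
qed

lemma compact_cpolydisc: "compact (cpolydisc n a r)"
proof -
  \<comment> \<open>Written as a full product, with the factor \<open>{0}\<close> from index
    \<open>n\<close> on, the set falls under Tychonoff's theorem.\<close>
  have eq: "cpolydisc n a r = Pi\<^sub>E UNIV (\<lambda>i. if i < n then cball (a i) r else {0})" (is "?L = ?R")
  proof (intro equalityI subsetI)
    fix z assume "z \<in> ?L" then show "z \<in> ?R" by (auto simp: cpolydisc_def cspace_def)
  next
    fix z assume "z \<in> ?R"
    then have z: "z i \<in> (if i < n then cball (a i) r else {0})" for i by (rule PiE_mem) simp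
    have "z i = 0" if "i \<ge> n" for i using z[of i] that by simp
    moreover have "z i \<in> cball (a i) r" if "i < n" for i using z[of i] that by simp
    ultimately show "z \<in> ?L" by (simp add: cpolydisc_def cspace_def)
  qed
  have "compactin (product_topology (\<lambda>i. euclidean) UNIV) (Pi\<^sub>E UNIV (\<lambda>i. if i < n then cball (a i) r else {0}))"
    by (rule compactin_PiE[THEN iffD2]) auto
  then show ?thesis unfolding eq by (simp add: euclidean_product_topology)
qed

lemma openin_polydisc: "openin (top_of_set (cspace n)) (polydisc n a r)"
proof -
  have "polydisc n a r = cspace n \<inter> (\<Inter>i<n. (\<lambda>z. z i) -` ball (a i) r)"
    by (auto simp: polydisc_def)
  moreover have "open (\<Inter>i<n. (\<lambda>z::nat\<Rightarrow>complex. z i) -` ball (a i) r)"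
    by (intro open_INT ballI open_vimage) (auto intro: continuous_on_product_coordinates)
  ultimately show ?thesis by auto
qed

lemma continuous_on_fun_upd:
  fixes f :: "'a::topological_space \<Rightarrow> 'b \<Rightarrow> 'c::topological_space"
  assumes "continuous_on S f" "continuous_on S g"
  shows "continuous_on S (\<lambda>x. (f x)(i := g x))"
proof (rule continuous_on_coordinatewise_then_product)
  fix j show "continuous_on S (\<lambda>x. ((f x)(i := g x)) j)"
    by (cases "j = i") (use assms continuous_on_product_then_coordinatewise[OF assms(1)] in auto)
qed

text \<open>Uniform limits give continuity of derivatives on small polydiscs only; this glues the
  pieces.\<close>

lemma continuous_on_locally:
  fixes V :: "'a::t2_space set"
  assumes "\<And>a. a \<in> V \<Longrightarrow> \<exists>W. openin (top_of_set V) W \<and> a \<in> W \<and> continuous_on W f"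
  shows "continuous_on V f"
  unfolding continuous_on_eq_continuous_within
proof
  fix a assume "a \<in> V"
  then obtain W where W: "openin (top_of_set V) W" "a \<in> W" "continuous_on W f"
    using assms by blast
  then obtain U where U: "open U" "W = V \<inter> U" by (metis openin_open)
  have "at a within V = at a within W"
    by (rule at_within_nhd[of a U]) (use U W in auto)
  then show "continuous (at a within V) f"
    using W by (simp add: continuous_on_eq_continuous_within)
qed

lemma cpolydisc_mono: "r \<le> s \<Longrightarrow> cpolydisc n a r \<subseteq> cpolydisc n a s"
  unfolding cpolydisc_def by force

lemma centre_in_polydisc: "a \<in> cspace n \<Longrightarrow> r > 0 \<Longrightarrow> a \<in> polydisc n a r"
  by (simp add: polydisc_def)

lemma cpolydisc_fun_upd_shift:
  assumes "z \<in> cpolydisc n a r" "w \<in> cball (z i) s" "i < n" "s \<ge> 0"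
  shows "z(i := w) \<in> cpolydisc n a (r + s)"
proof -
  have "dist (a i) w \<le> r + s"
    using assms dist_triangle[of "a i" w "z i"] by (auto simp: cpolydisc_def)
  moreover have "dist (a j) (z j) \<le> r + s" if "j < n" for j
    using assms that by (force simp: cpolydisc_def)
  ultimately show ?thesis using assms
    by (auto simp: cpolydisc_def fun_upd_in_cspace)
qed

lemma bounded_on_cpolydisc:
  assumes "continuous_on (cpolydisc n a r) f"
  obtains M where "M > 0" "\<And>z. z \<in> cpolydisc n a r \<Longrightarrow> cmod (f z) \<le> M"
proof -
  have "bounded (f ` cpolydisc n a r)"
    by (intro compact_imp_bounded compact_continuous_image assms compact_cpolydisc)
  then show ?thesis using that by (auto simp: bounded_pos)
qed

lemma cpolydisc_fun_upd_add:
  assumes "z \<in> cpolydisc n a r" "i < n" "cmod h \<le> s"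
  shows "z(i := z i + h) \<in> cpolydisc n a (r + s)"
proof (rule cpolydisc_fun_upd_shift[OF assms(1) _ assms(2)])
  show "s \<ge> 0" using assms(3) norm_ge_zero[of h] by linarith
  show "z i + h \<in> cball (z i) s" using assms(3) by (simp add: dist_norm)
qed

section \<open>Holomorphic functions of several variables\<close>

lemma holomorphic_severalD:
  assumes "holomorphic_several n V f"
  shows "continuous_on V f"
    and "z \<in> V \<Longrightarrow> i < n \<Longrightarrow> (\<lambda>w. f (z(i := w))) field_differentiable at (z i)"
  using assms by (auto simp: holomorphic_several_def)

text \<open>The gateway to one-variable theory: updating a coordinate below \<open>n\<close> does
  not leave \<open>cspace n\<close>, so relative openness becomes genuine openness in the complex
  plane.\<close>

lemma open_slice:
  assumes "openin (top_of_set (cspace n)) V" "z \<in> cspace n" "i < n"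
  shows "open {w. z(i := w) \<in> V}"
proof -
  obtain U where U: "open U" "V = cspace n \<inter> U" using assms(1) by (metis openin_open)
  have "{w. z(i := w) \<in> V} = (\<lambda>w. z(i := w)) -` U"
    using U assms fun_upd_in_cspace by auto
  moreover have "open ((\<lambda>w. z(i := w)) -` U)"
    using U(1) by (intro open_vimage continuous_on_fun_upd continuous_intros)
  ultimately show ?thesis by simp
qed

lemma openin_cspace_subset: "openin (top_of_set (cspace n)) V \<Longrightarrow> V \<subseteq> cspace n"
  by (metis openin_subset topspace_euclidean_subtopology)

lemma holomorphic_on_slice:
  assumes "holomorphic_several n V f" "openin (top_of_set (cspace n)) V" "i < n"
  shows "(\<lambda>w. f (z(i := w))) holomorphic_on {w. z(i := w) \<in> V}"
  unfolding holomorphic_on_def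
proof
  fix w assume "w \<in> {w. z(i := w) \<in> V}"
  then have "(\<lambda>u. f ((z(i := w))(i := u))) field_differentiable at ((z(i := w)) i)"
    by (intro holomorphic_severalD(2)[OF assms(1)] assms) auto
  then show "(\<lambda>w. f (z(i := w))) field_differentiable at w within {w. z(i := w) \<in> V}"
    by (simp add: field_differentiable_at_within)
qed

lemma eventually_slice:
  assumes V: "openin (top_of_set (cspace n)) V" and z: "z \<in> V" and i: "i < n"
  shows "\<forall>\<^sub>F t in nhds (0::real). z(i := z i + of_real t * e) \<in> V"
proof -
  have "((\<lambda>t::real. z i + of_real t * e) \<longlongrightarrow> z i + of_real 0 * e) (nhds 0)"
    by (intro tendsto_intros filterlim_ident)
  then have *: "filterlim (\<lambda>t::real. z i + of_real t * e) (nhds (z i)) (nhds 0)" by simp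
  have "\<forall>\<^sub>F w in nhds (z i). w \<in> {w. z(i := w) \<in> V}"
    by (rule eventually_nhds_in_open[OF open_slice[OF V _ i]])
       (use z openin_cspace_subset[OF V] in auto)
  from eventually_compose_filterlim[OF this *] show ?thesis by simp
qed

text \<open>Components of forms are controlled on chart images only. The derivative sees just the
  values near \<open>z\<close> along one slice, and these stay in \<open>V\<close>.\<close>

lemma real_pd_cong:
  assumes V: "openin (top_of_set (cspace n)) V" and z: "z \<in> V" and i: "i < n"
    and eq: "\<And>u. u \<in> V \<Longrightarrow> f u = g u"
  shows "real_pd i e f z = real_pd i e g z"
  unfolding real_pd_def
  by (rule vector_derivative_cong_eq)
     (use eventually_slice[OF V z i, of e] in \<open>auto elim!: eventually_mono simp: eq\<close>)

lemma d_z_cong: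
  assumes "openin (top_of_set (cspace n)) V" "z \<in> V" "i < n" "\<And>u. u \<in> V \<Longrightarrow> f u = g u"
  shows "d_z i f z = d_z i g z"
  using real_pd_cong[OF assms] by (simp add: d_z_def)

lemma holomorphic_several_cong:
  assumes V: "openin (top_of_set (cspace n)) V" and eq: "\<And>u. u \<in> V \<Longrightarrow> f u = g u"
    and f: "holomorphic_several n V f"
  shows "holomorphic_several n V g"
  unfolding holomorphic_several_def
proof (intro conjI ballI allI impI)
  show "continuous_on V g"
    using holomorphic_severalD(1)[OF f] eq by (simp cong: continuous_on_cong)
  fix z i assume z: "z \<in> V" and i: "i < n"
  from holomorphic_severalD(2)[OF f z i] obtain D where
    "((\<lambda>w. f (z(i := w))) has_field_derivative D) (at (z i))"
    by (auto simp: field_differentiable_def)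
  then have "((\<lambda>w. g (z(i := w))) has_field_derivative D) (at (z i))"
    by (rule has_field_derivative_transform_within_open[OF _ open_slice[OF V _ i]])
       (use z eq openin_cspace_subset[OF V] in auto)
  then show "(\<lambda>w. g (z(i := w))) field_differentiable at (z i)"
    by (auto simp: field_differentiable_def)
qed

lemma real_pd_has_vector_derivative:
  assumes "((\<lambda>w. f (z(i := w))) has_field_derivative D) (at (z i))"
  shows "((\<lambda>t::real. f (z(i := z i + of_real t * e))) has_vector_derivative (e * D)) (at 0)"
proof -
  have 1: "((\<lambda>t::real. z i + of_real t * e) has_vector_derivative e) (at 0)"
    by (rule has_vector_derivative_eq_rhs, (rule derivative_intros)+) auto
  have "((\<lambda>w. f (z(i := w))) \<circ> (\<lambda>t::real. z i + of_real t * e) has_vector_derivative (e * D)) (at 0)"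
    by (rule field_vector_diff_chain_at[OF 1]) (use assms in simp)
  then show ?thesis by (simp add: o_def)
qed

lemma real_pd_eq:
  assumes "((\<lambda>w. f (z(i := w))) has_field_derivative D) (at (z i))"
  shows "real_pd i e f z = e * D"
  unfolding real_pd_def
  by (rule vector_derivative_at) (rule real_pd_has_vector_derivative[OF assms])

text \<open>Along a complex differentiable slice the derivative in direction \<open>e\<close> is
  \<open>e * D\<close>; the directions 1 and \<i> then add up in \<open>d_z\<close> and cancel in
  \<open>d_zbar\<close>.\<close>

lemma d_z_eq:
  assumes "((\<lambda>w. f (z(i := w))) has_field_derivative D) (at (z i))"
  shows "d_z i f z = D" "d_zbar i f z = 0"
  using real_pd_eq[OF assms] by (auto simp: d_z_def d_zbar_def)

lemma has_field_derivative_d_z: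
  assumes "holomorphic_several n V f" "z \<in> V" "i < n"
  shows "((\<lambda>w. f (z(i := w))) has_field_derivative d_z i f z) (at (z i))"
  using holomorphic_severalD(2)[OF assms] d_z_eq(1) unfolding field_differentiable_def by metis

lemma has_field_derivative_d_z_slice:
  assumes "holomorphic_several n V f" "z(i := w) \<in> V" "i < n"
  shows "((\<lambda>w. f (z(i := w))) has_field_derivative d_z i f (z(i := w))) (at w)"
  using has_field_derivative_d_z[OF assms] by simp

lemma d_zbar_holomorphic:
  assumes "holomorphic_several n V f" "z \<in> V" "i < n"
  shows "d_zbar i f z = 0"
  using d_z_eq(2)[OF has_field_derivative_d_z[OF assms]] .

lemma holomorphic_several_const: "holomorphic_several n V (\<lambda>_. a)"
  by (simp add: holomorphic_several_def)

lemma holomorphic_several_add: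
  "holomorphic_several n V f \<Longrightarrow> holomorphic_several n V g \<Longrightarrow> holomorphic_several n V (\<lambda>z. f z + g z)"
  by (auto simp: holomorphic_several_def intro!: continuous_intros field_differentiable_add)

lemma holomorphic_several_mult:
  "holomorphic_several n V f \<Longrightarrow> holomorphic_several n V g \<Longrightarrow> holomorphic_several n V (\<lambda>z. f z * g z)"
  by (auto simp: holomorphic_several_def intro!: continuous_intros field_differentiable_mult)

lemma holomorphic_several_sum:
  "(\<And>k. k \<in> K \<Longrightarrow> holomorphic_several n V (f k)) \<Longrightarrow> holomorphic_several n V (\<lambda>z. \<Sum>k\<in>K. f k z)"
  by (induction K rule: infinite_finite_induct)
     (auto intro: holomorphic_several_const holomorphic_several_add)

lemma holomorphic_several_prod:
  "(\<And>k. k \<in> K \<Longrightarrow> holomorphic_several n V (f k)) \<Longrightarrow> holomorphic_several n V (\<lambda>z. \<Prod>k\<in>K. f k z)"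
  by (induction K rule: infinite_finite_induct)
     (auto intro: holomorphic_several_const holomorphic_several_mult)

lemma d_z_sum:
  assumes "\<And>k. k \<in> K \<Longrightarrow> holomorphic_several n V (f k)" "z \<in> V" "i < n"
  shows "d_z i (\<lambda>z. \<Sum>k\<in>K. f k z) z = (\<Sum>k\<in>K. d_z i (f k) z)"
  by (intro d_z_eq(1) DERIV_sum has_field_derivative_d_z) (use assms in auto)

lemma d_z_add:
  assumes "holomorphic_several n V f" "holomorphic_several n V g" "z \<in> V" "i < n"
  shows "d_z i (\<lambda>z. f z + g z) z = d_z i f z + d_z i g z"
  by (intro d_z_eq(1) DERIV_add has_field_derivative_d_z) (use assms in auto)

lemma d_z_mult:
  assumes "holomorphic_several n V f" "holomorphic_several n V g" "z \<in> V" "i < n"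
  shows "d_z i (\<lambda>z. f z * g z) z = d_z i f z * g z + f z * d_z i g z"
  by (rule d_z_eq(1))
     (use DERIV_mult'[OF has_field_derivative_d_z[OF assms(1,3,4)] has_field_derivative_d_z[OF assms(2-4)]]
      in \<open>simp add: algebra_simps\<close>)

lemma d_z_prod:
  assumes "\<And>k. k \<in> K \<Longrightarrow> holomorphic_several n V (f k)" "z \<in> V" "i < n"
  shows "d_z i (\<lambda>z. \<Prod>k\<in>K. f k z) z = (\<Sum>k\<in>K. d_z i (f k) z * (\<Prod>j\<in>K - {k}. f j z))"
  by (rule d_z_eq(1))
     (use has_field_derivative_prod[of K "\<lambda>k w. f k (z(i := w))" "\<lambda>k. d_z i (f k) z" "z i"]
        has_field_derivative_d_z[OF assms(1) assms(2,3)] in simp)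

lemma d_z_cmult:
  assumes "holomorphic_several n V f" "z \<in> V" "i < n"
  shows "d_z i (\<lambda>z. a * f z) z = a * d_z i f z"
  by (intro d_z_eq(1) DERIV_cmult has_field_derivative_d_z) (use assms in auto)

lemma d_z_const: "d_z i (\<lambda>_. a) z = 0"
  by (rule d_z_eq(1)) auto

lemma d_zbar_const: "d_zbar i (\<lambda>_. a) z = 0"
  by (rule d_z_eq(2)[where D = 0]) auto

section \<open>Cauchy estimates and difference quotients\<close>

lemma norm_d_z_le:
  assumes f: "holomorphic_several n V f" "openin (top_of_set (cspace n)) V"
    and sub: "cpolydisc n a (r + s) \<subseteq> V" and s: "s > 0" and i: "i < n" and z: "z \<in> cpolydisc n a r"
    and M: "\<And>u. u \<in> cpolydisc n a (r + s) \<Longrightarrow> cmod (f u) \<le> M"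
  shows "cmod (d_z i f z) \<le> M / s"
proof -
  have up: "z(i := w) \<in> cpolydisc n a (r + s)" if "w \<in> cball (z i) s" for w
    by (rule cpolydisc_fun_upd_shift) (use z i that s in auto)
  have hol: "(\<lambda>w. f (z(i := w))) holomorphic_on cball (z i) s"
    by (rule holomorphic_on_subset[OF holomorphic_on_slice[OF f i]]) (use up sub in blast)
  have "cmod ((deriv ^^ 1) (\<lambda>w. f (z(i := w))) (z i)) \<le> fact 1 * M / s ^ 1"
  proof (rule Cauchy_inequality)
    show "(\<lambda>w. f (z(i := w))) holomorphic_on ball (z i) s"
      using hol ball_subset_cball holomorphic_on_subset by blast
    show "continuous_on (cball (z i) s) (\<lambda>w. f (z(i := w)))"
      by (rule holomorphic_on_imp_continuous_on[OF hol])
    show "cmod (f (z(i := x))) \<le> M" if "cmod (z i - x) = s" for x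
      by (rule M[OF up]) (use that in \<open>simp add: dist_norm\<close>)
  qed (rule s)
  moreover have "z \<in> V" using up[of "z i"] sub s by auto
  ultimately show ?thesis
    using DERIV_imp_deriv[OF has_field_derivative_d_z[OF f(1) _ i]] by simp
qed

text \<open>First-order Taylor expansion, with the second derivative bounded by Cauchy's inequality
  on discs of radius \<open>r / 2\<close>; the constant is 2! times 4. It involves \<open>g\<close>
  only through \<open>M\<close>, which makes the convergence uniform when the slice varies over a
  polydisc.\<close>

lemma difference_quotient_bound:
  fixes g :: "complex \<Rightarrow> complex"
  assumes g: "g holomorphic_on S" "open S" and sub: "cball w r \<subseteq> S" and r: "r > 0"
    and M: "\<And>u. u \<in> cball w r \<Longrightarrow> cmod (g u) \<le> M"
    and h: "h \<noteq> 0" "cmod h \<le> r / 2"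
  shows "cmod ((g (w + h) - g w) / h - deriv g w) \<le> 8 * M / r\<^sup>2 * cmod h"
proof -
  have sub2: "cball u (r/2) \<subseteq> cball w r" if "u \<in> cball w (r/2)" for u
  proof
    fix v assume "v \<in> cball u (r/2)"
    then show "v \<in> cball w r" using that dist_triangle[of w v u] by simp
  qed
  have bd: "cmod (deriv (deriv g) u) \<le> 8 * M / r\<^sup>2" if u: "u \<in> cball w (r/2)" for u
  proof -
    have hol: "g holomorphic_on cball u (r/2)"
      using g(1) sub sub2[OF u] holomorphic_on_subset by blast
    have "cmod ((deriv ^^ 2) g u) \<le> fact 2 * M / (r/2) ^ 2"
    proof (rule Cauchy_inequality)
      show "g holomorphic_on ball u (r/2)"
        using hol ball_subset_cball holomorphic_on_subset by blast
      show "continuous_on (cball u (r/2)) g"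
        by (rule holomorphic_on_imp_continuous_on[OF hol])
      show "cmod (g x) \<le> M" if "cmod (u - x) = r/2" for x
        by (rule M, rule subsetD[OF sub2[OF u]]) (use that in \<open>simp add: dist_norm\<close>)
    qed (use r in simp)
    then show ?thesis by (simp add: numeral_2_eq_2 power_divide field_simps)
  qed
  have dg: "deriv g holomorphic_on S" using g holomorphic_deriv by blast
  let ?F = "\<lambda>k. (deriv ^^ k) g"
  have "cmod (?F 0 (w + h) - (\<Sum>k\<le>1. ?F k w * (w + h - w) ^ k / fact k))
      \<le> 8 * M / r\<^sup>2 * cmod (w + h - w) ^ Suc 1 / fact 1"
  proof (rule complex_Taylor[where S = "cball w (r/2)"])
    fix k :: nat and u assume u: "u \<in> cball w (r/2)" and k: "k \<le> 1"
    have "u \<in> S" using u sub r by (auto simp: subset_iff)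
    then have "(g has_field_derivative deriv g u) (at u)"
        "(deriv g has_field_derivative deriv (deriv g) u) (at u)"
      using g dg holomorphic_derivI by blast+
    then show "(?F k has_field_derivative ?F (Suc k) u) (at u within cball w (r/2))"
      using k by (cases "k = 0") (auto simp: le_Suc_eq intro: has_field_derivative_at_within)
  next
    fix u assume "u \<in> cball w (r/2)"
    then show "cmod ((deriv ^^ Suc 1) g u) \<le> 8 * M / r\<^sup>2" using bd by simp
  qed (use r h in \<open>auto simp: dist_norm\<close>)
  then have "cmod (g (w + h) - g w - deriv g w * h) \<le> 8 * M / r\<^sup>2 * cmod h ^ 2"
    by (simp add: numeral_2_eq_2 algebra_simps)
  moreover have "(g (w + h) - g w) / h - deriv g w = (g (w + h) - g w - deriv g w * h) / h"
    using h by (simp add: field_simps)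
  ultimately show ?thesis
    using h by (simp add: norm_divide divide_le_eq power2_eq_square mult.assoc)
qed

lemma uniform_limit_difference_quotient:
  assumes f: "holomorphic_several n V f" "openin (top_of_set (cspace n)) V"
    and sub: "cpolydisc n a (r + s) \<subseteq> V" and s: "s > 0" and i: "i < n"
    and h: "h \<longlonglongrightarrow> 0" "\<And>m. h m \<noteq> 0" "\<And>m. cmod (h m) \<le> s / 2"
  shows "uniform_limit (cpolydisc n a r) (\<lambda>m z. (f (z(i := z i + h m)) - f z) / h m) (d_z i f) sequentially"
proof -
  obtain M where M: "M > 0" "\<And>z. z \<in> cpolydisc n a (r + s) \<Longrightarrow> cmod (f z) \<le> M"
    using bounded_on_cpolydisc[OF continuous_on_subset[OF holomorphic_severalD(1)[OF f(1)] sub]] by blast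
  have bd: "cmod ((f (z(i := z i + h m)) - f z) / h m - d_z i f z) \<le> 8 * M / s\<^sup>2 * cmod (h m)"
    if z: "z \<in> cpolydisc n a r" for z m
  proof -
    have up: "z(i := w) \<in> cpolydisc n a (r + s)" if "w \<in> cball (z i) s" for w
      by (rule cpolydisc_fun_upd_shift) (use z i that s in auto)
    have zV: "z \<in> V" using up[of "z i"] sub s by auto
    have zc: "z \<in> cspace n" using z by (simp add: cpolydisc_def)
    have "cmod ((f (z(i := z i + h m)) - f (z(i := z i))) / h m - deriv (\<lambda>w. f (z(i := w))) (z i))
        \<le> 8 * M / s\<^sup>2 * cmod (h m)"
    proof (rule difference_quotient_bound[OF holomorphic_on_slice[OF f i] open_slice[OF f(2) zc i]])
      show "cball (z i) s \<subseteq> {w. z(i := w) \<in> V}" using up sub by blast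
      show "cmod (f (z(i := u))) \<le> M" if "u \<in> cball (z i) s" for u by (rule M(2)[OF up[OF that]])
    qed (rule s h)+
    then show ?thesis
      using DERIV_imp_deriv[OF has_field_derivative_d_z[OF f(1) zV i]] by simp
  qed
  show ?thesis
  proof (rule uniform_limitI)
    fix e :: real assume e: "e > 0"
    have "(\<lambda>m. 8 * M / s\<^sup>2 * cmod (h m)) \<longlonglongrightarrow> 8 * M / s\<^sup>2 * cmod 0"
      by (intro tendsto_intros h)
    then have "\<forall>\<^sub>F m in sequentially. 8 * M / s\<^sup>2 * cmod (h m) < e"
      using e by (intro order_tendstoD) auto
    then show "\<forall>\<^sub>F m in sequentially. \<forall>z\<in>cpolydisc n a r.
        dist ((f (z(i := z i + h m)) - f z) / h m) (d_z i f z) < e"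
    proof eventually_elim
      case (elim m)
      show ?case unfolding dist_norm by (intro ballI le_less_trans[OF bd elim])
    qed
  qed
qed

section \<open>Holomorphic and commuting partial derivatives\<close>

lemma null_sequence_exists:
  fixes s :: real assumes "s > 0"
  obtains h :: "nat \<Rightarrow> complex" where "h \<longlonglongrightarrow> 0" "\<And>m. h m \<noteq> 0" "\<And>m. cmod (h m) \<le> s"
proof
  let ?h = "\<lambda>m. complex_of_real (s * inverse (real (Suc m)))"
  have "(\<lambda>m. s * inverse (real (Suc m))) \<longlonglongrightarrow> s * 0"
    by (intro tendsto_intros LIMSEQ_inverse_real_of_nat)
  then show "?h \<longlonglongrightarrow> 0" by (metis mult_zero_right of_real_0 tendsto_of_real)
  show "?h m \<noteq> 0" for m using assms by (simp del: of_real_mult)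
  show "cmod (?h m) \<le> s" for m
    using assms by (simp only: norm_of_real) (simp add: field_simps)
qed

text \<open>Weierstrass' theorem on a slice: difference quotients in variable \<open>i\<close> are
  holomorphic in variable \<open>j\<close> and converge uniformly to \<open>d_z i f\<close>, so the
  limit is holomorphic in variable \<open>j\<close> and its derivative is the limit of the
  derivatives. The two conclusions share \<open>D\<close> because the first yields holomorphy of
  \<open>d_z i f\<close> and both together yield the symmetry of second derivatives.\<close>

lemma d_z_slice_derivative:
  assumes f: "holomorphic_several n V f" "openin (top_of_set (cspace n)) V"
    and z: "z \<in> V" and i: "i < n" and j: "j < n"
  shows "\<exists>D h. ((\<lambda>w. d_z i f (z(j := w))) has_field_derivative D) (at (z j)) \<and>
    h \<longlonglongrightarrow> 0 \<and> (\<forall>m. h m \<noteq> (0::complex)) \<and>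
    (\<lambda>m. (d_z j f (z(i := z i + h m)) - d_z j f z) / h m) \<longlonglongrightarrow> D"
proof -
  obtain t where t: "t > 0" "cpolydisc n z t \<subseteq> V"
    using openin_contains_cpolydisc[OF f(2) z] by blast
  \<comment> \<open>Half of the room is kept for the increments, so that shifted points remain in
    \<open>V\<close>.\<close>
  define r where "r = t / 2"
  have r: "r > 0" "cpolydisc n z (r + r) \<subseteq> V" using t by (auto simp: r_def)
  have zc: "z \<in> cspace n" using z openin_cspace_subset[OF f(2)] by blast
  obtain h where h: "h \<longlonglongrightarrow> 0" "\<And>m. h m \<noteq> (0::complex)" "\<And>m. cmod (h m) \<le> r / 2"
    using null_sequence_exists[of "r / 2"] r by auto
  let ?q = "\<lambda>m u. (f (u(i := u i + h m)) - f u) / h m"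
  let ?q' = "\<lambda>m u. (d_z j f (u(i := u i + h m)) - d_z j f u) / h m"
  have ul: "uniform_limit (cpolydisc n z r) ?q (d_z i f) sequentially"
    by (rule uniform_limit_difference_quotient[OF f r(2,1) i h])
  have up: "z(j := w) \<in> cpolydisc n z r" if "w \<in> cball (z j) r" for w
    using zc j that r by (auto simp: cpolydisc_def fun_upd_in_cspace)
  have up2: "u(i := u i + h m) \<in> V" if "u \<in> cpolydisc n z r" for u m
    using cpolydisc_fun_upd_add[OF that i, of "h m" r] h(3)[of m] r by auto
  have up1: "u \<in> V" if "u \<in> cpolydisc n z r" for u
    using cpolydisc_mono[of r "r + r" n z] that r by auto
  have der: "((\<lambda>w. ?q m (z(j := w))) has_field_derivative ?q' m (z(j := w))) (at w)"
    if w: "w \<in> ball (z j) r" for w m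
  proof -
    have wc: "z(j := w) \<in> cpolydisc n z r" using up w by simp
    have 1: "((\<lambda>w. f (z(j := w))) has_field_derivative d_z j f (z(j := w))) (at w)"
      by (rule has_field_derivative_d_z_slice[OF f(1) up1[OF wc] j])
    have 2: "((\<lambda>w. f ((z(j := w))(i := (z(j := w)) i + h m))) has_field_derivative
       d_z j f ((z(j := w))(i := (z(j := w)) i + h m))) (at w)"
    \<comment> \<open>For \<open>i = j\<close> the increment acts on the slice variable itself and
      amounts to a translation; otherwise it only changes the base point of the slice.\<close>
    proof (cases "i = j")
      case True
      have "((\<lambda>w. f (z(j := w))) has_field_derivative d_z j f (z(j := w + h m))) (at (w + h m))"
        by (rule has_field_derivative_d_z_slice[OF f(1) _ j]) (use up2[OF wc, of m] True in simp)
      then show ?thesis using True by (simp add: DERIV_shift)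
    next
      case False
      have "(z(i := z i + h m))(j := w) \<in> V"
        using up2[OF wc, of m] False by (simp add: fun_upd_twist)
      from has_field_derivative_d_z_slice[OF f(1) this j] show ?thesis
        using False by (simp add: fun_upd_twist)
    qed
    show ?thesis by (intro derivative_intros DERIV_cdivide DERIV_diff 1 2)
  qed
  have "\<exists>g'. \<forall>x\<in>ball (z j) r. ((\<lambda>w. d_z i f (z(j := w))) has_field_derivative g' x) (at x)
      \<and> ((\<lambda>m. ?q' m (z(j := x))) \<longlongrightarrow> g' x) sequentially"
  proof (rule has_complex_derivative_uniform_sequence[OF open_ball der])
    fix x assume x: "x \<in> ball (z j) r"
    then obtain d where d: "d > 0" "cball x d \<subseteq> ball (z j) r"
      using open_contains_cball open_ball by blast
    have "uniform_limit (cball x d) (\<lambda>m w. ?q m (z(j := w))) (\<lambda>w. d_z i f (z(j := w))) sequentially"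
    proof (rule uniform_limitI)
      fix e :: real assume "e > 0"
      from uniform_limitD[OF ul this] show "\<forall>\<^sub>F m in sequentially. \<forall>w\<in>cball x d.
        dist (?q m (z(j := w))) (d_z i f (z(j := w))) < e"
      proof eventually_elim
        case (elim m)
        show ?case
        proof
          fix w assume "w \<in> cball x d"
          then have "w \<in> cball (z j) r" using d by (meson ball_subset_cball subsetD)
          from up[OF this] elim
          show "dist (?q m (z(j := w))) (d_z i f (z(j := w))) < e" by blast
        qed
      qed
    qed
    then show "\<exists>d>0. cball x d \<subseteq> ball (z j) r \<and>
      uniform_limit (cball x d) (\<lambda>m w. ?q m (z(j := w))) (\<lambda>w. d_z i f (z(j := w))) sequentially"
      using d by blast
  qed
  then obtain g' where "\<forall>x\<in>ball (z j) r. ((\<lambda>w. d_z i f (z(j := w))) has_field_derivative g' x) (at x)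
      \<and> ((\<lambda>m. ?q' m (z(j := x))) \<longlongrightarrow> g' x) sequentially" by blast
  from bspec[OF this, of "z j"] have "((\<lambda>w. d_z i f (z(j := w))) has_field_derivative g' (z j)) (at (z j))"
    "(\<lambda>m. ?q' m z) \<longlonglongrightarrow> g' (z j)" using r by auto
  then show ?thesis using h(1,2) by blast
qed

text \<open>Differentiability in each variable is already at hand. Joint continuity is the remaining
  point: locally the derivative is a uniform limit of continuous difference quotients.\<close>

theorem holomorphic_several_d_z:
  assumes f: "holomorphic_several n V f" "openin (top_of_set (cspace n)) V" and i: "i < n"
  shows "holomorphic_several n V (d_z i f)"
  unfolding holomorphic_several_def
proof (intro conjI ballI allI impI)
  show "continuous_on V (d_z i f)"
  proof (rule continuous_on_locally)
    fix a assume a: "a \<in> V"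
    obtain t where t: "t > 0" "cpolydisc n a t \<subseteq> V"
      using openin_contains_cpolydisc[OF f(2) a] by blast
    define r where "r = t / 2"
    have r: "r > 0" "cpolydisc n a (r + r) \<subseteq> V" using t by (auto simp: r_def)
    have ac: "a \<in> cspace n" using a openin_cspace_subset[OF f(2)] by blast
    obtain h where h: "h \<longlonglongrightarrow> 0" "\<And>m. h m \<noteq> (0::complex)" "\<And>m. cmod (h m) \<le> r / 2"
      using null_sequence_exists[of "r / 2"] r by auto
    have up2: "u(i := u i + h m) \<in> V" if "u \<in> cpolydisc n a r" for u m
      using cpolydisc_fun_upd_add[OF that i, of "h m" r] h(3)[of m] r by auto
    have subV: "cpolydisc n a r \<subseteq> V"
      using cpolydisc_mono[of r "r + r" n a] r by auto
    have cf: "continuous_on V f" by (rule holomorphic_severalD(1)[OF f(1)])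
    have "continuous_on (cpolydisc n a r) (d_z i f)"
    proof (rule uniform_limit_theorem[OF _ uniform_limit_difference_quotient[OF f r(2,1) i h]])
      have "continuous_on (cpolydisc n a r) (\<lambda>z. (f (z(i := z i + h m)) - f z) / h m)" for m
      proof -
        have "continuous_on (cpolydisc n a r) (\<lambda>z. f (z(i := z i + h m)))"
          by (rule continuous_on_compose2[OF cf continuous_on_fun_upd[OF continuous_on_id]])
             (use up2 in \<open>auto intro!: continuous_on_add continuous_on_const
               continuous_on_product_then_coordinatewise[OF continuous_on_id]\<close>)
        then show ?thesis
          by (intro continuous_on_divide continuous_on_diff continuous_on_subset[OF cf subV]
              continuous_on_const ballI h)
      qed
      then show "\<forall>\<^sub>F m in sequentially. continuous_on (cpolydisc n a r) (\<lambda>z. (f (z(i := z i + h m)) - f z) / h m)"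
        by simp
    qed simp
    then have "continuous_on (polydisc n a r) (d_z i f)"
      by (rule continuous_on_subset) (rule polydisc_subset_cpolydisc, simp)
    moreover have "openin (top_of_set V) (polydisc n a r)"
      by (rule openin_subset_trans[OF openin_polydisc])
         (use subV polydisc_subset_cpolydisc[of r r n a] openin_cspace_subset[OF f(2)] in auto)
    ultimately show "\<exists>W. openin (top_of_set V) W \<and> a \<in> W \<and> continuous_on W (d_z i f)"
      using centre_in_polydisc[OF ac r(1)] by blast
  qed
next
  fix z j assume "z \<in> V" "j < n"
  then obtain D where "((\<lambda>w. d_z i f (z(j := w))) has_field_derivative D) (at (z j))"
    using d_z_slice_derivative[OF f _ i] by blast
  then show "(\<lambda>w. d_z i f (z(j := w))) field_differentiable at (z j)"
    unfolding field_differentiable_def by blast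
qed

text \<open>The limit \<open>D\<close> has two readings: it is the \<open>j\<close>-derivative of
  \<open>d_z i f\<close> by the Weierstrass argument, and the \<open>i\<close>-derivative of
  \<open>d_z j f\<close> by the very form of the quotients.\<close>

theorem d_z_commute:
  assumes f: "holomorphic_several n V f" "openin (top_of_set (cspace n)) V"
    and z: "z \<in> V" and i: "i < n" and j: "j < n"
  shows "d_z i (d_z j f) z = d_z j (d_z i f) z"
proof -
  obtain D h where D: "((\<lambda>w. d_z i f (z(j := w))) has_field_derivative D) (at (z j))"
    "h \<longlonglongrightarrow> 0" "\<And>m. h m \<noteq> (0::complex)"
    "(\<lambda>m. (d_z j f (z(i := z i + h m)) - d_z j f z) / h m) \<longlonglongrightarrow> D"
    using d_z_slice_derivative[OF f z i j] by blast
  have "((\<lambda>w. d_z j f (z(i := w))) has_field_derivative d_z i (d_z j f) z) (at (z i))"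
    by (rule has_field_derivative_d_z[OF holomorphic_several_d_z[OF f j] z i])
  then have "((\<lambda>h. (d_z j f (z(i := z i + h)) - d_z j f z) / h) \<longlongrightarrow> d_z i (d_z j f) z) (at 0)"
    by (simp add: DERIV_def)
  moreover have "filterlim h (at 0) sequentially"
    using D(2,3) by (simp add: filterlim_at)
  ultimately have "(\<lambda>m. (d_z j f (z(i := z i + h m)) - d_z j f z) / h m) \<longlonglongrightarrow> d_z i (d_z j f) z"
    by (rule filterlim_compose)
  with D(4) have "D = d_z i (d_z j f) z" using LIMSEQ_unique by blast
  then show ?thesis using d_z_eq(1)[OF D(1)] by simp
qed

section \<open>Mean value estimate and chain rule\<close>

text \<open>Passing from \<open>w\<close> to \<open>z\<close> one coordinate at a time never leaves
  the polydisc, and each stage is a one-variable mean value estimate. The free numbers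
  \<open>c i\<close> allow two uses: derivatives at a point give a first-order approximation, and
  zeros give a Lipschitz estimate.\<close>

lemma polydisc_mean_value:
  assumes f: "holomorphic_several n V f" and sub: "cpolydisc n a r \<subseteq> V"
    and z: "z \<in> cpolydisc n a r" and w: "w \<in> cpolydisc n a r"
    and bd: "\<And>u i. u \<in> cpolydisc n a r \<Longrightarrow> i < n \<Longrightarrow> cmod (d_z i f u - c i) \<le> e"
  shows "cmod (f z - f w - (\<Sum>i<n. c i * (z i - w i))) \<le> e * (\<Sum>i<n. cmod (z i - w i))"
proof -
  define u where "u k = (\<lambda>i. if i < k then z i else w i)" for k
  have uc: "u k \<in> cpolydisc n a r" for k
    using z w by (auto simp: u_def cpolydisc_def cspace_def)
  have "cmod (f (u m) - f w - (\<Sum>i<m. c i * (z i - w i))) \<le> e * (\<Sum>i<m. cmod (z i - w i))"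
    if "m \<le> n" for m
    using that
  proof (induction m)
    case 0
    have "u 0 = w" by (auto simp: u_def)
    then show ?case by simp
  next
    case (Suc m)
    then have m: "m < n" by simp
    have up: "(u m)(m := x) \<in> cpolydisc n a r" if "x \<in> cball (a m) r" for x
      using uc[of m] that m by (auto simp: cpolydisc_def fun_upd_in_cspace)
    have "cmod ((f ((u m)(m := z m)) - c m * z m) - (f ((u m)(m := w m)) - c m * w m)) \<le> e * cmod (z m - w m)"
    proof (rule field_differentiable_bound[where S = "cball (a m) r"
          and f = "\<lambda>x. f ((u m)(m := x)) - c m * x" and f' = "\<lambda>x. d_z m f ((u m)(m := x)) - c m"])
      fix x assume x: "x \<in> cball (a m) r"
      have "((\<lambda>x. f ((u m)(m := x))) has_field_derivative d_z m f ((u m)(m := x))) (at x)"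
        by (rule has_field_derivative_d_z_slice[OF f _ m]) (use up x sub in blast)
      moreover have "((\<lambda>x. c m * x) has_field_derivative c m) (at x)"
        by (rule DERIV_cmult_Id)
      ultimately show "((\<lambda>x. f ((u m)(m := x)) - c m * x) has_field_derivative d_z m f ((u m)(m := x)) - c m)
          (at x within cball (a m) r)"
        by (rule has_field_derivative_at_within[OF DERIV_diff])
      show "cmod (d_z m f ((u m)(m := x)) - c m) \<le> e"
        by (rule bd[OF up[OF x] m])
    qed (use z w m in \<open>auto simp: cpolydisc_def\<close>)
    moreover have "(u m)(m := z m) = u (Suc m)" "(u m)(m := w m) = u m"
      by (auto simp: u_def fun_eq_iff less_Suc_eq)
    ultimately have A: "cmod (f (u (Suc m)) - f (u m) - c m * (z m - w m)) \<le> e * cmod (z m - w m)"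
      by (simp add: algebra_simps)
    have "f (u (Suc m)) - f w - (\<Sum>i<Suc m. c i * (z i - w i)) =
       (f (u (Suc m)) - f (u m) - c m * (z m - w m)) + (f (u m) - f w - (\<Sum>i<m. c i * (z i - w i)))"
      by simp
    also have "cmod \<dots> \<le> e * cmod (z m - w m) + e * (\<Sum>i<m. cmod (z i - w i))"
      by (rule norm_triangle_le[OF add_mono[OF A Suc.IH]]) (use Suc.prems in simp)
    finally show ?case by (simp add: algebra_simps)
  qed
  moreover have "u n = z"
    using z w uc[of n] by (intro cspace_eqI[of _ n]) (auto simp: u_def cpolydisc_def)
  ultimately show ?thesis by (metis order_refl)
qed

lemma d_z_close_on_cpolydisc:
  assumes f: "holomorphic_several n V f" "openin (top_of_set (cspace n)) V"
    and a: "a \<in> V" and e: "e > 0"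
  obtains r where "r > 0" "cpolydisc n a r \<subseteq> V"
    "\<And>u i. u \<in> cpolydisc n a r \<Longrightarrow> i < n \<Longrightarrow> cmod (d_z i f u - d_z i f a) \<le> e"
proof -
  define W where "W i = V \<inter> (d_z i f) -` ball (d_z i f a) e" for i
  have Wo: "openin (top_of_set (cspace n)) (W i)" if "i < n" for i
  proof -
    have "openin (top_of_set V) (W i)" unfolding W_def
      by (rule continuous_openin_preimage_gen)
         (use holomorphic_severalD(1)[OF holomorphic_several_d_z[OF f that]] in auto)
    then show ?thesis using f(2) openin_trans by blast
  qed
  have "openin (top_of_set (cspace n)) (V \<inter> (\<Inter>i<n. W i))"
  \<comment> \<open>The rule for finite intersections of open sets asks for a nonempty index
    set.\<close>
  proof (cases "n = 0")
    case True then show ?thesis using f(2) by simp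
  next
    case False
    then show ?thesis using Wo f(2) by (intro openin_Int openin_INT2) auto
  qed
  moreover have "a \<in> V \<inter> (\<Inter>i<n. W i)" using a e by (auto simp: W_def)
  ultimately obtain r where r: "r > 0" "cpolydisc n a r \<subseteq> V \<inter> (\<Inter>i<n. W i)"
    using openin_contains_cpolydisc by blast
  show ?thesis
  proof (rule that[OF r(1)])
    show "cpolydisc n a r \<subseteq> V" using r(2) by blast
    fix u i assume "u \<in> cpolydisc n a r" "i < n"
    then have "u \<in> W i" using r(2) by blast
    then show "cmod (d_z i f u - d_z i f a) \<le> e"
      by (simp add: W_def dist_norm norm_minus_commute)
  qed
qed

text \<open>The remainder \<open>R\<close> of the linear approximation of \<open>f\<close> along the
  curve has derivative 0 at \<open>t\<close>: by continuity of the partial derivatives the mean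
  value estimate bounds it by a small multiple of the increments of the curve, and these are of the
  order of \<open>s - t\<close>.\<close>

theorem holomorphic_several_chain:
  assumes f: "holomorphic_several n V f" "openin (top_of_set (cspace n)) V"
    and T: "open T" "t \<in> T" "\<And>s. s \<in> T \<Longrightarrow> \<gamma> s \<in> V"
    and \<gamma>: "\<And>k. k < n \<Longrightarrow> ((\<lambda>s. \<gamma> s k) has_field_derivative \<gamma>' k) (at t)"
  shows "((\<lambda>s. f (\<gamma> s)) has_field_derivative (\<Sum>k<n. d_z k f (\<gamma> t) * \<gamma>' k)) (at t)"
proof -
  define R where "R s = f (\<gamma> s) - f (\<gamma> t) - (\<Sum>k<n. d_z k f (\<gamma> t) * (\<gamma> s k - \<gamma> t k))" for s
  have quot: "((\<lambda>s. cmod (\<gamma> s k - \<gamma> t k) / cmod (s - t)) \<longlongrightarrow> cmod (\<gamma>' k)) (at t)" if "k < n" for k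
    using tendsto_norm[OF \<gamma>[OF that, unfolded has_field_derivative_iff]] by (simp add: norm_divide)
  have Rder: "(R has_field_derivative 0) (at t)"
    unfolding has_field_derivative_iff
  proof (rule tendstoI)
    fix e :: real assume e: "e > 0"
    \<comment> \<open>\<open>L\<close> exceeds the limit of the summed difference quotients of the
      curve, hence bounds them near \<open>t\<close>; adding 1 makes this strict and
      \<open>L\<close> positive.\<close>
    define L where "L = (\<Sum>k<n. cmod (\<gamma>' k)) + 1"
    have L: "L > 0" unfolding L_def by (smt (verit) norm_ge_zero sum_nonneg)
    have "e / L > 0" using e L by simp
    then obtain r where r: "r > 0" "cpolydisc n (\<gamma> t) r \<subseteq> V"
      "\<And>u i. u \<in> cpolydisc n (\<gamma> t) r \<Longrightarrow> i < n \<Longrightarrow> cmod (d_z i f u - d_z i f (\<gamma> t)) \<le> e / L"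
      using d_z_close_on_cpolydisc[OF f T(3)[OF T(2)]] by blast
    have "((\<lambda>s. \<Sum>k<n. cmod (\<gamma> s k - \<gamma> t k) / cmod (s - t)) \<longlongrightarrow> (\<Sum>k<n. cmod (\<gamma>' k))) (at t)"
      by (intro tendsto_sum quot) auto
    then have ev1: "\<forall>\<^sub>F s in at t. (\<Sum>k<n. cmod (\<gamma> s k - \<gamma> t k) / cmod (s - t)) < L"
      by (rule order_tendstoD) (simp add: L_def)
    have ev2: "\<forall>\<^sub>F s in at t. \<forall>k\<in>{..<n}. \<gamma> s k \<in> ball (\<gamma> t k) r"
    proof (rule eventually_ball_finite)
      show "\<forall>k\<in>{..<n}. \<forall>\<^sub>F s in at t. \<gamma> s k \<in> ball (\<gamma> t k) r"
      proof
        fix k assume "k \<in> {..<n}"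
        then have "((\<lambda>s. \<gamma> s k) \<longlongrightarrow> \<gamma> t k) (at t)"
          using DERIV_isCont[OF \<gamma>[of k]] by (simp add: isCont_def)
        from tendstoD[OF this r(1)] show "\<forall>\<^sub>F s in at t. \<gamma> s k \<in> ball (\<gamma> t k) r"
          by (simp add: dist_commute)
      qed
    qed simp
    have ev3: "\<forall>\<^sub>F s in at t. s \<in> T" using T eventually_at_in_open' by blast
    have ev4: "\<forall>\<^sub>F s in at t. s \<noteq> t" by (simp add: eventually_at_filter)
    from ev1 ev2 ev3 ev4 show "\<forall>\<^sub>F s in at t. dist ((R s - R t) / (s - t)) 0 < e"
    proof eventually_elim
      case (elim s)
      have sc: "\<gamma> s \<in> cpolydisc n (\<gamma> t) r" "\<gamma> t \<in> cpolydisc n (\<gamma> t) r"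
        using elim T r openin_cspace_subset[OF f(2)] unfolding cpolydisc_def by (auto simp: less_imp_le)
      have "cmod (R s) \<le> e / L * (\<Sum>k<n. cmod (\<gamma> s k - \<gamma> t k))"
        unfolding R_def by (rule polydisc_mean_value[OF f(1) r(2) sc r(3)])
      then have "cmod (R s) / cmod (s - t) \<le> e / L * (\<Sum>k<n. cmod (\<gamma> s k - \<gamma> t k)) / cmod (s - t)"
        using divide_right_mono norm_ge_zero by blast
      also have "\<dots> = e / L * (\<Sum>k<n. cmod (\<gamma> s k - \<gamma> t k) / cmod (s - t))"
        by (simp only: times_divide_eq_right sum_divide_distrib[symmetric])
      also have "\<dots> < e / L * L"
        using elim(1) \<open>e / L > 0\<close> by (rule mult_strict_left_mono)
      also have "\<dots> = e" using L by simp
      finally show ?case by (simp add: norm_divide R_def)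
    qed
  qed
  have "((\<lambda>s. R s + f (\<gamma> t) + (\<Sum>k<n. d_z k f (\<gamma> t) * (\<gamma> s k - \<gamma> t k))) has_field_derivative
      0 + 0 + (\<Sum>k<n. d_z k f (\<gamma> t) * (\<gamma>' k - 0))) (at t)"
    by (intro DERIV_add Rder DERIV_const DERIV_sum DERIV_cmult DERIV_diff \<gamma>) auto
  moreover have "(\<lambda>s. R s + f (\<gamma> t) + (\<Sum>k<n. d_z k f (\<gamma> t) * (\<gamma> s k - \<gamma> t k))) = (\<lambda>s. f (\<gamma> s))"
    by (auto simp: R_def)
  ultimately show ?thesis by simp
qed

lemma chain_rule_transition:
  assumes f: "holomorphic_several n V f" "openin (top_of_set (cspace n)) V"
    and U: "openin (top_of_set (cspace n)) U" "\<And>u. u \<in> U \<Longrightarrow> \<tau> u \<in> V"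
    and \<tau>: "\<And>k. k < n \<Longrightarrow> holomorphic_several n U (\<lambda>u. \<tau> u k)"
  shows "holomorphic_several n U (\<lambda>u. f (\<tau> u))"
    and "z \<in> U \<Longrightarrow> i < n \<Longrightarrow> d_z i (\<lambda>u. f (\<tau> u)) z = (\<Sum>k<n. d_z k f (\<tau> z) * d_z i (\<lambda>u. \<tau> u k) z)"
proof -
  have der: "((\<lambda>w. f (\<tau> (z(i := w)))) has_field_derivative (\<Sum>k<n. d_z k f (\<tau> z) * d_z i (\<lambda>u. \<tau> u k) z)) (at (z i))"
    if z: "z \<in> U" and i: "i < n" for z i
  proof -
    have zc: "z \<in> cspace n" using z openin_cspace_subset[OF U(1)] by blast
    have "((\<lambda>w. f (\<tau> (z(i := w)))) has_field_derivative
        (\<Sum>k<n. d_z k f (\<tau> (z(i := z i))) * d_z i (\<lambda>u. \<tau> u k) z)) (at (z i))"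
    proof (rule holomorphic_several_chain[OF f open_slice[OF U(1) zc i]])
      fix k assume "k < n"
      then show "((\<lambda>s. \<tau> (z(i := s)) k) has_field_derivative d_z i (\<lambda>u. \<tau> u k) z) (at (z i))"
        using has_field_derivative_d_z[OF \<tau> z i] by simp
    qed (use z U in auto)
    then show ?thesis by simp
  qed
  show "d_z i (\<lambda>u. f (\<tau> u)) z = (\<Sum>k<n. d_z k f (\<tau> z) * d_z i (\<lambda>u. \<tau> u k) z)" if "z \<in> U" "i < n"
    by (rule d_z_eq(1)[OF der[OF that]])
  have "continuous_on U \<tau>"
  proof (rule continuous_on_coordinatewise_then_product)
    fix k show "continuous_on U (\<lambda>u. \<tau> u k)"
    proof (cases "k < n")
      case True then show ?thesis using holomorphic_severalD(1)[OF \<tau>] by blast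
    next
      case False
      \<comment> \<open>The values of \<tau> lie in \<open>V\<close>, which is part of
        \<open>cspace n\<close>.\<close>
      then have "\<tau> u k = 0" if "u \<in> U" for u
        using U(2)[OF that] openin_cspace_subset[OF f(2)] by (auto simp: cspace_def)
      then show ?thesis by (simp cong: continuous_on_cong)
    qed
  qed
  then have "continuous_on U (\<lambda>u. f (\<tau> u))"
    by (rule continuous_on_compose2[OF holomorphic_severalD(1)[OF f(1)]]) (use U in auto)
  then show "holomorphic_several n U (\<lambda>u. f (\<tau> u))"
    unfolding holomorphic_several_def field_differentiable_def using der by blast
qed

section \<open>Smoothness and the Cauchy-Riemann equations\<close>

text \<open>A further real partial derivative in direction \<open>e\<close> is \<open>e\<close>
  times \<open>d_z\<close>, which preserves holomorphy. The auxiliary \<open>g\<close> appears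
  because nothing is known about iterated derivatives outside \<open>V\<close>.\<close>

lemma iter_pd_holomorphic:
  assumes f: "holomorphic_several n V f" and V: "openin (top_of_set (cspace n)) V"
  shows "set ds \<subseteq> {..<n} \<times> UNIV \<Longrightarrow> \<exists>g. holomorphic_several n V g \<and> (\<forall>z\<in>V. iter_pd ds f z = g z)"
proof (induction ds)
  case Nil then show ?case using f by (auto simp: iter_pd_def)
next
  case (Cons d ds)
  obtain i e where d: "d = (i, e)" by (cases d)
  then have i: "i < n" using Cons.prems by auto
  from Cons obtain g where g: "holomorphic_several n V g" "\<And>z. z \<in> V \<Longrightarrow> iter_pd ds f z = g z" by auto
  have "iter_pd (d # ds) f z = e * d_z i g z" if z: "z \<in> V" for z
  proof -
    have "iter_pd (d # ds) f z = real_pd i e (iter_pd ds f) z" by (simp add: iter_pd_def d)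
    also have "\<dots> = real_pd i e g z" by (rule real_pd_cong[OF V z i g(2)])
    also have "\<dots> = e * d_z i g z" by (rule real_pd_eq[OF has_field_derivative_d_z[OF g(1) z i]])
    finally show ?thesis .
  qed
  moreover have "holomorphic_several n V (\<lambda>z. e * d_z i g z)"
    by (intro holomorphic_several_mult holomorphic_several_const holomorphic_several_d_z[OF g(1) V i])
  ultimately show ?case by blast
qed

theorem smooth_on_holomorphic:
  assumes f: "holomorphic_several n V f" and V: "openin (top_of_set (cspace n)) V"
  shows "smooth_on n V f"
  unfolding smooth_on_def
proof (intro allI impI conjI ballI)
  fix ds assume ds: "set ds \<subseteq> {..<n} \<times> {1, \<i>}"
  obtain g where g: "holomorphic_several n V g" "\<And>z. z \<in> V \<Longrightarrow> iter_pd ds f z = g z"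
    using iter_pd_holomorphic[OF f V, of ds] ds by blast
  show "continuous_on V (iter_pd ds f)"
    using holomorphic_severalD(1)[OF g(1)] g(2) by (simp cong: continuous_on_cong)
  fix z i and e :: complex assume z: "z \<in> V" and i: "i < n"
  have "((\<lambda>t::real. g (z(i := z i + of_real t * e))) has_vector_derivative (e * d_z i g z)) (at 0)"
    by (rule real_pd_has_vector_derivative[OF has_field_derivative_d_z[OF g(1) z i]])
  moreover have "\<forall>\<^sub>F t in nhds (0::real). iter_pd ds f (z(i := z i + of_real t * e)) = g (z(i := z i + of_real t * e))"
    using eventually_slice[OF V z i, of e] by eventually_elim (rule g(2))
  ultimately have "((\<lambda>t::real. iter_pd ds f (z(i := z i + of_real t * e))) has_vector_derivative (e * d_z i g z)) (at 0)"
    by (subst has_vector_derivative_cong_ev) (auto elim: eventually_mono dest: eventually_nhds_x_imp_x)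
  then show "(\<lambda>t::real. iter_pd ds f (z(i := z i + of_real t * e))) differentiable at 0"
    by (rule differentiableI_vector)
qed

text \<open>Continuous partial derivatives give real differentiability, and a partial derivative in
  y equal to \<i> times the one in x makes the real differential multiplication by
  \<open>P w0\<close>.\<close>

lemma Cauchy_Riemann_partials:
  fixes g :: "complex \<Rightarrow> complex"
  assumes S: "open S" "w0 \<in> S"
    and P: "\<And>w. w \<in> S \<Longrightarrow> ((\<lambda>t::real. g (w + of_real t)) has_vector_derivative P w) (at 0)"
    and Q: "\<And>w. w \<in> S \<Longrightarrow> ((\<lambda>t::real. g (w + of_real t * \<i>)) has_vector_derivative \<i> * P w) (at 0)"
    and cont: "continuous_on S P"
  shows "(g has_field_derivative P w0) (at w0)"
proof -
  \<comment> \<open>The theorem on partial derivatives is applied on a rectangle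
    \<open>X \<times> Y\<close> of half-side \<open>d\<close>; by the triangle inequality it lies in
    the disc of radius \<open>2 * d\<close>.\<close>
  obtain d where d: "d > 0" "ball w0 (2 * d) \<subseteq> S"
  proof -
    obtain e where "e > 0" "ball w0 e \<subseteq> S" using S open_contains_ball by blast
    then show ?thesis using that[of "e / 2"] by simp
  qed
  define X where "X = ball (Re w0) d"
  define Y where "Y = ball (Im w0) d"
  have S': "Complex x y \<in> S" if "x \<in> X" "y \<in> Y" for x y
  proof -
    have "cmod (w0 - Complex x y) \<le> \<bar>Re w0 - x\<bar> + \<bar>Im w0 - y\<bar>"
      using cmod_le[of "w0 - Complex x y"] by simp
    also have "\<dots> < 2 * d" using that by (auto simp: X_def Y_def dist_real_def)
    finally show ?thesis using d(2) by (auto simp: dist_norm)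
  qed
  let ?f = "\<lambda>x y. g (Complex x y)"
  have w0: "Re w0 \<in> X" "Im w0 \<in> Y" using d by (auto simp: X_def Y_def)
  have dx: "((\<lambda>x. ?f x y) has_vector_derivative P (Complex x y)) (at x)" if "x \<in> X" "y \<in> Y" for x y
  proof -
    have "((\<lambda>t. g (Complex x y + of_real t)) \<circ> (\<lambda>u. u - x) has_vector_derivative 1 *\<^sub>R P (Complex x y)) (at x)"
    proof (rule vector_diff_chain_at)
      show "((\<lambda>u. u - x) has_vector_derivative 1) (at x)"
        by (rule has_vector_derivative_eq_rhs, (rule derivative_intros)+) simp
    qed (use P[OF S'[OF that]] in simp)
    moreover have "Complex x y + of_real (u - x) = Complex u y" for u by (simp add: complex_eq_iff)
    ultimately show ?thesis by (simp add: o_def)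
  qed
  have dy: "((\<lambda>y. ?f x y) has_vector_derivative \<i> * P (Complex x y)) (at y)" if "x \<in> X" "y \<in> Y" for x y
  proof -
    have "((\<lambda>t. g (Complex x y + of_real t * \<i>)) \<circ> (\<lambda>u. u - y) has_vector_derivative 1 *\<^sub>R (\<i> * P (Complex x y))) (at y)"
    proof (rule vector_diff_chain_at)
      show "((\<lambda>u. u - y) has_vector_derivative 1) (at y)"
        by (rule has_vector_derivative_eq_rhs, (rule derivative_intros)+) simp
    qed (use Q[OF S'[OF that]] in simp)
    moreover have "Complex x y + of_real (u - y) * \<i> = Complex x u" for u by (simp add: complex_eq_iff)
    ultimately show ?thesis by (simp add: o_def)
  qed
  have contC: "continuous_on (X \<times> Y) (\<lambda>(x, y). P (Complex x y))"
    unfolding case_prod_unfold Complex_eq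
    by (rule continuous_on_compose2[OF cont])
       (use S' in \<open>auto intro!: continuous_intros simp: Complex_eq[symmetric]\<close>)
  have "((\<lambda>(x, y). ?f x y) has_derivative
      (\<lambda>(tx, ty). tx *\<^sub>R P (Complex (Re w0) (Im w0)) +
        blinfun_apply (blinfun_scaleR_left (\<i> * P (Complex (Re w0) (Im w0)))) ty))
      (at (Re w0, Im w0) within X \<times> Y)"
  proof (rule has_derivative_partialsI)
    show "((\<lambda>x. ?f x (Im w0)) has_derivative (\<lambda>tx. tx *\<^sub>R P (Complex (Re w0) (Im w0)))) (at (Re w0) within X)"
      using has_vector_derivative_at_within[OF dx[OF w0]] by (simp add: has_vector_derivative_def)
    show "((\<lambda>y. ?f x y) has_derivative blinfun_apply (blinfun_scaleR_left (\<i> * P (Complex x y)))) (at y within Y)"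
      if "x \<in> X" "y \<in> Y" for x y
      using has_vector_derivative_at_within[OF dy[OF that]]
      by (simp add: has_vector_derivative_def blinfun_scaleR_left.rep_eq)
    show "continuous (at (Re w0, Im w0) within X \<times> Y) (\<lambda>(x, y). blinfun_scaleR_left (\<i> * P (Complex x y)))"
    proof -
      have "continuous_on (X \<times> Y) (\<lambda>z. blinfun_scaleR_left (\<i> * (case z of (x, y) \<Rightarrow> P (Complex x y))))"
        by (intro bounded_linear.continuous_on[OF bounded_linear_blinfun_scaleR_left] continuous_intros contC)
      then show ?thesis
        using w0 by (simp add: continuous_on_eq_continuous_within case_prod_unfold)
    qed
  qed (use w0 in \<open>auto simp: Y_def\<close>)
  moreover have "at (Re w0, Im w0) within X \<times> Y = at (Re w0, Im w0)"
    by (rule at_within_open) (use w0 in \<open>auto simp: X_def Y_def open_Times\<close>)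
  ultimately have "((\<lambda>(x, y). ?f x y) has_derivative
      (\<lambda>(tx, ty). tx *\<^sub>R P w0 + ty *\<^sub>R (\<i> * P w0))) (at (Re w0, Im w0))"
    by (simp add: blinfun_scaleR_left.rep_eq)
  moreover have "((\<lambda>w. (Re w, Im w)) has_derivative (\<lambda>t. (Re t, Im t))) (at w0)"
    by (intro has_derivative_Pair bounded_linear_imp_has_derivative bounded_linear_Re bounded_linear_Im)
  ultimately have "((\<lambda>(x, y). ?f x y) \<circ> (\<lambda>w. (Re w, Im w)) has_derivative
      (\<lambda>(tx, ty). tx *\<^sub>R P w0 + ty *\<^sub>R (\<i> * P w0)) \<circ> (\<lambda>t. (Re t, Im t))) (at w0)"
    using diff_chain_at by blast
  moreover have "(\<lambda>(tx, ty). tx *\<^sub>R P w0 + ty *\<^sub>R (\<i> * P w0)) \<circ> (\<lambda>t. (Re t, Im t)) = (*) (P w0)"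
    by (auto simp: fun_eq_iff complex_eq_iff algebra_simps)
  ultimately show ?thesis by (simp add: has_field_derivative_def o_def)
qed

theorem holomorphic_several_if_d_zbar_zero:
  assumes f: "smooth_on n V f" and V: "openin (top_of_set (cspace n)) V"
    and dbar: "\<And>z i. z \<in> V \<Longrightarrow> i < n \<Longrightarrow> d_zbar i f z = 0"
  shows "holomorphic_several n V f"
  unfolding holomorphic_several_def
proof (intro conjI ballI allI impI)
  have s0: "continuous_on V f"
    "\<And>z i e. z \<in> V \<Longrightarrow> i < n \<Longrightarrow> e \<in> {1, \<i>} \<Longrightarrow> (\<lambda>t::real. f (z(i := z i + of_real t * e))) differentiable (at 0)"
    using f[unfolded smooth_on_def, rule_format, of "[]"] by (auto simp: iter_pd_def)
  show "continuous_on V f" by (rule s0)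
  fix z i assume z: "z \<in> V" and i: "i < n"
  have zc: "z \<in> cspace n" using z openin_cspace_subset[OF V] by blast
  have vd: "((\<lambda>t::real. f (u(i := u i + of_real t * e))) has_vector_derivative real_pd i e f u) (at 0)"
    if "u \<in> V" "e \<in> {1, \<i>}" for u e
    unfolding real_pd_def using s0(2)[OF that(1) i that(2)] vector_derivative_works by blast
  have Qeq: "real_pd i \<i> f u = \<i> * real_pd i 1 f u" if "u \<in> V" for u
  proof -
    have "real_pd i 1 f u + \<i> * real_pd i \<i> f u = 0" using dbar[OF that i] by (simp add: d_zbar_def)
    \<comment> \<open>Multiplying by \<i> solves the equation for the derivative in direction
      \<i>.\<close>
    then have "\<i> * (real_pd i 1 f u + \<i> * real_pd i \<i> f u) = 0" by simp
    then show ?thesis by (simp add: algebra_simps flip: mult.assoc)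
  qed
  have cpd: "continuous_on V (real_pd i 1 f)"
    using f[unfolded smooth_on_def, rule_format, of "[(i, 1)]"] i by (auto simp: iter_pd_def)
  have "((\<lambda>w. f (z(i := w))) has_field_derivative real_pd i 1 f (z(i := z i))) (at (z i))"
  proof (rule Cauchy_Riemann_partials[OF open_slice[OF V zc i], where P = "\<lambda>w. real_pd i 1 f (z(i := w))"])
    show "continuous_on {w. z(i := w) \<in> V} (\<lambda>w. real_pd i 1 f (z(i := w)))"
      by (rule continuous_on_compose2[OF cpd continuous_on_fun_upd[OF continuous_on_const continuous_on_id]]) auto
  next
    fix w assume w: "w \<in> {w. z(i := w) \<in> V}"
    show "((\<lambda>t::real. f (z(i := w + of_real t))) has_vector_derivative real_pd i 1 f (z(i := w))) (at 0)"
      using vd[of "z(i := w)" 1] w by simp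
    show "((\<lambda>t::real. f (z(i := w + of_real t * \<i>))) has_vector_derivative \<i> * real_pd i 1 f (z(i := w))) (at 0)"
      using vd[of "z(i := w)" \<i>] Qeq[of "z(i := w)"] w by simp
  qed (use z in auto)
  then show "(\<lambda>w. f (z(i := w))) field_differentiable at (z i)"
    unfolding field_differentiable_def by blast
qed

section \<open>Alternating functions of index lists\<close>

definition alternating :: "('b list \<Rightarrow> 'a::ab_group_add) \<Rightarrow> bool" where
  "alternating f \<longleftrightarrow> (\<forall>P x y R. f (P @ x # y # R) = - f (P @ y # x # R))"

lemma alternatingD: "alternating f \<Longrightarrow> f (P @ x # y # R) = - f (P @ y # x # R)"
  unfolding alternating_def by blast

lemma swap_entries_append:
  "swap_entries (length P) (Suc (length P + length Q)) (P @ x # Q @ y # R) = P @ y # Q @ x # R"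
  by (simp add: swap_entries_def nth_append list_update_append)

lemma alternating_if_swap_entries:
  assumes "\<And>I a b. a < b \<Longrightarrow> b < length I \<Longrightarrow> f (swap_entries a b I) = - f I"
  shows "alternating f"
  unfolding alternating_def
proof (intro allI)
  fix P x y R
  have "f (swap_entries (length P) (Suc (length P)) (P @ y # x # R)) = - f (P @ y # x # R)"
    by (rule assms) auto
  then show "f (P @ x # y # R) = - f (P @ y # x # R)"
    using swap_entries_append[of P "[]" y x R] by simp
qed

lemma alternating_move:
  fixes f :: "'b list \<Rightarrow> complex"
  assumes "alternating f"
  shows "f (P @ x # Q @ R) = (-1) ^ length Q * f (P @ Q @ x # R)"
proof (induction Q arbitrary: P)
  case (Cons y Q)
  have "f (P @ x # (y # Q) @ R) = - f ((P @ [y]) @ x # Q @ R)"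
    using alternatingD[OF assms, of P x y "Q @ R"] by simp
  then show ?case unfolding Cons.IH by simp
qed simp

text \<open>Moving the front entry past \<open>Q\<close> costs the same sign before and after the
  exchange; what remains is one exchange of neighbours.\<close>

lemma alternating_swap_entries:
  fixes f :: "nat list \<Rightarrow> complex"
  assumes f: "alternating f" and ab: "a < b" "b < length I"
  shows "f (swap_entries a b I) = - f I"
proof -
  define P where "P = take a I"
  define Q where "Q = take (b - Suc a) (drop (Suc a) I)"
  define R where "R = drop (Suc b) I"
  have "drop (Suc a) I = Q @ drop (b - Suc a) (drop (Suc a) I)"
    unfolding Q_def by (rule append_take_drop_id[symmetric])
  also have "drop (b - Suc a) (drop (Suc a) I) = I ! b # R"
    using ab by (simp add: R_def Cons_nth_drop_Suc)
  finally have I: "I = P @ I ! a # Q @ I ! b # R"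
    using id_take_nth_drop[of a I] ab by (simp add: P_def)
  have len: "length P = a" "Suc (length P + length Q) = b" using ab by (auto simp: P_def Q_def)
  have "swap_entries a b I = P @ I ! b # Q @ I ! a # R"
    using swap_entries_append[of P Q "I ! a" "I ! b" R] I len by simp
  then show ?thesis
    using alternating_move[OF f, of P "I ! b" Q "I ! a # R"]
      alternating_move[OF f, of P "I ! a" Q "I ! b # R"]
      alternatingD[OF f, of "P @ Q" "I ! b" "I ! a" R] I by simp
qed

section \<open>Inserting and removing entries\<close>

definition insert_entry :: "nat \<Rightarrow> nat \<Rightarrow> nat list \<Rightarrow> nat list" where
  "insert_entry a x M = take a M @ x # drop a M"

lemma length_remove_entry: "a < length I \<Longrightarrow> length (remove_entry a I) = length I - 1"
  by (simp add: remove_entry_def)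

lemma length_insert_entry: "length (insert_entry a x M) = Suc (length M)"
  by (simp add: insert_entry_def)

lemma set_remove_entry: "set (remove_entry a I) \<subseteq> set I"
  by (auto simp: remove_entry_def dest: in_set_takeD in_set_dropD)

lemma set_insert_entry: "set (insert_entry a x M) = insert x (set M)"
  by (metis Un_insert_right append_take_drop_id insert_entry_def list.simps(15) set_append)

lemma remove_insert_entry: "a \<le> length M \<Longrightarrow> remove_entry a (insert_entry a x M) = M"
  by (simp add: remove_entry_def insert_entry_def)

lemma insert_remove_entry: "a < length I \<Longrightarrow> insert_entry a (I ! a) (remove_entry a I) = I"
  by (simp add: remove_entry_def insert_entry_def id_take_nth_drop[symmetric])

lemma nth_insert_entry_same: "a \<le> length M \<Longrightarrow> insert_entry a x M ! a = x"
  by (simp add: insert_entry_def nth_append)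

lemma nth_remove_entry:
  assumes "a < length I" "b < length I - 1"
  shows "remove_entry a I ! b = (if b < a then I ! b else I ! Suc b)"
  using assms by (auto simp: remove_entry_def nth_append)

lemma remove_entry_commute:
  assumes "b < a" "a < length I"
  shows "remove_entry b (remove_entry a I) = remove_entry (a - 1) (remove_entry b I)"
proof (rule nth_equalityI)
  show "length (remove_entry b (remove_entry a I)) = length (remove_entry (a - 1) (remove_entry b I))"
    using assms by (simp add: length_remove_entry)
  fix i assume "i < length (remove_entry b (remove_entry a I))"
  then have "i < length I - 2" using assms by (simp add: length_remove_entry)
  then show "remove_entry b (remove_entry a I) ! i = remove_entry (a - 1) (remove_entry b I) ! i"
    using assms by (auto simp: nth_remove_entry length_remove_entry)
qed

lemma alternating_insert_entry:
  fixes f :: "nat list \<Rightarrow> complex"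
  assumes "alternating f" "a \<le> length M"
  shows "f (insert_entry a x M) = (-1) ^ a * f (x # M)"
proof -
  have "f (x # M) = (-1) ^ a * f (insert_entry a x M)"
    using alternating_move[OF assms(1), of "[]" x "take a M" "drop a M"] assms(2)
    by (simp add: insert_entry_def min_def)
  then have "(-1) ^ a * f (x # M) = ((-1) ^ a * (-1) ^ a) * f (insert_entry a x M)" by simp
  also have "(-1::complex) ^ a * (-1) ^ a = 1" by (simp flip: power_mult_distrib)
  finally show ?thesis by simp
qed

text \<open>Removing two entries in either order gives opposite signs.\<close>

lemma sum_remove_two_entries:
  fixes F :: "nat \<Rightarrow> nat \<Rightarrow> nat list \<Rightarrow> complex"
  assumes sym: "\<And>x y M. x \<in> set I \<Longrightarrow> y \<in> set I \<Longrightarrow> F x y M = F y x M"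
  shows "(\<Sum>a<length I. \<Sum>b<length I - 1.
    (-1) ^ a * ((-1) ^ b * F (I ! a) (remove_entry a I ! b) (remove_entry b (remove_entry a I)))) = 0"
proof -
  define S where "S = {..<length I} \<times> {..<length I - 1}"
  define g where "g = (\<lambda>(a, b). (-1) ^ a * ((-1) ^ b *
     F (I ! a) (remove_entry a I ! b) (remove_entry b (remove_entry a I))))"
  \<comment> \<open>A pair \<open>(a, b)\<close> removes entry \<open>a\<close> and then entry
    \<open>b\<close> of the shortened list. This involution performs the two removals in the other
    order; the shift by one, needed because the second position refers to the shortened list, flips
    the parity of \<open>a + b\<close>.\<close>
  define \<sigma> where "\<sigma> = (\<lambda>(a, b). if b < a then (b, a - 1) else (Suc b, a :: nat))"
  have \<sigma>: "\<sigma> s \<in> S" "\<sigma> (\<sigma> s) = s" if "s \<in> S" for s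
    using that by (auto simp: S_def \<sigma>_def split: if_splits)
  have "g (\<sigma> s) = - g s" if s: "s \<in> S" for s
  proof -
    obtain a b where ab: "s = (a, b)" by (cases s)
    then have lt: "a < length I" "b < length I - 1" using s by (auto simp: S_def)
    show ?thesis
    proof (cases "b < a")
      case True
      then obtain a' where a': "a = Suc a'" by (cases a) auto
      have "F (I ! b) (I ! a) (remove_entry b (remove_entry a I)) = F (I ! a) (I ! b) (remove_entry b (remove_entry a I))"
        by (rule sym) (use lt True in auto)
      then show ?thesis
        using True lt remove_entry_commute[OF True lt(1)]
        by (simp add: ab g_def \<sigma>_def nth_remove_entry a')
    next
      case False
      then have "remove_entry a (remove_entry (Suc b) I) = remove_entry b (remove_entry a I)"
        using remove_entry_commute[of a "Suc b" I] lt by simp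
      moreover have "F (I ! Suc b) (I ! a) (remove_entry b (remove_entry a I)) = F (I ! a) (I ! Suc b) (remove_entry b (remove_entry a I))"
        by (rule sym) (use lt in auto)
      ultimately show ?thesis
        using False lt by (simp add: ab g_def \<sigma>_def nth_remove_entry)
    qed
  qed
  then have "sum g S = sum (\<lambda>s. - g s) S"
    by (intro sum.reindex_bij_witness[of S \<sigma> \<sigma>]) (auto simp: \<sigma>)
  then have "sum g S = 0" by (simp add: sum_negf)
  moreover have "sum g S = (\<Sum>a<length I. \<Sum>b<length I - 1.
    (-1) ^ a * ((-1) ^ b * F (I ! a) (remove_entry a I ! b) (remove_entry b (remove_entry a I))))"
    by (simp add: S_def g_def sum.cartesian_product)
  ultimately show ?thesis by simp
qed

text \<open>Exchanging the entries at \<open>k\<close> and \<open>k + 1\<close> carries the terms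
  that remove one of them into each other, with opposite powers of -1 and the same remaining list.
  In all other terms the exchange happens inside the argument of \<open>G\<close>.\<close>

lemma alternating_alternating_sum:
  fixes G :: "nat \<Rightarrow> nat list \<Rightarrow> complex"
  assumes G: "\<And>x. alternating (G x)"
  shows "alternating (\<lambda>I. \<Sum>a<length I. (-1) ^ a * G (I ! a) (remove_entry a I))"
  unfolding alternating_def
proof (intro allI)
  fix P R :: "nat list" and x y
  define k where "k = length P"
  define m where "m = length (P @ x # y # R)"
  define \<sigma> where "\<sigma> a = (if a = k then Suc k else if a = Suc k then k else a)" for a
  let ?t = "\<lambda>I a. (-1) ^ a * G (I ! a) (remove_entry a I)"
  have m: "m = Suc (Suc (k + length R))" by (simp add: m_def k_def)
  have t: "?t (P @ y # x # R) (\<sigma> a) = - ?t (P @ x # y # R) a" if "a < m" for a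
  proof -
    consider "a < k" | "a = k" | "a = Suc k" | "a > Suc k" by linarith
    then show ?thesis
    proof cases
      case 1
      then show ?thesis
        using alternatingD[OF G, of "P ! a" "remove_entry a P" y x R]
        by (simp add: \<sigma>_def k_def remove_entry_def nth_append)
    next
      case 2 then show ?thesis by (simp add: \<sigma>_def k_def remove_entry_def nth_append)
    next
      case 3 then show ?thesis by (simp add: \<sigma>_def k_def remove_entry_def nth_append)
    next
      case 4
      then obtain b where b: "a = Suc (Suc (k + b))"
        by (metis Suc_leI add_Suc le_Suc_ex)
      show ?thesis
        using alternatingD[OF G, of "R ! b" P y x "remove_entry b R"]
        by (simp add: b \<sigma>_def k_def remove_entry_def nth_append eval_nat_numeral)
    qed
  qed
  have "(\<Sum>a<m. ?t (P @ x # y # R) a) = (\<Sum>a<m. - ?t (P @ y # x # R) a)"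
    by (rule sum.reindex_bij_witness[of _ \<sigma> \<sigma>]) (use t in \<open>auto simp: \<sigma>_def m\<close>)
  then show "(\<Sum>a<length (P @ x # y # R). ?t (P @ x # y # R) a) = - (\<Sum>a<length (P @ y # x # R). ?t (P @ y # x # R) a)"
    by (simp add: m_def sum_negf)
qed

section \<open>Sums over index lists and products of matrix entries\<close>

lemma multi_indices_int: "multi_indices n (int p) = {I. set I \<subseteq> {..<n} \<and> length I = p}"
  by (auto simp: multi_indices_def)

lemma finite_multi_indices: "finite (multi_indices n (int p))"
  unfolding multi_indices_int by (rule finite_lists_length_eq) simp

text \<open>The position \<open>a\<close> is left free so that each term can be split at the very
  entry that it singles out.\<close>

lemma sum_multi_indices_Suc:
  fixes g :: "nat list \<Rightarrow> complex"
  assumes "a \<le> p"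
  shows "(\<Sum>L\<in>multi_indices n (int (Suc p)). g L) =
    (\<Sum>k<n. \<Sum>K\<in>multi_indices n (int p). g (insert_entry a k K))"
proof -
  have "(\<Sum>L\<in>multi_indices n (int (Suc p)). g L) =
     (\<Sum>(k, K)\<in>{..<n} \<times> multi_indices n (int p). g (insert_entry a k K))"
  proof (rule sum.reindex_bij_witness[where i = "\<lambda>(k, K). insert_entry a k K" and j = "\<lambda>L. (L ! a, remove_entry a L)"])
    fix L assume "L \<in> multi_indices n (int (Suc p))"
    then have L: "set L \<subseteq> {..<n}" "length L = Suc p" unfolding multi_indices_int by auto
    then show "(case (L ! a, remove_entry a L) of (k, K) \<Rightarrow> insert_entry a k K) = L"
      using assms by (simp add: insert_remove_entry)
    have "L ! a \<in> set L" using L assms by simp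
    then have "L ! a < n" using L by blast
    then show "(L ! a, remove_entry a L) \<in> {..<n} \<times> multi_indices n (int p)"
      using L assms set_remove_entry[of a L] by (auto simp: multi_indices_int length_remove_entry)
    show "(case (L ! a, remove_entry a L) of (k, K) \<Rightarrow> g (insert_entry a k K)) = g L"
      using L assms by (simp add: insert_remove_entry)
  next
    fix b assume b: "b \<in> {..<n} \<times> multi_indices n (int p)"
    then show "(case b of (k, K) \<Rightarrow> insert_entry a k K) \<in> multi_indices n (int (Suc p))"
      unfolding multi_indices_int by (auto simp: set_insert_entry length_insert_entry)
    show "((case b of (k, K) \<Rightarrow> insert_entry a k K) ! a, remove_entry a (case b of (k, K) \<Rightarrow> insert_entry a k K)) = b"
      using b assms by (auto simp: multi_indices_int nth_insert_entry_same remove_insert_entry)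
  qed
  then show ?thesis by (simp add: sum.cartesian_product)
qed

text \<open>The product in \<open>jacobian_prod\<close> for an arbitrary matrix, so that the algebra
  can be done without charts.\<close>

definition entry_prod :: "(nat \<Rightarrow> nat \<Rightarrow> complex) \<Rightarrow> nat list \<Rightarrow> nat list \<Rightarrow> complex" where
  "entry_prod J I K = (\<Prod>a<length I. J (I ! a) (K ! a))"

lemma prod_lessThan_skip:
  fixes g :: "nat \<Rightarrow> complex"
  assumes "a \<le> m"
  shows "(\<Prod>b\<in>{..<Suc m} - {a}. g b) = (\<Prod>b<m. g (if b < a then b else Suc b))"
  by (rule prod.reindex_bij_witness[where i = "\<lambda>b. if b < a then b else Suc b" and j = "\<lambda>b. if b < a then b else b - 1"])
     (use assms in \<open>auto split: if_splits\<close>)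

lemma entry_prod_remove:
  assumes "a < length I" "length K = length I"
  shows "(\<Prod>b\<in>{..<length I} - {a}. J (I ! b) (K ! b)) = entry_prod J (remove_entry a I) (remove_entry a K)"
proof -
  obtain m where m: "length I = Suc m" using assms by (cases "length I") auto
  then have "(\<Prod>b\<in>{..<length I} - {a}. J (I ! b) (K ! b)) = (\<Prod>b<m. J (I ! (if b < a then b else Suc b)) (K ! (if b < a then b else Suc b)))"
    using prod_lessThan_skip[of a m "\<lambda>b. J (I ! b) (K ! b)"] assms by simp
  also have "\<dots> = entry_prod J (remove_entry a I) (remove_entry a K)"
    unfolding entry_prod_def
    by (rule prod.cong) (use assms m in \<open>auto simp: length_remove_entry nth_remove_entry\<close>)
  finally show ?thesis .
qed

lemma entry_prod_insert:
  assumes "a < length I" "length K = length I - 1"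
  shows "entry_prod J I (insert_entry a k K) = J (I ! a) k * entry_prod J (remove_entry a I) K"
proof -
  have "entry_prod J I (insert_entry a k K) = J (I ! a) (insert_entry a k K ! a) *
     (\<Prod>b\<in>{..<length I} - {a}. J (I ! b) (insert_entry a k K ! b))"
    unfolding entry_prod_def by (rule prod.remove) (use assms in auto)
  then show ?thesis
    using assms by (simp add: entry_prod_remove length_insert_entry nth_insert_entry_same remove_insert_entry)
qed

text \<open>The pointwise identity behind the invariance of \<open>\<partial>\<close>: the terms with second derivatives \<open>H\<close> of the
  coordinate change cancel, since \<open>H\<close> is symmetric in its lower indices and \<open>W\<close> is alternating.\<close>

lemma alternating_sum_transformation:
  fixes J :: "nat \<Rightarrow> nat \<Rightarrow> complex"
  assumes I: "I \<in> multi_indices n (int (Suc p))"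
    and W: "alternating W"
    and H: "\<And>i j k. i < n \<Longrightarrow> j < n \<Longrightarrow> k < n \<Longrightarrow> H i j k = H j i k"
  shows "(\<Sum>a<Suc p. (-1) ^ a * (\<Sum>K\<in>multi_indices n (int p).
        (\<Sum>b<p. H (I ! a) (remove_entry a I ! b) (K ! b) * entry_prod J (remove_entry b (remove_entry a I)) (remove_entry b K)) * W K
        + entry_prod J (remove_entry a I) K * (\<Sum>k<n. W' k K * J (I ! a) k)))
    = (\<Sum>L\<in>multi_indices n (int (Suc p)). entry_prod J I L * (\<Sum>a<Suc p. (-1) ^ a * W' (L ! a) (remove_entry a L)))"
    (is "?lhs = ?rhs")
proof -
  have lenI: "length I = Suc p" and setI: "set I \<subseteq> {..<n}" using I unfolding multi_indices_int by auto
  \<comment> \<open>Once the entry at position \<open>b\<close> has been moved to the front of the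
    argument of \<open>W\<close>, at the price of \<open>(-1) ^ b\<close>, the sum depends on
    \<open>b\<close> no longer and inherits the symmetry of \<open>H\<close> in \<open>i\<close> and
    \<open>j\<close>.\<close>
  define F where "F i j M = (\<Sum>k<n. \<Sum>N\<in>multi_indices n (int (p - 1)). H i j k * entry_prod J M N * W (k # N))" for i j M
  have F: "(\<Sum>K\<in>multi_indices n (int p). H i j (K ! b) * entry_prod J M (remove_entry b K) * W K) = (-1) ^ b * F i j M"
    if "b < p" for i j b M
  proof -
    have p: "int p = int (Suc (p - 1))" and b: "b \<le> p - 1" using that by auto
    show ?thesis unfolding p sum_multi_indices_Suc[OF b] F_def sum_distrib_left
      by (intro sum.cong refl)
         (use b W in \<open>auto simp: multi_indices_int nth_insert_entry_same remove_insert_entry alternating_insert_entry\<close>)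
  qed
  have A0: "(\<Sum>a<Suc p. (-1) ^ a * (\<Sum>K\<in>multi_indices n (int p).
        (\<Sum>b<p. H (I ! a) (remove_entry a I ! b) (K ! b) * entry_prod J (remove_entry b (remove_entry a I)) (remove_entry b K)) * W K)) = 0"
  proof -
    have "(\<Sum>a<Suc p. (-1) ^ a * (\<Sum>K\<in>multi_indices n (int p).
        (\<Sum>b<p. H (I ! a) (remove_entry a I ! b) (K ! b) * entry_prod J (remove_entry b (remove_entry a I)) (remove_entry b K)) * W K))
      = (\<Sum>a<Suc p. (-1) ^ a * (\<Sum>b<p. (\<Sum>K\<in>multi_indices n (int p).
         H (I ! a) (remove_entry a I ! b) (K ! b) * entry_prod J (remove_entry b (remove_entry a I)) (remove_entry b K) * W K)))"
      by (simp only: sum_distrib_right) (subst sum.swap, rule refl)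
    also have "\<dots> = (\<Sum>a<Suc p. \<Sum>b<p. (-1) ^ a * ((-1) ^ b * F (I ! a) (remove_entry a I ! b) (remove_entry b (remove_entry a I))))"
      unfolding sum_distrib_left by (intro sum.cong refl) (simp add: F flip: sum_distrib_left)
    also have "\<dots> = 0"
    proof -
      have "F x y M = F y x M" if "x \<in> set I" "y \<in> set I" for x y M
      proof -
        have "H x y k = H y x k" if "k < n" for k
          by (rule H) (use that \<open>x \<in> set I\<close> \<open>y \<in> set I\<close> setI in auto)
        then show ?thesis unfolding F_def by (intro sum.cong refl) auto
      qed
      from sum_remove_two_entries[of I F, OF this] show ?thesis by (simp add: lenI)
    qed
    finally show ?thesis .
  qed
  have "?lhs = (\<Sum>a<Suc p. (-1) ^ a * (\<Sum>K\<in>multi_indices n (int p).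
        (\<Sum>b<p. H (I ! a) (remove_entry a I ! b) (K ! b) * entry_prod J (remove_entry b (remove_entry a I)) (remove_entry b K)) * W K))
    + (\<Sum>a<Suc p. (-1) ^ a * (\<Sum>K\<in>multi_indices n (int p). entry_prod J (remove_entry a I) K * (\<Sum>k<n. W' k K * J (I ! a) k)))"
    by (simp add: sum.distrib distrib_left del: sum.lessThan_Suc)
  also have "\<dots> = (\<Sum>a<Suc p. (-1) ^ a * (\<Sum>K\<in>multi_indices n (int p). entry_prod J (remove_entry a I) K * (\<Sum>k<n. W' k K * J (I ! a) k)))"
    unfolding A0 by simp
  \<comment> \<open>Here \<open>L\<close> is \<open>K\<close> with \<open>k\<close> inserted at
    position \<open>a\<close>: the factor \<open>J (I ! a) k\<close> completes the product over the
    shortened lists to the product over \<open>I\<close> and \<open>L\<close>.\<close>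
  also have "\<dots> = (\<Sum>a<Suc p. \<Sum>L\<in>multi_indices n (int (Suc p)). entry_prod J I L * ((-1) ^ a * W' (L ! a) (remove_entry a L)))"
  proof (rule sum.cong[OF refl])
    fix a assume "a \<in> {..<Suc p}"
    then have a: "a \<le> p" by simp
    have "(\<Sum>L\<in>multi_indices n (int (Suc p)). entry_prod J I L * ((-1) ^ a * W' (L ! a) (remove_entry a L)))
      = (\<Sum>k<n. \<Sum>K\<in>multi_indices n (int p). (-1) ^ a * (entry_prod J (remove_entry a I) K * (W' k K * J (I ! a) k)))"
      unfolding sum_multi_indices_Suc[OF a]
      by (intro sum.cong refl)
         (use a lenI in \<open>auto simp: multi_indices_int nth_insert_entry_same remove_insert_entry entry_prod_insert mult_ac\<close>)
    then show "(-1) ^ a * (\<Sum>K\<in>multi_indices n (int p). entry_prod J (remove_entry a I) K * (\<Sum>k<n. W' k K * J (I ! a) k))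
      = (\<Sum>L\<in>multi_indices n (int (Suc p)). entry_prod J I L * ((-1) ^ a * W' (L ! a) (remove_entry a L)))"
      by (simp only: sum_distrib_left) (subst sum.swap, rule refl)
  qed
  also have "\<dots> = ?rhs"
    by (simp only: sum_distrib_left) (subst sum.swap, rule refl)
  finally show ?thesis .
qed

section \<open>Holomorphic forms\<close>

definition hol_forms :: "nat \<Rightarrow> 'a chart set \<Rightarrow> int \<Rightarrow> 'a form set" where
  "hol_forms n A p = {\<omega> \<in> smooth_forms n A p 0. delbar n A \<omega> = (\<lambda>c I J z. 0)}"

abbreviation jacobian :: "'a chart \<Rightarrow> 'a chart \<Rightarrow> (nat \<Rightarrow> complex) \<Rightarrow> nat \<Rightarrow> nat \<Rightarrow> complex" where
  "jacobian c d z \<equiv> \<lambda>i k. d_z i (\<lambda>u. transition c d u k) z"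

lemma multi_indices_0: "multi_indices n 0 = {[]}"
  by (auto simp: multi_indices_def)

lemma remove_entry_in_multi_indices:
  assumes "I \<in> multi_indices n (int (Suc p))" "a < Suc p"
  shows "remove_entry a I \<in> multi_indices n (int p)"
  using assms set_remove_entry[of a I] unfolding multi_indices_int by (auto simp: length_remove_entry)

lemma nth_in_multi_indices:
  assumes "I \<in> multi_indices n (int p)" "a < p"
  shows "I ! a < n"
proof -
  have "I ! a \<in> set I" using assms unfolding multi_indices_int by auto
  then show ?thesis using assms unfolding multi_indices_int by blast
qed

locale complex_mfd =
  fixes n :: nat and X :: "'a topology" and A :: "'a chart set"
  assumes mfd: "complex_manifold n X A"
begin

lemma is_chart: "c \<in> A \<Longrightarrow> is_chart n X c"
  using mfd by (simp add: complex_manifold_def)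

lemma openin_chart_image: "c \<in> A \<Longrightarrow> openin (top_of_set (cspace n)) (chart_image c)"
  using is_chart by (simp add: is_chart_def)

lemma chart_subset_topspace: "c \<in> A \<Longrightarrow> fst c \<subseteq> topspace X"
  using is_chart openin_subset unfolding is_chart_def by blast

lemma inj_on_chart:
  assumes "c \<in> A" shows "inj_on (snd c) (fst c)"
proof -
  have "inj_on (snd c) (topspace (subtopology X (fst c)))"
    using is_chart[OF assms] unfolding is_chart_def by (blast intro: homeomorphic_imp_injective_map)
  then show ?thesis using chart_subset_topspace[OF assms] by (simp add: Int_absorb1)
qed

lemma openin_chart_image_of_open:
  assumes c: "c \<in> A" and U: "openin X U"
  shows "openin (top_of_set (cspace n)) (snd c ` (fst c \<inter> U))"
proof -
  have "openin (subtopology X (fst c)) (fst c \<inter> U)"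
    using U by (simp add: openin_subtopology_Int2)
  then have "openin (top_of_set (chart_image c)) (snd c ` (fst c \<inter> U))"
    using is_chart[OF c] homeomorphic_imp_open_map unfolding is_chart_def open_map_def by blast
  then show ?thesis using openin_trans openin_chart_image[OF c] by blast
qed

lemma openin_overlap:
  assumes "c \<in> A" "d \<in> A" shows "openin (top_of_set (cspace n)) (overlap c d)"
  unfolding overlap_def
  by (rule openin_chart_image_of_open) (use assms is_chart in \<open>auto simp: is_chart_def\<close>)

lemma overlap_subset: "overlap c d \<subseteq> chart_image c"
  by (auto simp: overlap_def chart_image_def)

lemma transition_chart:
  assumes "c \<in> A" "x \<in> fst c" shows "transition c d (snd c x) = snd d x"
  using inj_on_chart[OF assms(1)] assms by (simp add: transition_def)

lemma transition_in_chart_image: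
  assumes "c \<in> A" "z \<in> overlap c d" shows "transition c d z \<in> chart_image d"
proof -
  obtain x where "x \<in> fst c" "x \<in> fst d" "z = snd c x" using assms(2) by (auto simp: overlap_def)
  then show ?thesis using transition_chart[OF assms(1), of x d] by (simp add: chart_image_def)
qed

lemma holomorphic_transition:
  "c \<in> A \<Longrightarrow> d \<in> A \<Longrightarrow> k < n \<Longrightarrow> holomorphic_several n (overlap c d) (\<lambda>z. transition c d z k)"
  using mfd by (simp add: complex_manifold_def)

section \<open>Components of holomorphic forms and their derivative\<close>

text \<open>Holomorphy of the components supplies both smoothness and the vanishing of
  \<open>delbar\<close>, so neither has to be checked for forms constructed later.\<close>

lemma hol_formsI:
  assumes zero: "\<And>c I J z. \<not> (c \<in> A \<and> I \<in> multi_indices n (int p) \<and> J = [] \<and> z \<in> chart_image c) \<Longrightarrow> \<omega> c I J z = 0"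
    and hol: "\<And>c I. c \<in> A \<Longrightarrow> I \<in> multi_indices n (int p) \<Longrightarrow> holomorphic_several n (chart_image c) (\<omega> c I [])"
    and alt: "\<And>c z. c \<in> A \<Longrightarrow> alternating (\<lambda>I. \<omega> c I [] z)"
    and trans: "\<And>c d I z. c \<in> A \<Longrightarrow> d \<in> A \<Longrightarrow> I \<in> multi_indices n (int p) \<Longrightarrow> z \<in> overlap c d \<Longrightarrow>
      \<omega> c I [] z = (\<Sum>K\<in>multi_indices n (int p). entry_prod (jacobian c d z) I K * \<omega> d K [] (transition c d z))"
  shows "\<omega> \<in> hol_forms n A (int p)"
proof -
  have "delbar n A \<omega> c I J z = 0" for c I J z
  proof (cases "c \<in> A \<and> set I \<subseteq> {..<n} \<and> set J \<subseteq> {..<n} \<and> z \<in> chart_image c")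
    case True
    have "d_zbar (J ! b) (\<omega> c I (remove_entry b J)) z = 0" if "b < length J" for b
    \<comment> \<open>If an entry of \<open>J\<close> is left after the removal, the function being
      differentiated is identically 0; only a one-entry \<open>J\<close> reaches a true
      component.\<close>
    proof (cases "I \<in> multi_indices n (int p) \<and> remove_entry b J = []")
      case T: True
      have "J ! b < n" using True that nth_mem[OF that] by blast
      then show ?thesis using T True d_zbar_holomorphic[OF hol] by metis
    next
      case False
      then have "\<omega> c I (remove_entry b J) = (\<lambda>_. 0)" using zero by blast
      then show ?thesis by (simp add: d_zbar_const)
    qed
    then show ?thesis by (simp add: delbar_def)
  qed (auto simp: delbar_def)
  then have dbar: "delbar n A \<omega> = (\<lambda>c I J z. 0)" by (intro ext)
  have "\<omega> \<in> smooth_forms n A (int p) 0"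
    unfolding smooth_forms_def mem_Collect_eq multi_indices_0
    using zero hol alternating_swap_entries[OF alt] trans
    by (auto simp: jacobian_prod_def entry_prod_def smooth_on_holomorphic openin_chart_image)
  with dbar show ?thesis by (simp add: hol_forms_def)
qed

context
  fixes \<omega> :: "'a form" and p :: nat
  assumes \<omega>: "\<omega> \<in> hol_forms n A (int p)"
begin

lemma hol_form_zero:
  assumes "\<not> (c \<in> A \<and> I \<in> multi_indices n (int p) \<and> J = [] \<and> z \<in> chart_image c)"
  shows "\<omega> c I J z = 0"
  using \<omega> assms unfolding hol_forms_def smooth_forms_def multi_indices_0 by blast

lemma hol_form_zero_fun: "I \<notin> multi_indices n (int p) \<or> J \<noteq> [] \<Longrightarrow> \<omega> c I J = (\<lambda>z. 0)"
  using hol_form_zero by blast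

text \<open>Evaluating \<open>delbar\<close> at the one-entry list \<open>[i]\<close> isolates a
  single Wirtinger derivative up to sign.\<close>

lemma hol_form_holomorphic:
  assumes c: "c \<in> A" and I: "I \<in> multi_indices n (int p)"
  shows "holomorphic_several n (chart_image c) (\<omega> c I [])"
proof (rule holomorphic_several_if_d_zbar_zero[OF _ openin_chart_image[OF c]])
  show "smooth_on n (chart_image c) (\<omega> c I [])"
    using \<omega> c I unfolding hol_forms_def smooth_forms_def multi_indices_0 by blast
  fix z i assume z: "z \<in> chart_image c" and i: "i < n"
  have "delbar n A \<omega> c I [i] z = 0" using \<omega> by (simp add: hol_forms_def)
  then show "d_zbar i (\<omega> c I []) z = 0"
    using c I z i by (simp add: delbar_def multi_indices_int remove_entry_def)
qed

lemma hol_form_alternating: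
  assumes c: "c \<in> A" shows "alternating (\<lambda>I. \<omega> c I [] z)"
proof (rule alternating_if_swap_entries)
  fix I :: "nat list" and a b :: nat assume ab: "a < b" "b < length I"
  show "\<omega> c (swap_entries a b I) [] z = - \<omega> c I [] z"
  proof (cases "I \<in> multi_indices n (int p)")
    case True
    note cond = \<omega>[unfolded hol_forms_def smooth_forms_def mem_Collect_eq multi_indices_0, THEN conjunct1,
        THEN conjunct2, THEN bspec, OF c, THEN bspec, OF True, THEN bspec, OF singletonI]
    show ?thesis by (rule cond[THEN conjunct2, THEN conjunct1, rule_format, OF conjI[OF ab]])
  next
    case False
    \<comment> \<open>A swap keeps length and entries, so outside the index set both sides are 0 and
      the identity extends to all lists.\<close>
    then have "swap_entries a b I \<notin> multi_indices n (int p)"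
      using ab by (simp add: multi_indices_int swap_entries_def set_swap)
    then show ?thesis using False hol_form_zero by simp
  qed
qed

lemma hol_form_transition:
  assumes "c \<in> A" "d \<in> A" "I \<in> multi_indices n (int p)" "z \<in> overlap c d"
  shows "\<omega> c I [] z = (\<Sum>K\<in>multi_indices n (int p). entry_prod (jacobian c d z) I K * \<omega> d K [] (transition c d z))"
proof -
  have "\<omega> c I [] z = (\<Sum>K\<in>multi_indices n (int p). \<Sum>L\<in>multi_indices n 0.
          jacobian_prod c d z I K * cnj (jacobian_prod c d z [] L) * \<omega> d K L (transition c d z))"
    using \<omega> assms unfolding hol_forms_def smooth_forms_def multi_indices_0 by blast
  then show ?thesis by (simp add: multi_indices_0 jacobian_prod_def entry_prod_def)
qed

lemma del_hol_form:
  assumes "c \<in> A" "I \<in> multi_indices n (int (Suc p))" "z \<in> chart_image c"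
  shows "del n A \<omega> c I [] z = (\<Sum>a<Suc p. (-1) ^ a * d_z (I ! a) (\<omega> c (remove_entry a I) []) z)"
  using assms unfolding multi_indices_int by (simp add: del_def)

lemma del_hol_form_zero:
  assumes "\<not> (c \<in> A \<and> I \<in> multi_indices n (int (Suc p)) \<and> J = [] \<and> z \<in> chart_image c)"
  shows "del n A \<omega> c I J z = 0"
proof (cases "c \<in> A \<and> set I \<subseteq> {..<n} \<and> set J \<subseteq> {..<n} \<and> z \<in> chart_image c")
  case True
  have "\<omega> c (remove_entry a I) J = (\<lambda>_. 0)" if "a < length I" for a
  proof (rule hol_form_zero_fun)
    show "remove_entry a I \<notin> multi_indices n (int p) \<or> J \<noteq> []"
      using True assms that unfolding multi_indices_int by (auto simp: length_remove_entry)
  qed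
  then show ?thesis by (simp add: del_def d_z_const)
qed (auto simp: del_def)

lemma del_hol_form_holomorphic:
  assumes c: "c \<in> A" and I: "I \<in> multi_indices n (int (Suc p))"
  shows "holomorphic_several n (chart_image c) (del n A \<omega> c I [])"
proof (rule holomorphic_several_cong[OF openin_chart_image[OF c] del_hol_form[OF c I, symmetric]])
  show "holomorphic_several n (chart_image c) (\<lambda>z. \<Sum>a<Suc p. (-1) ^ a * d_z (I ! a) (\<omega> c (remove_entry a I) []) z)"
  proof (intro holomorphic_several_sum holomorphic_several_mult holomorphic_several_const)
    fix a assume "a \<in> {..<Suc p}"
    then have a: "a < Suc p" by simp
    show "holomorphic_several n (chart_image c) (d_z (I ! a) (\<omega> c (remove_entry a I) []))"
      by (rule holomorphic_several_d_z[OF hol_form_holomorphic[OF c remove_entry_in_multi_indices[OF I a]]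
            openin_chart_image[OF c] nth_in_multi_indices[OF I a]])
  qed
qed

lemma del_hol_form_alternating:
  assumes c: "c \<in> A" shows "alternating (\<lambda>I. del n A \<omega> c I [] z)"
proof (cases "z \<in> chart_image c")
  case False
  then have "del n A \<omega> c I [] z = 0" for I by (simp add: del_def)
  then show ?thesis by (simp add: alternating_def)
next
  case z: True
  \<comment> \<open>The cut-off at \<open>n\<close> matches the default value of \<open>del\<close>:
    if \<open>I\<close> has an entry outside the range, either that entry is removed and
    \<open>G\<close> is 0, or it stays in the remaining list and the component is 0.\<close>
  define G where "G x K = (if x < n then d_z x (\<omega> c K []) z else 0)" for x K
  have "alternating (G x)" for x
    unfolding alternating_def
  proof (intro allI)
    fix P R :: "nat list" and y1 y2
    let ?K = "P @ y1 # y2 # R" and ?K' = "P @ y2 # y1 # R"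
    have "\<omega> c ?K [] z = - \<omega> c ?K' [] z" for z
      by (rule alternatingD[OF hol_form_alternating[OF c]])
    then have eq: "\<omega> c ?K [] = (\<lambda>z. (-1) * \<omega> c ?K' [] z)" by (intro ext) simp
    show "G x ?K = - G x ?K'"
    proof (cases "x < n \<and> ?K' \<in> multi_indices n (int p)")
      case True
      then show ?thesis
        using d_z_cmult[OF hol_form_holomorphic[OF c, of ?K'] z, of x "-1"] by (simp add: G_def eq)
    next
      case False
      then have "x < n \<Longrightarrow> \<omega> c ?K' [] = (\<lambda>_. 0)" using hol_form_zero_fun by blast
      then show ?thesis unfolding G_def eq by (simp add: d_z_const)
    qed
  qed
  then have "alternating (\<lambda>I. \<Sum>a<length I. (-1) ^ a * G (I ! a) (remove_entry a I))"
    by (rule alternating_alternating_sum)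
  moreover have "(\<Sum>a<length I. (-1) ^ a * G (I ! a) (remove_entry a I)) = del n A \<omega> c I [] z" for I
  proof (cases "set I \<subseteq> {..<n}")
    case True
    have "G (I ! a) (remove_entry a I) = d_z (I ! a) (\<omega> c (remove_entry a I) []) z" if "a < length I" for a
      using True nth_mem[OF that] by (auto simp: G_def)
    then show ?thesis using True c z by (simp add: del_def)
  next
    case False
    have "G (I ! a) (remove_entry a I) = 0" if a: "a < length I" for a
    proof (cases "I ! a < n")
      case True
      have "set I = insert (I ! a) (set (remove_entry a I))"
        using set_insert_entry[of a "I ! a" "remove_entry a I"] insert_remove_entry[OF a] by simp
      then have "\<not> set (remove_entry a I) \<subseteq> {..<n}" using False True by auto
      then have "\<omega> c (remove_entry a I) [] = (\<lambda>_. 0)"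
        by (intro hol_form_zero_fun) (auto simp: multi_indices_int)
      then show ?thesis by (simp add: G_def d_z_const)
    qed (simp add: G_def)
    then show ?thesis using False by (simp add: del_def)
  qed
  ultimately show ?thesis by simp
qed

text \<open>Leibniz and chain rule applied to the transformation law. The sum over \<open>b\<close>
  carries the second derivatives of the coordinate change, which only the alternating sum in
  \<open>del\<close> will remove.\<close>

lemma d_z_hol_form_transition:
  assumes c: "c \<in> A" and d: "d \<in> A" and I: "I \<in> multi_indices n (int p)" and z: "z \<in> overlap c d" and i: "i < n"
  shows "d_z i (\<omega> c I []) z = (\<Sum>K\<in>multi_indices n (int p).
    (\<Sum>b<p. d_z i (\<lambda>u. jacobian c d u (I ! b) (K ! b)) z * entry_prod (jacobian c d z) (remove_entry b I) (remove_entry b K))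
      * \<omega> d K [] (transition c d z)
    + entry_prod (jacobian c d z) I K * (\<Sum>k<n. d_z k (\<omega> d K []) (transition c d z) * jacobian c d z i k))"
proof -
  let ?O = "overlap c d" and ?\<tau> = "transition c d"
  note O = openin_overlap[OF c d]
  have lenI: "length I = p" using I by (simp add: multi_indices_int)
  have hJ: "holomorphic_several n ?O (\<lambda>u. jacobian c d u j k)" if "j < n" "k < n" for j k
    by (rule holomorphic_several_d_z[OF holomorphic_transition[OF c d that(2)] O that(1)])
  have hP: "holomorphic_several n ?O (\<lambda>u. entry_prod (jacobian c d u) I K)" if K: "K \<in> multi_indices n (int p)" for K
    unfolding entry_prod_def
    by (intro holomorphic_several_prod hJ) (use nth_in_multi_indices I K lenI in auto)
  have hC: "holomorphic_several n ?O (\<lambda>u. \<omega> d K [] (?\<tau> u))"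
    "d_z i (\<lambda>u. \<omega> d K [] (?\<tau> u)) z = (\<Sum>k<n. d_z k (\<omega> d K []) (?\<tau> z) * jacobian c d z i k)"
    if K: "K \<in> multi_indices n (int p)" for K
    using chain_rule_transition[OF hol_form_holomorphic[OF d K] openin_chart_image[OF d] O
        transition_in_chart_image[OF c] holomorphic_transition[OF c d]] z i by auto
  have dP: "d_z i (\<lambda>u. entry_prod (jacobian c d u) I K) z =
      (\<Sum>b<p. d_z i (\<lambda>u. jacobian c d u (I ! b) (K ! b)) z * entry_prod (jacobian c d z) (remove_entry b I) (remove_entry b K))"
    if K: "K \<in> multi_indices n (int p)" for K
  proof -
    have lenK: "length K = p" using K by (simp add: multi_indices_int)
    have "d_z i (\<lambda>u. \<Prod>b<p. jacobian c d u (I ! b) (K ! b)) z = (\<Sum>b<p. d_z i (\<lambda>u. jacobian c d u (I ! b) (K ! b)) z *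
        (\<Prod>j\<in>{..<p} - {b}. jacobian c d z (I ! j) (K ! j)))"
      by (rule d_z_prod[OF hJ z i]) (use nth_in_multi_indices I K in auto)
    also have "\<dots> = (\<Sum>b<p. d_z i (\<lambda>u. jacobian c d u (I ! b) (K ! b)) z * entry_prod (jacobian c d z) (remove_entry b I) (remove_entry b K))"
    proof (rule sum.cong[OF refl])
      fix b assume "b \<in> {..<p}"
      then have "(\<Prod>j\<in>{..<p} - {b}. jacobian c d z (I ! j) (K ! j)) = entry_prod (jacobian c d z) (remove_entry b I) (remove_entry b K)"
        using entry_prod_remove[of b I K "jacobian c d z"] lenI lenK by simp
      then show "d_z i (\<lambda>u. jacobian c d u (I ! b) (K ! b)) z * (\<Prod>j\<in>{..<p} - {b}. jacobian c d z (I ! j) (K ! j)) =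
        d_z i (\<lambda>u. jacobian c d u (I ! b) (K ! b)) z * entry_prod (jacobian c d z) (remove_entry b I) (remove_entry b K)"
        by (simp only:)
    qed
    finally show ?thesis unfolding entry_prod_def lenI .
  qed
  have "d_z i (\<omega> c I []) z = d_z i (\<lambda>u. \<Sum>K\<in>multi_indices n (int p). entry_prod (jacobian c d u) I K * \<omega> d K [] (?\<tau> u)) z"
    by (rule d_z_cong[OF O z i hol_form_transition[OF c d I]])
  also have "\<dots> = (\<Sum>K\<in>multi_indices n (int p). d_z i (\<lambda>u. entry_prod (jacobian c d u) I K * \<omega> d K [] (?\<tau> u)) z)"
    by (rule d_z_sum[OF holomorphic_several_mult[OF hP hC(1)] z i])
  also have "\<dots> = (\<Sum>K\<in>multi_indices n (int p).
    (\<Sum>b<p. d_z i (\<lambda>u. jacobian c d u (I ! b) (K ! b)) z * entry_prod (jacobian c d z) (remove_entry b I) (remove_entry b K))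
      * \<omega> d K [] (?\<tau> z)
    + entry_prod (jacobian c d z) I K * (\<Sum>k<n. d_z k (\<omega> d K []) (?\<tau> z) * jacobian c d z i k))"
  proof (rule sum.cong[OF refl])
    fix K assume K: "K \<in> multi_indices n (int p)"
    show "d_z i (\<lambda>u. entry_prod (jacobian c d u) I K * \<omega> d K [] (?\<tau> u)) z =
      (\<Sum>b<p. d_z i (\<lambda>u. jacobian c d u (I ! b) (K ! b)) z * entry_prod (jacobian c d z) (remove_entry b I) (remove_entry b K))
      * \<omega> d K [] (?\<tau> z)
    + entry_prod (jacobian c d z) I K * (\<Sum>k<n. d_z k (\<omega> d K []) (?\<tau> z) * jacobian c d z i k)"
      unfolding d_z_mult[OF hP[OF K] hC(1)[OF K] z i] dP[OF K] hC(2)[OF K] ..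
  qed
  finally show ?thesis .
qed

theorem del_in_hol_forms: "del n A \<omega> \<in> hol_forms n A (int (Suc p))"
proof (rule hol_formsI)
  fix c d I z assume c: "c \<in> A" and d: "d \<in> A" and I: "I \<in> multi_indices n (int (Suc p))" and z: "z \<in> overlap c d"
  let ?J = "jacobian c d z"
  let ?W = "\<lambda>K. \<omega> d K [] (transition c d z)" and ?W' = "\<lambda>k K. d_z k (\<omega> d K []) (transition c d z)"
  \<comment> \<open>The second derivatives of the coordinate change, symmetric since partial
    derivatives commute.\<close>
  define H where "H i j k = d_z i (\<lambda>u. jacobian c d u j k) z" for i j k
  have Hsym: "H i j k = H j i k" if "i < n" "j < n" "k < n" for i j k
    unfolding H_def by (rule d_z_commute[OF holomorphic_transition[OF c d that(3)] openin_overlap[OF c d] z that(1,2)])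
  have zc: "z \<in> chart_image c" using z overlap_subset by blast
  have "del n A \<omega> c I [] z = (\<Sum>a<Suc p. (-1) ^ a * d_z (I ! a) (\<omega> c (remove_entry a I) []) z)"
    by (rule del_hol_form[OF c I zc])
  also have "\<dots> = (\<Sum>a<Suc p. (-1) ^ a * (\<Sum>K\<in>multi_indices n (int p).
        (\<Sum>b<p. H (I ! a) (remove_entry a I ! b) (K ! b) * entry_prod ?J (remove_entry b (remove_entry a I)) (remove_entry b K)) * ?W K
        + entry_prod ?J (remove_entry a I) K * (\<Sum>k<n. ?W' k K * ?J (I ! a) k)))"
  proof (rule sum.cong[OF refl])
    fix a assume "a \<in> {..<Suc p}"
    then have a: "a < Suc p" by simp
    show "(-1) ^ a * d_z (I ! a) (\<omega> c (remove_entry a I) []) z = (-1) ^ a * (\<Sum>K\<in>multi_indices n (int p).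
        (\<Sum>b<p. H (I ! a) (remove_entry a I ! b) (K ! b) * entry_prod ?J (remove_entry b (remove_entry a I)) (remove_entry b K)) * ?W K
        + entry_prod ?J (remove_entry a I) K * (\<Sum>k<n. ?W' k K * ?J (I ! a) k))"
      unfolding d_z_hol_form_transition[OF c d remove_entry_in_multi_indices[OF I a] z nth_in_multi_indices[OF I a]] H_def ..
  qed
  also have "\<dots> = (\<Sum>L\<in>multi_indices n (int (Suc p)). entry_prod ?J I L * (\<Sum>a<Suc p. (-1) ^ a * ?W' (L ! a) (remove_entry a L)))"
    by (rule alternating_sum_transformation[OF I hol_form_alternating[OF d] Hsym])
  also have "\<dots> = (\<Sum>L\<in>multi_indices n (int (Suc p)). entry_prod ?J I L * del n A \<omega> d L [] (transition c d z))"
    by (rule sum.cong[OF refl]) (simp only: del_hol_form[OF d _ transition_in_chart_image[OF c z]])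
  finally show "del n A \<omega> c I [] z = (\<Sum>L\<in>multi_indices n (int (Suc p)). entry_prod ?J I L * del n A \<omega> d L [] (transition c d z))" .
qed (fact del_hol_form_zero del_hol_form_holomorphic del_hol_form_alternating)+

end

text \<open>Second derivatives are symmetric while removing two entries in either order gives
  opposite signs, so the terms cancel in pairs.\<close>

theorem del_del_hol_form:
  assumes \<omega>: "\<omega> \<in> hol_forms n A (int p)"
  shows "del n A (del n A \<omega>) = (\<lambda>c I J z. 0)"
proof (intro ext)
  fix c I J z
  note \<omega>' = del_in_hol_forms[OF \<omega>]
  show "del n A (del n A \<omega>) c I J z = 0"
  proof (cases "c \<in> A \<and> I \<in> multi_indices n (int (Suc (Suc p))) \<and> J = [] \<and> z \<in> chart_image c")
    case False
    then show ?thesis by (rule del_hol_form_zero[OF \<omega>'])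
  next
    case True
    then have c: "c \<in> A" and I: "I \<in> multi_indices n (int (Suc (Suc p)))" and J: "J = []" and z: "z \<in> chart_image c"
      by auto
    note Vo = openin_chart_image[OF c]
    define F where "F x y M = d_z x (d_z y (\<omega> c M [])) z" for x y M
    have lenI: "length I = Suc (Suc p)" and setI: "set I \<subseteq> {..<n}" using I unfolding multi_indices_int by auto
    have sym: "F x y M = F y x M" if "x \<in> set I" "y \<in> set I" for x y M
    proof (cases "M \<in> multi_indices n (int p)")
      case True
      show ?thesis unfolding F_def
        by (rule d_z_commute[OF hol_form_holomorphic[OF \<omega> c True] Vo z]) (use that setI in auto)
    next
      case False
      then have "\<omega> c M [] = (\<lambda>_. 0)" using hol_form_zero_fun[OF \<omega>] by blast
      then have "d_z x (\<omega> c M []) = (\<lambda>_. 0)" for x by (auto simp: d_z_const)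
      then show ?thesis by (simp add: F_def d_z_const)
    qed
    have "del n A (del n A \<omega>) c I [] z = (\<Sum>a<Suc (Suc p). (-1) ^ a * d_z (I ! a) (del n A \<omega> c (remove_entry a I) []) z)"
      by (rule del_hol_form[OF \<omega>' c I z])
    also have "\<dots> = (\<Sum>a<Suc (Suc p). \<Sum>b<Suc p. (-1) ^ a * ((-1) ^ b * F (I ! a) (remove_entry a I ! b) (remove_entry b (remove_entry a I))))"
    proof (rule sum.cong[OF refl])
      fix a assume "a \<in> {..<Suc (Suc p)}"
      then have a: "a < Suc (Suc p)" by simp
      let ?I = "remove_entry a I"
      have I': "?I \<in> multi_indices n (int (Suc p))" by (rule remove_entry_in_multi_indices[OF I a])
      note ia = nth_in_multi_indices[OF I a]
      have h: "holomorphic_several n (chart_image c) (d_z (?I ! b) (\<omega> c (remove_entry b ?I) []))" if "b < Suc p" for b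
        by (rule holomorphic_several_d_z[OF hol_form_holomorphic[OF \<omega> c remove_entry_in_multi_indices[OF I' that]]
            Vo nth_in_multi_indices[OF I' that]])
      have "d_z (I ! a) (del n A \<omega> c ?I []) z =
        d_z (I ! a) (\<lambda>z. \<Sum>b<Suc p. (-1) ^ b * d_z (?I ! b) (\<omega> c (remove_entry b ?I) []) z) z"
        by (rule d_z_cong[OF Vo z ia del_hol_form[OF \<omega> c I']])
      also have "\<dots> = (\<Sum>b<Suc p. d_z (I ! a) (\<lambda>z. (-1) ^ b * d_z (?I ! b) (\<omega> c (remove_entry b ?I) []) z) z)"
        by (rule d_z_sum[OF _ z ia]) (intro holomorphic_several_mult holomorphic_several_const h, simp)
      also have "\<dots> = (\<Sum>b<Suc p. (-1) ^ b * F (I ! a) (?I ! b) (remove_entry b ?I))"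
        unfolding F_def by (rule sum.cong[OF refl]) (rule d_z_cmult[OF h z ia], simp)
      finally show "(-1) ^ a * d_z (I ! a) (del n A \<omega> c ?I []) z =
          (\<Sum>b<Suc p. (-1) ^ a * ((-1) ^ b * F (I ! a) (?I ! b) (remove_entry b ?I)))"
        by (simp only: sum_distrib_left)
    qed
    also have "\<dots> = 0" using sum_remove_two_entries[of I F, OF sym] by (simp only: lenI diff_Suc_1)
    finally show ?thesis unfolding J .
  qed
qed

section \<open>Linear structure of the holomorphic forms\<close>

lemma hol_forms_zero: "(\<lambda>c I J z. 0) \<in> hol_forms n A (int p)"
  by (rule hol_formsI) (auto simp: holomorphic_several_const alternating_def)

lemma hol_forms_add:
  assumes \<omega>: "\<omega> \<in> hol_forms n A (int p)" and \<eta>: "\<eta> \<in> hol_forms n A (int p)"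
  shows "(\<lambda>c I J z. \<omega> c I J z + \<eta> c I J z) \<in> hol_forms n A (int p)"
proof (rule hol_formsI)
  show "alternating (\<lambda>I. \<omega> c I [] z + \<eta> c I [] z)" if "c \<in> A" for c z
    using alternatingD[OF hol_form_alternating[OF \<omega> that, of z]] alternatingD[OF hol_form_alternating[OF \<eta> that, of z]]
    unfolding alternating_def by (metis minus_add_distrib)
qed (auto simp: hol_form_zero[OF \<omega>] hol_form_zero[OF \<eta>] hol_form_transition[OF \<omega>] hol_form_transition[OF \<eta>]
    sum.distrib distrib_left intro!: holomorphic_several_add hol_form_holomorphic[OF \<omega>] hol_form_holomorphic[OF \<eta>])

lemma hol_forms_smult:
  assumes \<omega>: "\<omega> \<in> hol_forms n A (int p)"
  shows "(\<lambda>c I J z. a * \<omega> c I J z) \<in> hol_forms n A (int p)"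
proof (rule hol_formsI)
  show "alternating (\<lambda>I. a * \<omega> c I [] z)" if "c \<in> A" for c z
    using alternatingD[OF hol_form_alternating[OF \<omega> that, of z]]
    unfolding alternating_def by (metis mult_minus_right)
qed (auto simp: hol_form_zero[OF \<omega>] hol_form_transition[OF \<omega>] sum_distrib_left mult_ac
    intro!: holomorphic_several_mult holomorphic_several_const hol_form_holomorphic[OF \<omega>])

lemma del_add:
  assumes \<omega>: "\<omega> \<in> hol_forms n A (int p)" and \<eta>: "\<eta> \<in> hol_forms n A (int p)"
  shows "del n A (\<lambda>c I J z. \<omega> c I J z + \<eta> c I J z) = (\<lambda>c I J z. del n A \<omega> c I J z + del n A \<eta> c I J z)"
proof (intro ext)
  fix c I J z
  note s = hol_forms_add[OF \<omega> \<eta>]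
  show "del n A (\<lambda>c I J z. \<omega> c I J z + \<eta> c I J z) c I J z = del n A \<omega> c I J z + del n A \<eta> c I J z"
  proof (cases "c \<in> A \<and> I \<in> multi_indices n (int (Suc p)) \<and> J = [] \<and> z \<in> chart_image c")
    case False
    then show ?thesis using del_hol_form_zero[OF \<omega>] del_hol_form_zero[OF \<eta>] del_hol_form_zero[OF s] by simp
  next
    case True
    then have c: "c \<in> A" and I: "I \<in> multi_indices n (int (Suc p))" and J: "J = []" and z: "z \<in> chart_image c" by auto
    have "d_z (I ! a) (\<lambda>z. \<omega> c (remove_entry a I) [] z + \<eta> c (remove_entry a I) [] z) z =
       d_z (I ! a) (\<omega> c (remove_entry a I) []) z + d_z (I ! a) (\<eta> c (remove_entry a I) []) z" if "a < Suc p" for a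
      by (rule d_z_add[OF hol_form_holomorphic[OF \<omega> c remove_entry_in_multi_indices[OF I that]]
            hol_form_holomorphic[OF \<eta> c remove_entry_in_multi_indices[OF I that]] z nth_in_multi_indices[OF I that]])
    then show ?thesis
      unfolding J del_hol_form[OF s c I z] del_hol_form[OF \<omega> c I z] del_hol_form[OF \<eta> c I z] sum.distrib[symmetric]
      by (intro sum.cong refl) (simp add: distrib_left)
  qed
qed

lemma del_smult:
  assumes \<omega>: "\<omega> \<in> hol_forms n A (int p)"
  shows "del n A (\<lambda>c I J z. r * \<omega> c I J z) = (\<lambda>c I J z. r * del n A \<omega> c I J z)"
proof (intro ext)
  fix c I J z
  note s = hol_forms_smult[OF \<omega>, of r]
  show "del n A (\<lambda>c I J z. r * \<omega> c I J z) c I J z = r * del n A \<omega> c I J z"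
  proof (cases "c \<in> A \<and> I \<in> multi_indices n (int (Suc p)) \<and> J = [] \<and> z \<in> chart_image c")
    case False
    then show ?thesis using del_hol_form_zero[OF \<omega>] del_hol_form_zero[OF s] by simp
  next
    case True
    then have c: "c \<in> A" and I: "I \<in> multi_indices n (int (Suc p))" and J: "J = []" and z: "z \<in> chart_image c" by auto
    have "d_z (I ! a) (\<lambda>z. r * \<omega> c (remove_entry a I) [] z) z = r * d_z (I ! a) (\<omega> c (remove_entry a I) []) z"
      if "a < Suc p" for a
      by (rule d_z_cmult[OF hol_form_holomorphic[OF \<omega> c remove_entry_in_multi_indices[OF I that]] z
            nth_in_multi_indices[OF I that]])
    then show ?thesis
      unfolding J del_hol_form[OF s c I z] del_hol_form[OF \<omega> c I z] sum_distrib_left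
      by (intro sum.cong refl) simp
  qed
qed

end

section \<open>Compactness\<close>

text \<open>Polydiscs are open relative to \<open>cspace n\<close> but not in the space of all
  sequences, hence the covers by relatively open sets.\<close>

lemma compact_cover_openin:
  assumes K: "compact K" "K \<subseteq> S"
    and U: "\<And>z. z \<in> K \<Longrightarrow> openin (top_of_set S) (U z)" "\<And>z. z \<in> K \<Longrightarrow> z \<in> U z"
  obtains F where "finite F" "F \<subseteq> K" "K \<subseteq> (\<Union>z\<in>F. U z)"
proof -
  have "compactin (top_of_set S) K" using K by (simp add: compactin_subtopology)
  then have "\<exists>\<F>. finite \<F> \<and> \<F> \<subseteq> U ` K \<and> K \<subseteq> \<Union>\<F>"
    by (rule compactinD) (use U in auto)
  then obtain \<F> where "finite \<F>" "\<F> \<subseteq> U ` K" "K \<subseteq> \<Union>\<F>" by blast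
  then show ?thesis using that by (metis finite_subset_image)
qed

context complex_mfd
begin

section \<open>Uniform bounds on a finite cover\<close>

text \<open>An element is a chart with the centre and radius of a polydisc. The open polydiscs of
  radius \<open>r\<close> already cover; the closed ones of radius \<open>r + r\<close> still fit
  into the charts and leave room for Cauchy's estimates.\<close>

definition is_cover :: "('a chart \<times> (nat \<Rightarrow> complex) \<times> real) set \<Rightarrow> bool" where
  "is_cover T \<longleftrightarrow> finite T \<and>
    (\<forall>(c, a, r)\<in>T. c \<in> A \<and> r > 0 \<and> cpolydisc n a (r + r) \<subseteq> chart_image c) \<and>
    (\<forall>x\<in>topspace X. \<exists>(c, a, r)\<in>T. x \<in> fst c \<and> snd c x \<in> polydisc n a r)"

text \<open>The statement that a supremum norm is at most \<open>B\<close>, phrased without forming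
  a supremum.\<close>

definition bounded_by :: "('a chart \<times> (nat \<Rightarrow> complex) \<times> real) set \<Rightarrow> nat \<Rightarrow> real \<Rightarrow> 'a form \<Rightarrow> bool" where
  "bounded_by T p B \<omega> \<longleftrightarrow>
    (\<forall>(c, a, r)\<in>T. \<forall>I\<in>multi_indices n (int p). \<forall>z\<in>cpolydisc n a r. cmod (\<omega> c I [] z) \<le> B)"

lemma chart_of_point:
  assumes "x \<in> topspace X" obtains c where "c \<in> A" "x \<in> fst c"
  using mfd assms unfolding complex_manifold_def by blast

lemma openin_chart_preimage:
  assumes c: "c \<in> A" and W: "openin (top_of_set (cspace n)) W" "W \<subseteq> chart_image c"
  shows "openin X {x \<in> fst c. snd c x \<in> W}"
proof -
  have W': "openin (top_of_set (chart_image c)) W"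
    by (rule openin_subset_trans[OF W openin_cspace_subset[OF openin_chart_image[OF c]]])
  have "continuous_map (subtopology X (fst c)) (top_of_set (chart_image c)) (snd c)"
    using is_chart[OF c] unfolding is_chart_def by (blast intro: homeomorphic_imp_continuous_map)
  from openin_continuous_map_preimage[OF this W']
  have "openin (subtopology X (fst c)) {x \<in> fst c. snd c x \<in> W}"
    using chart_subset_topspace[OF c] by (simp add: Int_absorb1)
  then show ?thesis
    using is_chart[OF c] unfolding is_chart_def by (blast intro: openin_trans_full)
qed

lemma cover_exists:
  assumes "compact_space X" obtains T where "is_cover T"
proof -
  define G where "G = {(c, a, r). c \<in> A \<and> r > 0 \<and> cpolydisc n a (r + r) \<subseteq> chart_image c}"
  define U where "U = (\<lambda>(c :: 'a chart, a, r). {x \<in> fst c. snd c x \<in> polydisc n a r})"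
  have op: "openin X (U g)" if "g \<in> G" for g
  proof -
    obtain c a r where g: "g = (c, a, r)" by (cases g)
    then have *: "c \<in> A" "r > 0" "cpolydisc n a (r + r) \<subseteq> chart_image c" using that by (auto simp: G_def)
    have "polydisc n a r \<subseteq> chart_image c"
      using polydisc_subset_cpolydisc[of r "r + r" n a] * by auto
    then show ?thesis unfolding g U_def by (simp add: openin_chart_preimage[OF *(1) openin_polydisc])
  qed
  have cov: "\<exists>g\<in>G. x \<in> U g" if x: "x \<in> topspace X" for x
  proof -
    obtain c where c: "c \<in> A" "x \<in> fst c" using chart_of_point[OF x] by blast
    have a: "snd c x \<in> chart_image c" using c by (auto simp: chart_image_def)
    obtain t where t: "t > 0" "cpolydisc n (snd c x) t \<subseteq> chart_image c"
      using openin_contains_cpolydisc[OF openin_chart_image[OF c(1)] a] by blast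
    have "snd c x \<in> polydisc n (snd c x) (t / 2)"
      by (rule centre_in_polydisc) (use a openin_cspace_subset[OF openin_chart_image[OF c(1)]] t in auto)
    then have "(c, snd c x, t / 2) \<in> G" "x \<in> U (c, snd c x, t / 2)"
      using c t by (auto simp: G_def U_def)
    then show ?thesis by blast
  qed
  have "\<exists>\<F>. finite \<F> \<and> \<F> \<subseteq> U ` G \<and> topspace X \<subseteq> \<Union>\<F>"
    using assms[unfolded compact_space_alt, rule_format, of "U ` G"] op cov by blast
  then obtain T where T: "finite T" "T \<subseteq> G" "topspace X \<subseteq> (\<Union>g\<in>T. U g)"
    by (metis finite_subset_image)
  have "is_cover T"
    unfolding is_cover_def
  proof (intro conjI ballI)
    show "finite T" by (rule T)
    show "case g of (c, a, r) \<Rightarrow> c \<in> A \<and> r > 0 \<and> cpolydisc n a (r + r) \<subseteq> chart_image c" if "g \<in> T" for g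
      using that T(2) unfolding G_def by blast
    show "\<exists>(c, a, r)\<in>T. x \<in> fst c \<and> snd c x \<in> polydisc n a r" if x: "x \<in> topspace X" for x
    proof -
      obtain g where g: "g \<in> T" "x \<in> U g" using T(3) x by blast
      then show ?thesis by (intro bexI[of _ g]) (auto simp: U_def split: prod.splits)
    qed
  qed
  then show ?thesis by (rule that)
qed

context
  fixes T :: "('a chart \<times> (nat \<Rightarrow> complex) \<times> real) set"
  assumes T: "is_cover T"
begin

lemma coverD:
  assumes "(c, a, r) \<in> T"
  shows "c \<in> A" "r > 0" "cpolydisc n a (r + r) \<subseteq> chart_image c"
  using T assms unfolding is_cover_def by auto

lemma cover_point:
  assumes "x \<in> topspace X"
  obtains d a r where "(d, a, r) \<in> T" "x \<in> fst d" "snd d x \<in> polydisc n a r"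
  using T assms unfolding is_cover_def by blast

lemma bounded_byD:
  assumes "bounded_by T p B \<omega>" "(c, a, r) \<in> T" "I \<in> multi_indices n (int p)" "z \<in> cpolydisc n a r"
  shows "cmod (\<omega> c I [] z) \<le> B"
  using assms unfolding bounded_by_def by blast

text \<open>Near \<open>z\<close> the manifold is seen by some polydisc of the cover, where
  \<open>B\<close> is available; the transformation law brings it to the chart \<open>c\<close> at
  the cost of Jacobian coefficients, which are continuous and so locally bounded. Neither
  \<open>U\<close> nor \<open>C\<close> depends on the form or on \<open>B\<close>.\<close>

lemma locally_bounded_by:
  assumes c: "c \<in> A" and z: "z \<in> chart_image c"
  shows "\<exists>U C. openin (top_of_set (cspace n)) U \<and> z \<in> U \<and> C \<ge> 0 \<and>
    (\<forall>\<omega> B I w. \<omega> \<in> hol_forms n A (int p) \<longrightarrow> B \<ge> 0 \<longrightarrow> bounded_by T p B \<omega> \<longrightarrow>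
      I \<in> multi_indices n (int p) \<longrightarrow> w \<in> U \<longrightarrow> cmod (\<omega> c I [] w) \<le> C * B)"
proof -
  obtain x where x: "x \<in> fst c" "z = snd c x" using z by (auto simp: chart_image_def)
  obtain d a r where d: "(d, a, r) \<in> T" "x \<in> fst d" "snd d x \<in> polydisc n a r"
    using cover_point chart_subset_topspace[OF c] x by blast
  note dA = coverD[OF d(1)]
  let ?M = "multi_indices n (int p)"
  define Y where "Y = {y \<in> fst d. snd d y \<in> polydisc n a r}"
  have "polydisc n a r \<subseteq> chart_image d"
    using polydisc_subset_cpolydisc[of r "r + r" n a] dA by auto
  then have "openin X Y" unfolding Y_def by (intro openin_chart_preimage dA openin_polydisc)
  then have U0: "openin (top_of_set (cspace n)) (snd c ` (fst c \<inter> Y))"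
    by (rule openin_chart_image_of_open[OF c])
  \<comment> \<open>Summing over \<open>I\<close> as well gives one continuous majorant for all
    components.\<close>
  define g where "g w = (\<Sum>I\<in>?M. \<Sum>K\<in>?M. cmod (entry_prod (jacobian c d w) I K))" for w
  have contg: "continuous_on (overlap c d) g"
    unfolding g_def entry_prod_def
  proof (intro continuous_on_sum continuous_on_norm continuous_on_prod)
    fix I K b assume I: "I \<in> ?M" and K: "K \<in> ?M" and "b \<in> {..<length I}"
    then have b: "b < p" by (simp add: multi_indices_int)
    show "continuous_on (overlap c d) (\<lambda>u. jacobian c d u (I ! b) (K ! b))"
      by (rule holomorphic_severalD(1)[OF holomorphic_several_d_z[OF
            holomorphic_transition[OF c dA(1) nth_in_multi_indices[OF K b]] openin_overlap[OF c dA(1)] nth_in_multi_indices[OF I b]]])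
  qed
  define U1 where "U1 = overlap c d \<inter> g -` {..< g z + 1}"
  have "openin (top_of_set (overlap c d)) U1"
    unfolding U1_def by (rule continuous_openin_preimage_gen[OF contg]) auto
  then have U1: "openin (top_of_set (cspace n)) U1" using openin_overlap[OF c dA(1)] openin_trans by blast
  define U where "U = snd c ` (fst c \<inter> Y) \<inter> U1"
  have "cmod (\<omega> c I [] w) \<le> (g z + 1) * B"
    if \<omega>: "\<omega> \<in> hol_forms n A (int p)" and B: "B \<ge> 0" "bounded_by T p B \<omega>" and I: "I \<in> ?M" and w: "w \<in> U" for \<omega> B I w
  proof -
    from w obtain y where y: "w = snd c y" "y \<in> fst c" "y \<in> Y" by (auto simp: U_def)
    have tw: "transition c d w \<in> cpolydisc n a r"
      using transition_chart[OF c y(2)] y polydisc_subset_cpolydisc[of r r n a] by (auto simp: Y_def)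
    have wo: "w \<in> overlap c d" using w by (auto simp: U_def U1_def)
    have "cmod (\<omega> c I [] w) \<le> (\<Sum>K\<in>?M. cmod (entry_prod (jacobian c d w) I K * \<omega> d K [] (transition c d w)))"
      unfolding hol_form_transition[OF \<omega> c dA(1) I wo] by (rule norm_sum)
    also have "\<dots> \<le> (\<Sum>K\<in>?M. cmod (entry_prod (jacobian c d w) I K) * B)"
      unfolding norm_mult by (intro sum_mono mult_left_mono bounded_byD[OF B(2) d(1)] tw) auto
    also have "\<dots> = (\<Sum>K\<in>?M. cmod (entry_prod (jacobian c d w) I K)) * B"
      by (simp add: sum_distrib_right)
    also have "\<dots> \<le> g w * B"
    proof (rule mult_right_mono[OF _ B(1)])
      show "(\<Sum>K\<in>?M. cmod (entry_prod (jacobian c d w) I K)) \<le> g w"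
        unfolding g_def
        by (rule member_le_sum[OF I, where f = "\<lambda>I. \<Sum>K\<in>?M. cmod (entry_prod (jacobian c d w) I K)"])
           (auto intro: sum_nonneg simp: finite_multi_indices)
    qed
    also have "\<dots> \<le> (g z + 1) * B"
      by (rule mult_right_mono[OF _ B(1)]) (use w in \<open>auto simp: U_def U1_def\<close>)
    finally show ?thesis .
  qed
  moreover have "openin (top_of_set (cspace n)) U" unfolding U_def by (rule openin_Int[OF U0 U1])
  moreover have "z \<in> U" using x d by (auto simp: U_def U1_def Y_def overlap_def)
  moreover have "g z + 1 \<ge> 0" unfolding g_def by (intro add_nonneg_nonneg sum_nonneg) auto
  ultimately show ?thesis by blast
qed

text \<open>Meant for the doubled polydiscs: a bound on the small ones controls the form there up to
  a factor that is the same for all forms.\<close>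

lemma compact_bounded_by:
  assumes c: "c \<in> A" and K: "compact K" "K \<subseteq> chart_image c"
  obtains C where "C \<ge> 0" "\<And>\<omega> B I w. \<omega> \<in> hol_forms n A (int p) \<Longrightarrow> B \<ge> 0 \<Longrightarrow> bounded_by T p B \<omega> \<Longrightarrow>
      I \<in> multi_indices n (int p) \<Longrightarrow> w \<in> K \<Longrightarrow> cmod (\<omega> c I [] w) \<le> C * B"
proof -
  have "\<forall>z\<in>K. \<exists>U C. openin (top_of_set (cspace n)) U \<and> z \<in> U \<and> C \<ge> 0 \<and>
    (\<forall>\<omega> B I w. \<omega> \<in> hol_forms n A (int p) \<longrightarrow> B \<ge> 0 \<longrightarrow> bounded_by T p B \<omega> \<longrightarrow>
      I \<in> multi_indices n (int p) \<longrightarrow> w \<in> U \<longrightarrow> cmod (\<omega> c I [] w) \<le> C * B)"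
    by (intro ballI locally_bounded_by[OF c]) (use K in blast)
  from bchoice[OF this] obtain U where
    "\<forall>z\<in>K. \<exists>C. openin (top_of_set (cspace n)) (U z) \<and> z \<in> U z \<and> C \<ge> 0 \<and>
    (\<forall>\<omega> B I w. \<omega> \<in> hol_forms n A (int p) \<longrightarrow> B \<ge> 0 \<longrightarrow> bounded_by T p B \<omega> \<longrightarrow>
      I \<in> multi_indices n (int p) \<longrightarrow> w \<in> U z \<longrightarrow> cmod (\<omega> c I [] w) \<le> C * B)" by blast
  from bchoice[OF this] obtain C where
    UC: "\<forall>z\<in>K. openin (top_of_set (cspace n)) (U z) \<and> z \<in> U z \<and> C z \<ge> 0 \<and>
    (\<forall>\<omega> B I w. \<omega> \<in> hol_forms n A (int p) \<longrightarrow> B \<ge> 0 \<longrightarrow> bounded_by T p B \<omega> \<longrightarrow>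
      I \<in> multi_indices n (int p) \<longrightarrow> w \<in> U z \<longrightarrow> cmod (\<omega> c I [] w) \<le> C z * B)" by blast
  have Kc: "K \<subseteq> cspace n" using K openin_cspace_subset[OF openin_chart_image[OF c]] by blast
  obtain F where F: "finite F" "F \<subseteq> K" "K \<subseteq> (\<Union>z\<in>F. U z)"
    by (rule compact_cover_openin[OF K(1) Kc, of U]) (use UC in auto)
  have C0: "C z \<ge> 0" if "z \<in> F" for z using UC F that by blast
  show ?thesis
  \<comment> \<open>The sum of the finitely many nonnegative constants dominates each of
    them.\<close>
  proof (rule that[of "sum C F"])
    show "sum C F \<ge> 0" by (rule sum_nonneg) (rule C0)
    fix \<omega> B I w
    assume *: "\<omega> \<in> hol_forms n A (int p)" "B \<ge> 0" "bounded_by T p B \<omega>" "I \<in> multi_indices n (int p)" and w: "w \<in> K"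
    obtain z where z: "z \<in> F" "w \<in> U z" using F w by blast
    have "cmod (\<omega> c I [] w) \<le> C z * B" using UC z F(2) * by blast
    also have "\<dots> \<le> sum C F * B"
      by (rule mult_right_mono[OF member_le_sum[OF z(1) C0 F(1)] *(2)]) simp
    finally show "cmod (\<omega> c I [] w) \<le> sum C F * B" .
  qed
qed

text \<open>Cauchy's estimates make the components Lipschitz with a constant proportional to the bound; so a form
  vanishing on a fine enough net is halved.\<close>

lemma net_halves_bound:
  assumes t: "(c, a, r) \<in> T"
  shows "\<exists>S. finite S \<and> (\<forall>\<omega> B I z. \<omega> \<in> hol_forms n A (int p) \<longrightarrow> B \<ge> 0 \<longrightarrow> bounded_by T p B \<omega> \<longrightarrow>
    (\<forall>s\<in>S. \<forall>I\<in>multi_indices n (int p). \<omega> c I [] s = 0) \<longrightarrow>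
    I \<in> multi_indices n (int p) \<longrightarrow> z \<in> cpolydisc n a r \<longrightarrow> cmod (\<omega> c I [] z) \<le> B / 2)"
proof -
  note tT = coverD[OF t]
  obtain C where C: "C \<ge> 0" "\<And>\<omega> B I w. \<omega> \<in> hol_forms n A (int p) \<Longrightarrow> B \<ge> 0 \<Longrightarrow> bounded_by T p B \<omega> \<Longrightarrow>
      I \<in> multi_indices n (int p) \<Longrightarrow> w \<in> cpolydisc n a (r + r) \<Longrightarrow> cmod (\<omega> c I [] w) \<le> C * B"
    using compact_bounded_by[OF tT(1) compact_cpolydisc tT(3)] by blast
  \<comment> \<open>With partial derivatives at most \<open>C * B / r\<close> and \<open>n\<close>
    coordinates off by at most \<open>e\<close>, the value changes by at most
    \<open>C / r * (n * e) * B\<close>. This choice makes the factor a half of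
    \<open>C / (C + 1) * (n / (n + 1))\<close>; adding 1 keeps the denominators positive.\<close>
  define e where "e = r / (2 * (C + 1) * (real n + 1))"
  have e: "e > 0" using tT C by (simp add: e_def)
  have ce: "C / r * (real n * e) \<le> 1 / 2"
  proof -
    have "C / r * (real n * e) = (C / (C + 1)) * (real n / (real n + 1)) / 2"
      using tT C by (simp add: e_def field_simps)
    also have "\<dots> \<le> 1 * 1 / 2"
      using C by (intro divide_right_mono mult_mono) auto
    finally show ?thesis by simp
  qed
  obtain S where S: "finite S" "S \<subseteq> cpolydisc n a r" "cpolydisc n a r \<subseteq> (\<Union>s\<in>S. polydisc n s e)"
  proof (rule compact_cover_openin[OF compact_cpolydisc, of n a r "cspace n" "\<lambda>s. polydisc n s e"])
    show "cpolydisc n a r \<subseteq> cspace n" by (auto simp: cpolydisc_def)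
    show "z \<in> polydisc n z e" if "z \<in> cpolydisc n a r" for z
      using that e by (simp add: polydisc_def cpolydisc_def)
  qed (auto intro: openin_polydisc)
  have sub: "cpolydisc n a r \<subseteq> chart_image c"
    using cpolydisc_mono[of r "r + r" n a] tT by auto
  have "cmod (\<omega> c I [] z) \<le> B / 2"
    if \<omega>: "\<omega> \<in> hol_forms n A (int p)" and B: "B \<ge> 0" "bounded_by T p B \<omega>"
      and van: "\<forall>s\<in>S. \<forall>I\<in>multi_indices n (int p). \<omega> c I [] s = 0"
      and I: "I \<in> multi_indices n (int p)" and z: "z \<in> cpolydisc n a r" for \<omega> B I z
  proof -
    obtain s where s: "s \<in> S" "z \<in> polydisc n s e" using S z by blast
    note hol = hol_form_holomorphic[OF \<omega> tT(1) I]
    have "cmod (d_z i (\<omega> c I []) u - 0) \<le> C * B / r" if "u \<in> cpolydisc n a r" "i < n" for u i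
      using norm_d_z_le[OF hol openin_chart_image[OF tT(1)] tT(3,2) that(2,1) C(2)[OF \<omega> B I]] by simp
    \<comment> \<open>The mean value estimate with all \<open>c i\<close> equal to 0, from a net
      point \<open>s\<close> where the component vanishes.\<close>
    then have "cmod (\<omega> c I [] z - \<omega> c I [] s - (\<Sum>i<n. 0 * (z i - s i))) \<le> C * B / r * (\<Sum>i<n. cmod (z i - s i))"
      by (intro polydisc_mean_value[OF hol sub z]) (use s S in auto)
    then have "cmod (\<omega> c I [] z) \<le> C * B / r * (\<Sum>i<n. cmod (z i - s i))"
      using van s I by simp
    also have "\<dots> \<le> C * B / r * (\<Sum>i<n. e)"
    proof (intro mult_left_mono sum_mono)
      show "cmod (z i - s i) \<le> e" if "i \<in> {..<n}" for i
        using s that by (auto simp: polydisc_def dist_norm norm_minus_commute less_imp_le)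
      show "C * B / r \<ge> 0" using C B tT by simp
    qed
    also have "\<dots> = C / r * (real n * e) * B" by simp
    also have "\<dots> \<le> 1 / 2 * B" by (rule mult_right_mono[OF ce B(1)])
    finally show ?thesis by simp
  qed
  with S(1) show ?thesis by blast
qed

lemma bounded_by_exists:
  assumes \<omega>: "\<omega> \<in> hol_forms n A (int p)"
  obtains B where "B \<ge> 0" "bounded_by T p B \<omega>"
proof -
  let ?M = "multi_indices n (int p)"
  have "\<exists>M\<ge>0. \<forall>z\<in>cpolydisc n a r. cmod (\<omega> c I [] z) \<le> M" if t: "(c, a, r) \<in> T" and I: "I \<in> ?M" for c a r I
  proof -
    note tT = coverD[OF t]
    have "continuous_on (cpolydisc n a r) (\<omega> c I [])"
      by (rule continuous_on_subset[OF holomorphic_severalD(1)[OF hol_form_holomorphic[OF \<omega> tT(1) I]]])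
         (use cpolydisc_mono[of r "r + r" n a] tT in auto)
    then show ?thesis by (rule bounded_on_cpolydisc) (auto intro: less_imp_le)
  qed
  then have "\<forall>x\<in>T \<times> ?M. \<exists>M\<ge>0. case x of ((c, a, r), I) \<Rightarrow> \<forall>z\<in>cpolydisc n a r. cmod (\<omega> c I [] z) \<le> M" by auto
  from bchoice[OF this] obtain M where
    M: "\<And>x. x \<in> T \<times> ?M \<Longrightarrow> M x \<ge> 0"
       "\<And>c a r I z. (c, a, r) \<in> T \<Longrightarrow> I \<in> ?M \<Longrightarrow> z \<in> cpolydisc n a r \<Longrightarrow> cmod (\<omega> c I [] z) \<le> M ((c, a, r), I)"
    by fastforce
  have fin: "finite (T \<times> ?M)" using T by (simp add: is_cover_def finite_multi_indices)
  show ?thesis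
  proof (rule that[of "sum M (T \<times> ?M)"])
    show "sum M (T \<times> ?M) \<ge> 0" by (rule sum_nonneg) (rule M(1))
    have "cmod (\<omega> c I [] z) \<le> sum M (T \<times> ?M)" if "(c, a, r) \<in> T" "I \<in> ?M" "z \<in> cpolydisc n a r" for c a r I z
      by (rule order.trans[OF M(2)[OF that] member_le_sum[where f = M]]) (use that M fin in auto)
    then show "bounded_by T p (sum M (T \<times> ?M)) \<omega>" unfolding bounded_by_def by blast
  qed
qed

text \<open>A form has components in every chart of the atlas, while the cover involves only some
  charts; the transformation law carries the vanishing over.\<close>

lemma hol_form_zero_if_zero_on_cover:
  assumes \<omega>: "\<omega> \<in> hol_forms n A (int p)"
    and van: "\<And>c a r I z. (c, a, r) \<in> T \<Longrightarrow> I \<in> multi_indices n (int p) \<Longrightarrow> z \<in> cpolydisc n a r \<Longrightarrow> \<omega> c I [] z = 0"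
  shows "\<omega> = (\<lambda>c I J z. 0)"
proof (intro ext)
  fix c I J z
  show "\<omega> c I J z = 0"
  proof (cases "c \<in> A \<and> I \<in> multi_indices n (int p) \<and> J = [] \<and> z \<in> chart_image c")
    case True
    then have c: "c \<in> A" and I: "I \<in> multi_indices n (int p)" and J: "J = []" by auto
    obtain x where x: "x \<in> fst c" "z = snd c x" using True by (auto simp: chart_image_def)
    obtain d a r where d: "(d, a, r) \<in> T" "x \<in> fst d" "snd d x \<in> polydisc n a r"
      using cover_point chart_subset_topspace[OF c] x by blast
    have "z \<in> overlap c d" using x d by (auto simp: overlap_def)
    moreover have "transition c d z \<in> cpolydisc n a r"
      using transition_chart[OF c x(1)] x d polydisc_subset_cpolydisc[of r r n a] by auto
    ultimately show ?thesis
      unfolding J using hol_form_transition[OF \<omega> c coverD(1)[OF d(1)] I] van[OF d(1)] by simp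
  qed (rule hol_form_zero[OF \<omega>])
qed

end

section \<open>Finite evaluation sets and locally constant functions\<close>

theorem finite_evaluation_set:
  assumes "compact_space X"
  obtains S where "finite S"
    "\<And>\<omega>. \<omega> \<in> hol_forms n A (int p) \<Longrightarrow> (\<And>c I z. (c, I, z) \<in> S \<Longrightarrow> \<omega> c I [] z = 0) \<Longrightarrow> \<omega> = (\<lambda>c I J z. 0)"
proof -
  obtain T where T: "is_cover T" using cover_exists[OF assms] .
  let ?M = "multi_indices n (int p)"
  have "\<forall>t\<in>T. \<exists>S. finite S \<and> (\<forall>\<omega> B I z. \<omega> \<in> hol_forms n A (int p) \<longrightarrow> B \<ge> 0 \<longrightarrow> bounded_by T p B \<omega> \<longrightarrow>
    (\<forall>s\<in>S. \<forall>I\<in>?M. \<omega> (fst t) I [] s = 0) \<longrightarrow>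
    I \<in> ?M \<longrightarrow> z \<in> cpolydisc n (fst (snd t)) (snd (snd t)) \<longrightarrow> cmod (\<omega> (fst t) I [] z) \<le> B / 2)"
    by (intro ballI net_halves_bound[OF T]) simp
  from bchoice[OF this] obtain N where N: "\<forall>t\<in>T. finite (N t) \<and>
    (\<forall>\<omega> B I z. \<omega> \<in> hol_forms n A (int p) \<longrightarrow> B \<ge> 0 \<longrightarrow> bounded_by T p B \<omega> \<longrightarrow>
    (\<forall>s\<in>N t. \<forall>I\<in>?M. \<omega> (fst t) I [] s = 0) \<longrightarrow>
    I \<in> ?M \<longrightarrow> z \<in> cpolydisc n (fst (snd t)) (snd (snd t)) \<longrightarrow> cmod (\<omega> (fst t) I [] z) \<le> B / 2)" ..
  define S where "S = (\<Union>t\<in>T. {fst t} \<times> ?M \<times> N t)"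
  show ?thesis
  proof (rule that[of S])
    show "finite S" using T N by (auto simp: S_def is_cover_def finite_multi_indices)
    fix \<omega> assume \<omega>: "\<omega> \<in> hol_forms n A (int p)" and van: "\<And>c I z. (c, I, z) \<in> S \<Longrightarrow> \<omega> c I [] z = 0"
    have half: "bounded_by T p (B / 2) \<omega>" if "B \<ge> 0" "bounded_by T p B \<omega>" for B
      unfolding bounded_by_def
    proof (clarify)
      fix c a r I z assume t: "(c, a, r) \<in> T" and I: "I \<in> ?M" and z: "z \<in> cpolydisc n a r"
      have "\<forall>s\<in>N (c, a, r). \<forall>I\<in>?M. \<omega> (fst (c, a, r)) I [] s = 0"
      proof (intro ballI)
        fix s I assume "s \<in> N (c, a, r)" "I \<in> ?M"
        then have "(c, I, s) \<in> S" unfolding S_def by (intro UN_I[OF t]) simp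
        then show "\<omega> (fst (c, a, r)) I [] s = 0" by (simp add: van)
      qed
      from N[THEN bspec, OF t, THEN conjunct2, THEN spec[of _ \<omega>], THEN spec[of _ B], THEN spec[of _ I],
          THEN spec[of _ z], THEN mp, OF \<omega>, THEN mp, OF that(1), THEN mp, OF that(2), THEN mp, OF this,
          THEN mp, OF I] z
      show "cmod (\<omega> c I [] z) \<le> B / 2" by simp
    qed
    obtain B where B: "B \<ge> 0" "bounded_by T p B \<omega>" using bounded_by_exists[OF T \<omega>] .
    \<comment> \<open>The halving needs no input about the form beyond its bound, so it can be
      repeated with the same net.\<close>
    have bm: "bounded_by T p (B / 2 ^ m) \<omega>" for m
    proof (induction m)
      case (Suc m)
      have "bounded_by T p (B / 2 ^ m / 2) \<omega>" by (rule half[OF _ Suc]) (use B in simp)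
      then show ?case by (simp add: mult.commute)
    qed (use B in simp)
    show "\<omega> = (\<lambda>c I J z. 0)"
    proof (rule hol_form_zero_if_zero_on_cover[OF T \<omega>])
      fix c a r I z assume *: "(c, a, r) \<in> T" "I \<in> ?M" "z \<in> cpolydisc n a r"
      have "cmod (\<omega> c I [] z) \<le> 0"
        by (rule LIMSEQ_le_const[OF LIMSEQ_divide_realpow_zero[of 2 B]])
           (use bounded_byD[OF T bm *] in auto)
      then show "\<omega> c I [] z = 0" by simp
    qed
  qed
qed

text \<open>The polynomial \<open>\<Prod> (F - F(s))\<close> in a holomorphic function \<open>F\<close>, over the points \<open>s\<close> of a finite
  set on which evaluation is injective, vanishes; so \<open>F\<close> takes finitely many values.\<close>

theorem del_hol_functions:
  assumes X: "compact_space X" and \<omega>: "\<omega> \<in> hol_forms n A 0"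
  shows "del n A \<omega> = (\<lambda>c I J z. 0)"
proof -
  have \<omega>0: "\<omega> \<in> hol_forms n A (int 0)" using \<omega> by simp
  have M0: "multi_indices n (int 0) = {[]}" by (simp add: multi_indices_0)
  obtain S where S: "finite S"
    "\<And>\<omega>. \<omega> \<in> hol_forms n A (int 0) \<Longrightarrow> (\<And>c I z. (c, I, z) \<in> S \<Longrightarrow> \<omega> c I [] z = 0) \<Longrightarrow> \<omega> = (\<lambda>c I J z. 0)"
    using finite_evaluation_set[OF X] by blast
  define v where "v = (\<lambda>(c, I, z). \<omega> c I [] z)"
  \<comment> \<open>The polynomial in \<omega> as a form of degree 0; the factor belonging to a
    point of \<open>S\<close> vanishes there. Outside the chart images the value must be 0, not the
    product.\<close>
  define \<eta> :: "'a form" where "\<eta> c I J z =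
     (if c \<in> A \<and> I = [] \<and> J = [] \<and> z \<in> chart_image c then \<Prod>s\<in>S. \<omega> c [] [] z + - v s else 0)" for c I J z
  have "\<eta> \<in> hol_forms n A (int 0)"
  proof (rule hol_formsI)
    show "\<eta> c I J z = 0" if "\<not> (c \<in> A \<and> I \<in> multi_indices n (int 0) \<and> J = [] \<and> z \<in> chart_image c)" for c I J z
      using that unfolding M0 \<eta>_def by auto
    show "alternating (\<lambda>I. \<eta> c I [] z)" for c z by (simp add: alternating_def \<eta>_def)
    show "holomorphic_several n (chart_image c) (\<eta> c I [])" if c: "c \<in> A" and I: "I \<in> multi_indices n (int 0)" for c I
    proof (rule holomorphic_several_cong[OF openin_chart_image[OF c]])
      show "holomorphic_several n (chart_image c) (\<lambda>z. \<Prod>s\<in>S. \<omega> c I [] z + - v s)"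
        by (intro holomorphic_several_prod holomorphic_several_add holomorphic_several_const
            hol_form_holomorphic[OF \<omega>0 c I])
    qed (use c I in \<open>auto simp: \<eta>_def multi_indices_0\<close>)
    fix c d I z assume c: "c \<in> A" and d: "d \<in> A" and I: "I \<in> multi_indices n (int 0)" and z: "z \<in> overlap c d"
    have "\<omega> c [] [] z = \<omega> d [] [] (transition c d z)"
      using hol_form_transition[OF \<omega>0 c d _ z, of "[]"] by (simp add: multi_indices_0 entry_prod_def)
    then show "\<eta> c I [] z = (\<Sum>K\<in>multi_indices n (int 0). entry_prod (jacobian c d z) I K * \<eta> d K [] (transition c d z))"
      using I c d subsetD[OF overlap_subset z] transition_in_chart_image[OF c z]
      by (simp add: multi_indices_0 entry_prod_def \<eta>_def)
  qed
  moreover have "\<eta> c I [] z = 0" if "(c, I, z) \<in> S" for c I z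
  proof (cases "c \<in> A \<and> I = [] \<and> z \<in> chart_image c")
    case True
    then have "\<omega> c [] [] z + - v (c, I, z) = 0" by (simp add: v_def)
    then show ?thesis using True S(1) that by (auto simp: \<eta>_def prod_zero_iff intro!: bexI[of _ "(c, I, z)"])
  qed (auto simp: \<eta>_def)
  ultimately have \<eta>0: "\<eta> = (\<lambda>c I J z. 0)" by (rule S(2))
  have val: "\<omega> c [] [] z \<in> v ` S" if "c \<in> A" "z \<in> chart_image c" for c z
  proof -
    have "(\<Prod>s\<in>S. \<omega> c [] [] z + - v s) = 0"
      using fun_cong[OF fun_cong[OF fun_cong[OF fun_cong[OF \<eta>0, of c], of "[]"], of "[]"], of z] that
      by (simp add: \<eta>_def)
    then show ?thesis using S(1) by (auto simp: prod_zero_iff)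
  qed
  show ?thesis
  proof (intro ext)
    fix c I J z
    show "del n A \<omega> c I J z = 0"
    proof (cases "c \<in> A \<and> I \<in> multi_indices n (int (Suc 0)) \<and> J = [] \<and> z \<in> chart_image c")
      case True
      then have c: "c \<in> A" and I: "I \<in> multi_indices n (int (Suc 0))" and J: "J = []" and z: "z \<in> chart_image c" by auto
      note Vo = openin_chart_image[OF c]
      have i: "I ! 0 < n" by (rule nth_in_multi_indices[OF I]) simp
      have re: "remove_entry 0 I = []" using remove_entry_in_multi_indices[OF I, of 0] by (simp add: multi_indices_0)
      have zc: "z \<in> cspace n" using z openin_cspace_subset[OF Vo] by blast
      let ?g = "\<lambda>w. \<omega> c [] [] (z(I ! 0 := w))"
      obtain e where e: "e > 0" "ball (z (I ! 0)) e \<subseteq> {w. z(I ! 0 := w) \<in> chart_image c}"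
        using open_slice[OF Vo zc i] z open_contains_ball_eq by (metis (mono_tags) fun_upd_triv mem_Collect_eq)
      have "?g holomorphic_on ball (z (I ! 0)) e"
        by (rule holomorphic_on_subset[OF holomorphic_on_slice[OF hol_form_holomorphic[OF \<omega>0 c] Vo i] e(2)])
           (simp add: multi_indices_0)
      then have "continuous_on (ball (z (I ! 0)) e) ?g" by (rule holomorphic_on_imp_continuous_on)
      moreover have "finite (?g ` ball (z (I ! 0)) e)"
        by (rule finite_subset[of _ "v ` S"]) (use val[OF c] e S in auto)
      \<comment> \<open>A disc is connected, and a continuous function with finite range on a
        connected set is constant.\<close>
      ultimately have "?g constant_on ball (z (I ! 0)) e"
        by (intro continuous_finite_range_constant) auto
      then obtain k where k: "\<And>w. w \<in> ball (z (I ! 0)) e \<Longrightarrow> ?g w = k" by (auto simp: constant_on_def)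
      have "(?g has_field_derivative 0) (at (z (I ! 0)))"
        by (rule has_field_derivative_transform_within_open[OF DERIV_const[of k] open_ball]) (use k e in auto)
      then have "d_z (I ! 0) (\<omega> c [] []) z = 0" by (rule d_z_eq(1))
      then show ?thesis
        unfolding J del_hol_form[OF \<omega>0 c I z] by (simp add: re)
    qed (rule del_hol_form_zero[OF \<omega>0])
  qed
qed

end

section \<open>Quotients and dimensions\<close>

lemma field_complex_field: "field complex_field"
proof -
  have "cring complex_field"
  proof (rule cringI)
    show "abelian_group complex_field"
      by (rule abelian_groupI) (auto simp: complex_field_def add_ac intro: exI[of _ "- _"] ab_left_minus)
    show "Group.comm_monoid complex_field"
      by (rule comm_monoidI) (auto simp: complex_field_def mult_ac)
  qed (auto simp: complex_field_def algebra_simps)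
  then show ?thesis
  proof (rule cring.cring_fieldI)
    have "x \<in> Units complex_field" if "x \<noteq> 0" for x
      using that by (auto simp: Units_def complex_field_def intro!: exI[of _ "inverse x"])
    moreover have "0 \<notin> Units complex_field" by (auto simp: Units_def complex_field_def)
    ultimately show "Units complex_field = carrier complex_field - {\<zero>\<^bsub>complex_field\<^esub>}"
      by (force simp: complex_field_def)
  qed
qed

lemma linear_mapI:
  assumes "vectorspace K V" "vectorspace K W"
    and "\<And>v. v \<in> carrier V \<Longrightarrow> f v \<in> carrier W"
    and "\<And>v w. v \<in> carrier V \<Longrightarrow> w \<in> carrier V \<Longrightarrow> f (v \<oplus>\<^bsub>V\<^esub> w) = f v \<oplus>\<^bsub>W\<^esub> f w"
    and "\<And>a v. a \<in> carrier K \<Longrightarrow> v \<in> carrier V \<Longrightarrow> f (a \<odot>\<^bsub>V\<^esub> v) = a \<odot>\<^bsub>W\<^esub> f v"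
  shows "linear_map K V W f"
  using assms unfolding linear_map_def mod_hom_def mod_hom_axioms_def module_hom_def vectorspace_def by auto

context vectorspace
begin

text \<open>For quotients: \<open>Q\<close> is so far a mere record, and every axiom is carried over
  along the surjection \<open>f\<close>.\<close>

lemma vectorspace_surj_image:
  assumes car: "carrier Q = f ` carrier V"
    and add: "\<And>v w. v \<in> carrier V \<Longrightarrow> w \<in> carrier V \<Longrightarrow> f v \<oplus>\<^bsub>Q\<^esub> f w = f (v \<oplus>\<^bsub>V\<^esub> w)"
    and smult: "\<And>a v. a \<in> carrier K \<Longrightarrow> v \<in> carrier V \<Longrightarrow> a \<odot>\<^bsub>Q\<^esub> f v = f (a \<odot>\<^bsub>V\<^esub> v)"
    and zero: "\<zero>\<^bsub>Q\<^esub> = f \<zero>\<^bsub>V\<^esub>"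
  shows "vectorspace K Q"
proof (rule vs_criteria)
  show "field K" ..
  show "\<forall>v\<in>carrier Q. \<exists>w\<in>carrier Q. v \<oplus>\<^bsub>Q\<^esub> w = \<zero>\<^bsub>Q\<^esub>"
  proof
    fix v assume "v \<in> carrier Q"
    then obtain u where u: "u \<in> carrier V" "v = f u" using car by auto
    then have "v \<oplus>\<^bsub>Q\<^esub> f (\<ominus>\<^bsub>V\<^esub> u) = \<zero>\<^bsub>Q\<^esub>" by (simp add: add zero M.r_neg)
    then show "\<exists>w\<in>carrier Q. v \<oplus>\<^bsub>Q\<^esub> w = \<zero>\<^bsub>Q\<^esub>" using u car by blast
  qed
qed (auto simp: car add smult zero M.a_ac smult_assoc1 smult_l_distr smult_r_distr)

context
  fixes W assumes W: "subspace K W V"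
begin

lemma subspace_facts:
  shows "W \<subseteq> carrier V" "\<zero>\<^bsub>V\<^esub> \<in> W" "v \<in> W \<Longrightarrow> w \<in> W \<Longrightarrow> v \<oplus>\<^bsub>V\<^esub> w \<in> W"
    "a \<in> carrier K \<Longrightarrow> v \<in> W \<Longrightarrow> a \<odot>\<^bsub>V\<^esub> v \<in> W"
  using W by (auto simp: subspace_def submodule_def)

lemma abelian_subgroup_subspace: "abelian_subgroup W V"
proof (rule abelian_subgroupI3)
  have "\<ominus>\<^bsub>V\<^esub> v \<in> W" if "v \<in> W" for v
    using subspace_facts(1,4) that by (metis R.add.inv_closed R.one_closed smult_minus_1 subsetD)
  then show "additive_subgroup W V"
    unfolding additive_subgroup_def
    by (intro M.add.subgroupI) (use subspace_facts in \<open>auto simp: a_inv_def\<close>)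
  show "abelian_group V" ..
qed

lemma coset_smult:
  assumes a: "a \<in> carrier K" and v: "v \<in> carrier V"
  shows "W <+>\<^bsub>V\<^esub> ((\<odot>\<^bsub>V\<^esub>) a ` (W +>\<^bsub>V\<^esub> v)) = W +>\<^bsub>V\<^esub> (a \<odot>\<^bsub>V\<^esub> v)"
proof (intro equalityI subsetI)
  fix x assume "x \<in> W <+>\<^bsub>V\<^esub> ((\<odot>\<^bsub>V\<^esub>) a ` (W +>\<^bsub>V\<^esub> v))"
  then obtain w w' where w: "w \<in> W" "w' \<in> W" "x = w \<oplus>\<^bsub>V\<^esub> a \<odot>\<^bsub>V\<^esub> (w' \<oplus>\<^bsub>V\<^esub> v)"
    by (auto simp: set_add_def set_mult_def a_r_coset_def')
  then have "x = (w \<oplus>\<^bsub>V\<^esub> a \<odot>\<^bsub>V\<^esub> w') \<oplus>\<^bsub>V\<^esub> a \<odot>\<^bsub>V\<^esub> v"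
    using a v subspace_facts(1) by (simp add: smult_r_distr M.a_assoc subsetD)
  then show "x \<in> W +>\<^bsub>V\<^esub> (a \<odot>\<^bsub>V\<^esub> v)"
    using w a subspace_facts(3,4) by (auto simp: a_r_coset_def')
next
  fix x assume "x \<in> W +>\<^bsub>V\<^esub> (a \<odot>\<^bsub>V\<^esub> v)"
  \<comment> \<open>Writing \<open>v\<close> as 0 plus \<open>v\<close> exhibits it as an element of
    its own coset, as the set sum requires.\<close>
  then obtain w where w: "w \<in> W" "x = w \<oplus>\<^bsub>V\<^esub> a \<odot>\<^bsub>V\<^esub> (\<zero>\<^bsub>V\<^esub> \<oplus>\<^bsub>V\<^esub> v)"
    using v by (auto simp: a_r_coset_def')
  then show "x \<in> W <+>\<^bsub>V\<^esub> ((\<odot>\<^bsub>V\<^esub>) a ` (W +>\<^bsub>V\<^esub> v))"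
    using subspace_facts(2) unfolding set_add_def set_mult_def a_r_coset_def' by auto
qed

lemma coset_zero: "W +>\<^bsub>V\<^esub> \<zero>\<^bsub>V\<^esub> = W"
  using subspace_facts(1) by (force simp: a_r_coset_def')

lemma coset_eq_iff: "v \<in> carrier V \<Longrightarrow> W +>\<^bsub>V\<^esub> v = W \<longleftrightarrow> v \<in> W"
  by (metis abelian_subgroup.a_rcos_self abelian_subgroup_subspace abelian_subgroup.a_rcos_const)

end

lemma subspaceI:
  assumes "W \<subseteq> carrier V" "\<zero>\<^bsub>V\<^esub> \<in> W" "\<And>v w. v \<in> W \<Longrightarrow> w \<in> W \<Longrightarrow> v \<oplus>\<^bsub>V\<^esub> w \<in> W"
    "\<And>a v. a \<in> carrier K \<Longrightarrow> v \<in> W \<Longrightarrow> a \<odot>\<^bsub>V\<^esub> v \<in> W"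
  shows "subspace K W V"
proof -
  have "vectorspace K V" "module K V" ..
  then show ?thesis using assms by (simp add: subspace_def submodule_def)
qed

text \<open>The kernel of a functional has codimension at most one: a finite spanning set of it,
  together with one vector on which the functional is nonzero, spans everything.\<close>

lemma fin_dim_if_hyperplane_fin_dim:
  assumes e: "\<And>v. v \<in> carrier V \<Longrightarrow> e v \<in> carrier K"
      "\<And>v w. v \<in> carrier V \<Longrightarrow> w \<in> carrier V \<Longrightarrow> e (v \<oplus>\<^bsub>V\<^esub> w) = e v \<oplus>\<^bsub>K\<^esub> e w"
      "\<And>a v. a \<in> carrier K \<Longrightarrow> v \<in> carrier V \<Longrightarrow> e (a \<odot>\<^bsub>V\<^esub> v) = a \<otimes>\<^bsub>K\<^esub> e v"
    and U: "U = {v \<in> carrier V. e v = \<zero>\<^bsub>K\<^esub>}"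
    and sub: "subspace K U V"
    and fd: "vectorspace.fin_dim K (V\<lparr>carrier := U\<rparr>)"
  shows fin_dim
proof -
  interpret U: vectorspace K "V\<lparr>carrier := U\<rparr>" by (rule subspace_is_vs[OF sub])
  obtain B where B: "finite B" "B \<subseteq> U" "U.span B = U"
    using fd unfolding U.fin_dim_def by auto
  have Bc: "B \<subseteq> carrier V" using B U by auto
  have sB: "span B = U"
    using span_li_not_depend(1)[OF B(2)] sub B(3) by (simp add: subspace_def)
  show ?thesis
  proof (cases "U = carrier V")
    case True
    then show ?thesis unfolding fin_dim_def using B sB Bc by auto
  next
    case False
    then obtain v0 where v0: "v0 \<in> carrier V" "e v0 \<noteq> \<zero>\<^bsub>K\<^esub>" using U by auto
    let ?C = "insert v0 B"
    have C: "?C \<subseteq> carrier V" using v0 Bc by auto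
    have sC: "subspace K (span ?C) V" by (rule span_is_subspace[OF C])
    have "v \<in> span ?C" if v: "v \<in> carrier V" for v
    proof -
      \<comment> \<open>The multiple of \<open>v0\<close> that has to be subtracted from
        \<open>v\<close> to land in the kernel.\<close>
      define a where "a = e v \<otimes>\<^bsub>K\<^esub> inv\<^bsub>K\<^esub> (e v0)"
      have inv: "inv\<^bsub>K\<^esub> (e v0) \<in> carrier K" "inv\<^bsub>K\<^esub> (e v0) \<otimes>\<^bsub>K\<^esub> e v0 = \<one>\<^bsub>K\<^esub>"
        using v0 e(1) field_Units by (auto simp: Units_inv_closed)
      have a: "a \<in> carrier K" using inv e(1)[OF v] by (simp add: a_def)
      define u where "u = v \<oplus>\<^bsub>V\<^esub> (\<ominus>\<^bsub>K\<^esub> a) \<odot>\<^bsub>V\<^esub> v0"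
      have uc: "u \<in> carrier V" using v v0 a by (simp add: u_def)
      have "a \<otimes>\<^bsub>K\<^esub> e v0 = e v"
        using inv e(1)[OF v] e(1)[OF v0(1)] by (simp add: a_def R.m_assoc)
      then have "e u = \<zero>\<^bsub>K\<^esub>"
        using v v0 a e(1)[OF v] e(1)[OF v0(1)] by (simp add: u_def e(2,3) R.l_minus R.r_neg)
      then have "u \<in> span ?C" using uc U sB span_is_monotone[of B ?C] by auto
      moreover have "a \<odot>\<^bsub>V\<^esub> v0 \<in> span ?C"
        using subspace_facts(4)[OF sC a] in_own_span[OF C] by auto
      ultimately have "u \<oplus>\<^bsub>V\<^esub> a \<odot>\<^bsub>V\<^esub> v0 \<in> span ?C" by (rule subspace_facts(3)[OF sC])
      moreover have "u \<oplus>\<^bsub>V\<^esub> a \<odot>\<^bsub>V\<^esub> v0 = v"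
        using v v0 a by (simp add: u_def M.a_assoc smult_l_minus M.l_neg)
      ultimately show ?thesis by simp
    qed
    then have "span ?C = carrier V" using subspace_facts(1)[OF sC] by blast
    then show ?thesis unfolding fin_dim_def using B(1) C by blast
  qed
qed

end

section \<open>Dimension of quotients and separating functionals\<close>

lemma linear_map_quotient:
  fixes V :: "('k, 'v) module"
  assumes V: "vectorspace K V" and W: "subspace K W V"
  shows "linear_map K V (quotient_space V W) (\<lambda>v. W +>\<^bsub>V\<^esub> v)"
proof -
  interpret vectorspace K V by (rule V)
  note sum = abelian_subgroup.a_rcos_sum[OF abelian_subgroup_subspace[OF W]]
  show ?thesis
  proof (rule linear_mapI[OF V])
    show "vectorspace K (quotient_space V W)"
      by (rule vectorspace_surj_image[where f = "\<lambda>v. W +>\<^bsub>V\<^esub> v"])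
         (auto simp: quotient_space_def A_RCOSETS_def' sum coset_smult[OF W] coset_zero[OF W])
  qed (auto simp: quotient_space_def A_RCOSETS_def' sum coset_smult[OF W])
qed

text \<open>Rank-nullity for the projection, whose kernel is \<open>W\<close>.\<close>

lemma dim_quotient:
  fixes V :: "('k, 'v) module"
  assumes V: "vectorspace K V" and W: "subspace K W V" and fd: "vectorspace.fin_dim K V"
  shows "vectorspace.dim K (quotient_space V W) + vectorspace.dim K (V\<lparr>carrier := W\<rparr>) = vectorspace.dim K V"
proof -
  interpret vectorspace K V by (rule V)
  interpret q: linear_map K V "quotient_space V W" "\<lambda>v. W +>\<^bsub>V\<^esub> v" by (rule linear_map_quotient[OF V W])
  have "q.imT = carrier (quotient_space V W)"
    by (auto simp: q.im_def quotient_space_def A_RCOSETS_def')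
  moreover have "\<zero>\<^bsub>quotient_space V W\<^esub> = W" by (simp add: quotient_space_def)
  then have "q.kerT = W"
    using coset_eq_iff[OF W] subspace_facts(1)[OF W] unfolding q.ker_def by auto
  ultimately show ?thesis using q.rank_nullity_main(1)[OF fd] by simp
qed

text \<open>Restricting to the kernel of one functional after another loses at most one dimension
  each time and ends at the zero space. The induction varies \<open>V\<close>, since the remaining
  functionals separate only the vectors of that kernel.\<close>

lemma fin_dim_if_functionals_separate:
  assumes S: "finite S" and V: "vectorspace K V"
    and e: "\<And>s v. s \<in> S \<Longrightarrow> v \<in> carrier V \<Longrightarrow> e s v \<in> carrier K"
      "\<And>s v w. s \<in> S \<Longrightarrow> v \<in> carrier V \<Longrightarrow> w \<in> carrier V \<Longrightarrow> e s (v \<oplus>\<^bsub>V\<^esub> w) = e s v \<oplus>\<^bsub>K\<^esub> e s w"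
      "\<And>s a v. s \<in> S \<Longrightarrow> a \<in> carrier K \<Longrightarrow> v \<in> carrier V \<Longrightarrow> e s (a \<odot>\<^bsub>V\<^esub> v) = a \<otimes>\<^bsub>K\<^esub> e s v"
    and sep: "\<And>v. v \<in> carrier V \<Longrightarrow> (\<And>s. s \<in> S \<Longrightarrow> e s v = \<zero>\<^bsub>K\<^esub>) \<Longrightarrow> v = \<zero>\<^bsub>V\<^esub>"
  shows "vectorspace.fin_dim K V"
  using S V e sep
proof (induction S arbitrary: V rule: finite_induct)
  case empty
  interpret vectorspace K V by (rule empty)
  have "carrier V = {\<zero>\<^bsub>V\<^esub>}" using empty.prems(5) by auto
  then have "gen_set {}" using span_empty by simp
  then show ?case unfolding fin_dim_def by blast
next
  case (insert s S)
  interpret vectorspace K V by (rule insert)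
  note e = insert.prems(2-4)
  define U where "U = {v \<in> carrier V. e s v = \<zero>\<^bsub>K\<^esub>}"
  have e0: "e s \<zero>\<^bsub>V\<^esub> = \<zero>\<^bsub>K\<^esub>"
    using e(3)[of s "\<zero>\<^bsub>K\<^esub>" "\<zero>\<^bsub>V\<^esub>"] e(1)[of s "\<zero>\<^bsub>V\<^esub>"] by simp
  have sub: "subspace K U V"
    by (rule subspaceI) (auto simp: U_def e e0)
  have "vectorspace.fin_dim K (V\<lparr>carrier := U\<rparr>)"
  proof (rule insert.IH)
    show "vectorspace K (V\<lparr>carrier := U\<rparr>)" by (rule subspace_is_vs[OF sub])
    show "v = \<zero>\<^bsub>V\<lparr>carrier := U\<rparr>\<^esub>" if "v \<in> carrier (V\<lparr>carrier := U\<rparr>)" "\<And>t. t \<in> S \<Longrightarrow> e t v = \<zero>\<^bsub>K\<^esub>" for v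
      using insert.prems(5)[of v] that by (auto simp: U_def)
  qed (auto simp: U_def e)
  then show ?case
    by (rule fin_dim_if_hyperplane_fin_dim[of "e s", OF _ _ _ U_def sub, rotated 3]) (auto simp: e)
qed

section \<open>Cohomology in bidegree (p,0)\<close>

abbreviation zero_form :: "'a form" where
  "zero_form \<equiv> \<lambda>c I J z. 0"

text \<open>There are no forms of bidegree \<open>(p,-1)\<close>, so the classes in bidegree \<open>(p,0)\<close> are singletons.\<close>

definition class_space :: "'a form set \<Rightarrow> (complex, 'a form set) module" where
  "class_space S =
    \<lparr>carrier = (\<lambda>\<omega>. {\<omega>}) ` S, monoid.mult = undefined, one = undefined,
     ring.zero = {zero_form},
     add = (\<lambda>P Q. \<Union>\<omega>\<in>P. \<Union>\<eta>\<in>Q. {\<lambda>c I J z. \<omega> c I J z + \<eta> c I J z}),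
     module.smult = (\<lambda>a P. \<Union>\<omega>\<in>P. {\<lambda>c I J z. a * \<omega> c I J z})\<rparr>"

text \<open>An equality of records rather than an isomorphism, so that dimensions transfer by
  rewriting.\<close>

lemma quotient_form_space_zero:
  "quotient_space ((form_space n A p q)\<lparr>carrier := S\<rparr>) {zero_form} = class_space S"
  unfolding quotient_space_def class_space_def form_space_def A_RCOSETS_def RCOSETS_def r_coset_def
    set_add_def set_mult_def
  by (simp add: UNION_singleton_eq_range image_image)

lemma smooth_forms_neg: "smooth_forms n A p (- 1) = {zero_form}"
proof -
  have "multi_indices n (- 1) = {}" by (auto simp: multi_indices_def)
  then show ?thesis unfolding smooth_forms_def by (auto simp: fun_eq_iff)
qed

lemma delbar_zero: "delbar n A zero_form = zero_form"
  by (intro ext) (simp add: delbar_def d_zbar_const)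

lemma del_zero: "del n A zero_form = zero_form"
  by (intro ext) (simp add: del_def d_z_const)

lemma zero_form_space: "\<zero>\<^bsub>form_space n A p q\<^esub> = zero_form"
  by (simp add: form_space_def)

lemma zero_H_delbar: "\<zero>\<^bsub>H_delbar n A p 0\<^esub> = {zero_form}"
  by (simp add: H_delbar_def quotient_space_def smooth_forms_neg delbar_zero)

lemma H_delbar_eq: "H_delbar n A p 0 = class_space (hol_forms n A p)"
  unfolding H_delbar_def hol_forms_def zero_form_space
  using quotient_form_space_zero by (simp add: smooth_forms_neg delbar_zero)

lemma H_BC_eq: "H_BC n A p 0 = class_space {\<omega> \<in> hol_forms n A p. del n A \<omega> = zero_form}"
proof -
  have "{\<omega> \<in> smooth_forms n A p 0. del n A \<omega> = zero_form \<and> delbar n A \<omega> = zero_form}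
      = {\<omega> \<in> hol_forms n A p. del n A \<omega> = zero_form}" by (auto simp: hol_forms_def)
  then show ?thesis
    unfolding H_BC_def zero_form_space
    using quotient_form_space_zero by (simp add: smooth_forms_neg delbar_zero del_zero)
qed

lemma del_H_eq: "del_H n A p 0 {\<omega>} = {del n A \<omega>}"
  by (simp add: del_H_def smooth_forms_neg delbar_zero set_add_def set_mult_def form_space_def)

text \<open>On singleton classes \<open>del_H\<close> is \<open>del\<close> on the representative,
  and the quotient of quotients becomes closed forms modulo derivatives of forms one degree
  lower.\<close>

lemma E2_eq:
  "E2 n A p 0 = quotient_space (class_space {\<omega> \<in> hol_forms n A p. del n A \<omega> = zero_form})
     ((\<lambda>\<omega>. {del n A \<omega>}) ` hol_forms n A (p - 1))"
proof -
  have "{P \<in> carrier (H_delbar n A p 0). del_H n A p 0 P = {zero_form}}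
      = carrier (class_space {\<omega> \<in> hol_forms n A p. del n A \<omega> = zero_form})"
    by (auto simp: H_delbar_eq class_space_def del_H_eq)
  then have "(H_delbar n A p 0)\<lparr>carrier := {P \<in> carrier (H_delbar n A p 0). del_H n A p 0 P = {zero_form}}\<rparr>
      = class_space {\<omega> \<in> hol_forms n A p. del n A \<omega> = zero_form}"
    by (simp add: H_delbar_eq class_space_def)
  moreover have "del_H n A (p - 1) 0 ` carrier (H_delbar n A (p - 1) 0) = (\<lambda>\<omega>. {del n A \<omega>}) ` hol_forms n A (p - 1)"
    by (simp add: H_delbar_eq class_space_def image_image del_H_eq)
  ultimately show ?thesis unfolding E2_def zero_H_delbar by simp
qed

section \<open>Vector spaces of classes\<close>

text \<open>Closure is stated for plain sets of functions, so that all holomorphic forms and the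
  closed ones can be treated alike.\<close>

definition lin_closed :: "'a form set \<Rightarrow> bool" where
  "lin_closed S \<longleftrightarrow> zero_form \<in> S \<and> (\<forall>\<omega>\<in>S. \<forall>\<eta>\<in>S. (\<lambda>c I J z. \<omega> c I J z + \<eta> c I J z) \<in> S) \<and>
    (\<forall>a. \<forall>\<omega>\<in>S. (\<lambda>c I J z. a * \<omega> c I J z) \<in> S)"

lemma class_space_simps:
  "carrier (class_space S) = (\<lambda>\<omega>. {\<omega>}) ` S"
  "\<zero>\<^bsub>class_space S\<^esub> = {zero_form}"
  "{\<omega>} \<oplus>\<^bsub>class_space S\<^esub> {\<eta>} = {\<lambda>c I J z. \<omega> c I J z + \<eta> c I J z}"
  "a \<odot>\<^bsub>class_space S\<^esub> {\<omega>} = {\<lambda>c I J z. a * \<omega> c I J z}"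
  by (auto simp: class_space_def)

lemma complex_field_simps:
  "carrier complex_field = UNIV" "\<zero>\<^bsub>complex_field\<^esub> = 0" "\<one>\<^bsub>complex_field\<^esub> = 1"
  "a \<oplus>\<^bsub>complex_field\<^esub> b = a + b" "a \<otimes>\<^bsub>complex_field\<^esub> b = a * b"
  by (auto simp: complex_field_def)

lemma vectorspace_class_space:
  assumes S: "lin_closed S" shows "vectorspace complex_field (class_space S)"
proof (rule vs_criteria[OF field_complex_field])
  have closed: "zero_form \<in> S" "\<And>\<omega> \<eta>. \<omega> \<in> S \<Longrightarrow> \<eta> \<in> S \<Longrightarrow> (\<lambda>c I J z. \<omega> c I J z + \<eta> c I J z) \<in> S"
    "\<And>a \<omega>. \<omega> \<in> S \<Longrightarrow> (\<lambda>c I J z. a * \<omega> c I J z) \<in> S"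
    using S by (auto simp: lin_closed_def)
  show "\<zero>\<^bsub>class_space S\<^esub> \<in> carrier (class_space S)" using closed(1) by (simp add: class_space_simps)
  show "\<forall>v w. v \<in> carrier (class_space S) \<and> w \<in> carrier (class_space S) \<longrightarrow> v \<oplus>\<^bsub>class_space S\<^esub> w \<in> carrier (class_space S)"
    using closed(2) by (auto simp: class_space_simps)
  show "\<forall>v\<in>carrier (class_space S). \<exists>w\<in>carrier (class_space S). v \<oplus>\<^bsub>class_space S\<^esub> w = \<zero>\<^bsub>class_space S\<^esub>"
  proof
    fix v assume "v \<in> carrier (class_space S)"
    then obtain \<omega> where \<omega>: "\<omega> \<in> S" "v = {\<omega>}" by (auto simp: class_space_simps)
    show "\<exists>w\<in>carrier (class_space S). v \<oplus>\<^bsub>class_space S\<^esub> w = \<zero>\<^bsub>class_space S\<^esub>"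
      by (rule bexI[of _ "{\<lambda>c I J z. - 1 * \<omega> c I J z}"])
         (use closed(3)[OF \<omega>(1), of "- 1"] in \<open>auto simp: \<omega> class_space_simps\<close>)
  qed
  show "\<forall>c v. c \<in> carrier complex_field \<and> v \<in> carrier (class_space S) \<longrightarrow> c \<odot>\<^bsub>class_space S\<^esub> v \<in> carrier (class_space S)"
    using closed(3) by (auto simp: class_space_simps)
qed (auto simp: class_space_simps complex_field_simps algebra_simps)

context complex_mfd
begin

abbreviation closed_hol_forms :: "nat \<Rightarrow> 'a form set" where
  "closed_hol_forms p \<equiv> {\<omega> \<in> hol_forms n A (int p). del n A \<omega> = zero_form}"

lemma lin_closed_hol_forms: "lin_closed (hol_forms n A (int p))"
  unfolding lin_closed_def using hol_forms_zero hol_forms_add hol_forms_smult by blast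

lemma lin_closed_closed_hol_forms: "lin_closed (closed_hol_forms p)"
  unfolding lin_closed_def
  using hol_forms_zero[of p] hol_forms_add[of _ p] hol_forms_smult[of _ p] del_zero del_add[of _ p] del_smult[of _ p]
  by auto

lemma fin_dim_class_space:
  assumes X: "compact_space X" and S: "lin_closed S" "S \<subseteq> hol_forms n A (int p)"
  shows "vectorspace.fin_dim complex_field (class_space S)"
proof -
  obtain E where E: "finite E" "\<And>\<omega>. \<omega> \<in> hol_forms n A (int p) \<Longrightarrow> (\<And>c I z. (c, I, z) \<in> E \<Longrightarrow> \<omega> c I [] z = 0) \<Longrightarrow> \<omega> = zero_form"
    using finite_evaluation_set[OF X] by blast
  show ?thesis
  proof (rule fin_dim_if_functionals_separate[OF E(1) vectorspace_class_space[OF S(1)],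
        \<comment> \<open>The functionals are evaluations of components at the points of
          \<open>E\<close>, applied to the only element of a class.\<close>
        where e = "\<lambda>(c, I, z) P. the_elem P c I [] z"])
    fix P assume P: "P \<in> carrier (class_space S)"
      and van: "\<And>s. s \<in> E \<Longrightarrow> (case s of (c, I, z) \<Rightarrow> \<lambda>P. the_elem P c I [] z) P = \<zero>\<^bsub>complex_field\<^esub>"
    obtain \<omega> where \<omega>: "P = {\<omega>}" "\<omega> \<in> hol_forms n A (int p)" using P S(2) by (auto simp: class_space_simps)
    have "\<omega> = zero_form"
    proof (rule E(2)[OF \<omega>(2)])
      show "\<omega> c I [] z = 0" if "(c, I, z) \<in> E" for c I z
        using van[OF that] by (simp add: \<omega>(1) complex_field_simps)
    qed
    then show "P = \<zero>\<^bsub>class_space S\<^esub>" by (simp add: \<omega>(1) class_space_simps)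
  qed (auto simp: class_space_simps complex_field_simps)
qed

text \<open>The target consists of the closed forms of degree \<open>p + 1\<close>, so that the
  image of this map is the very subspace divided out in \<open>E2\<close>.\<close>

lemma linear_map_del:
  "linear_map complex_field (class_space (hol_forms n A (int p))) (class_space (closed_hol_forms (Suc p)))
     (\<lambda>P. {del n A (the_elem P)})"
proof (rule linear_mapI)
  show "vectorspace complex_field (class_space (hol_forms n A (int p)))"
    by (rule vectorspace_class_space[OF lin_closed_hol_forms])
  show "vectorspace complex_field (class_space (closed_hol_forms (Suc p)))"
    by (rule vectorspace_class_space[OF lin_closed_closed_hol_forms])
qed (use del_in_hol_forms[of _ p] del_del_hol_form[of _ p] del_add[of _ p] del_smult[of _ p]
      in \<open>auto simp: class_space_simps simp del: of_nat_Suc\<close>)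

text \<open>Rank-nullity for \<open>del\<close> in degree \<open>p\<close> and the quotient defining
  \<open>E2\<close> in degree \<open>p + 1\<close> contain the same rank; eliminating it gives the
  first formula, in additive form since the dimensions are natural numbers. The second one starts
  the recursion: in degree 0 every holomorphic form is closed.\<close>

lemma dimension_formulas:
  assumes X: "compact_space X"
  shows "h_BC n A (int p) 0 + h_BC n A (int (Suc p)) 0 = h_delbar n A (int p) 0 + h_2 n A (int (Suc p)) 0"
    and "h_BC n A 0 0 = h_delbar n A 0 0"
proof -
  let ?H = "class_space (hol_forms n A (int p))" and ?Z = "\<lambda>p. class_space (closed_hol_forms p)"
  let ?B = "(\<lambda>\<omega>. {del n A \<omega>}) ` hol_forms n A (int p)"
  interpret d: linear_map complex_field ?H "?Z (Suc p)" "\<lambda>P. {del n A (the_elem P)}" by (rule linear_map_del)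
  have fd: "vectorspace.fin_dim complex_field ?H" "vectorspace.fin_dim complex_field (?Z (Suc p))"
    by (rule fin_dim_class_space[OF X lin_closed_hol_forms order_refl])
       (rule fin_dim_class_space[OF X lin_closed_closed_hol_forms, of "Suc p" "Suc p"], blast)
  have im: "d.imT = ?B" by (simp add: d.im_def class_space_simps image_image)
  have "d.kerT = (\<lambda>\<omega>. {\<omega>}) ` closed_hol_forms p"
    unfolding d.ker_def by (auto simp: class_space_simps)
  then have ker: "?H\<lparr>carrier := d.kerT\<rparr> = ?Z p" by (simp add: class_space_def)
  have 1: "vectorspace.dim complex_field ((?Z (Suc p))\<lparr>carrier := ?B\<rparr>) + vectorspace.dim complex_field (?Z p)
      = vectorspace.dim complex_field ?H"
    using d.rank_nullity_main(1)[OF fd(1)] unfolding im ker .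
  have sub: "subspace complex_field ?B (?Z (Suc p))" using d.imT_is_subspace unfolding im .
  have 2: "vectorspace.dim complex_field (quotient_space (?Z (Suc p)) ?B)
      + vectorspace.dim complex_field ((?Z (Suc p))\<lparr>carrier := ?B\<rparr>) = vectorspace.dim complex_field (?Z (Suc p))"
    by (rule dim_quotient[OF vectorspace_class_space[OF lin_closed_closed_hol_forms] sub fd(2)])
  have "int (Suc p) - 1 = int p" by simp
  then have E: "E2 n A (int (Suc p)) 0 = quotient_space (?Z (Suc p)) ?B"
    using E2_eq[of n A "int (Suc p)"] by (simp only:)
  show "h_BC n A (int p) 0 + h_BC n A (int (Suc p)) 0 = h_delbar n A (int p) 0 + h_2 n A (int (Suc p)) 0"
    using 1 2 unfolding h_BC_def h_delbar_def h_2_def cdim_def E H_BC_eq H_delbar_eq by linarith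
  have "{\<omega> \<in> hol_forms n A 0. del n A \<omega> = zero_form} = hol_forms n A 0"
    using del_hol_functions[OF X] by blast
  then show "h_BC n A 0 0 = h_delbar n A 0 0"
    unfolding h_BC_def h_delbar_def H_BC_eq H_delbar_eq by simp
qed

text \<open>By the recursion, \<open>h_BC\<close> in degree \<open>p + 1\<close> is
  \<open>h_2\<close> there plus the defect \<open>h_delbar - h_BC\<close> in degree
  \<open>p\<close>, which by induction is the alternating sum up to \<open>p\<close>. Raising the
  degree flips all old signs, and the new term enters with sign +1.\<close>

lemma h_BC_formula:
  assumes X: "compact_space X"
  shows "int (h_BC n A (int p) 0) = int (h_delbar n A (int p) 0) -
    (\<Sum>j=1..p. (-1) ^ (p + j) * (int (h_delbar n A (int j) 0) - int (h_2 n A (int j) 0)))"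
proof (induction p)
  case 0
  then show ?case using dimension_formulas(2)[OF X] by simp
next
  case (Suc p)
  let ?x = "\<lambda>j. int (h_delbar n A (int j) 0) - int (h_2 n A (int j) 0)"
  have "(\<Sum>j=1..Suc p. (-1) ^ (Suc p + j) * ?x j) = (\<Sum>j=1..p. (-1) ^ (Suc p + j) * ?x j) + (-1) ^ (Suc p + Suc p) * ?x (Suc p)"
    by simp
  also have "(-1) ^ (Suc p + Suc p) = (1::int)"
    by (rule neg_one_even_power) simp
  also have "(\<Sum>j=1..p. (-1) ^ (Suc p + j) * ?x j) = - (\<Sum>j=1..p. (-1) ^ (p + j) * ?x j)"
    by (simp add: sum_negf)
  finally have "(\<Sum>j=1..Suc p. (-1) ^ (Suc p + j) * ?x j) = ?x (Suc p) - (\<Sum>j=1..p. (-1) ^ (p + j) * ?x j)"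
    by simp
  then show ?case using Suc dimension_formulas(1)[OF X, of p] by linarith
qed

end

theorem mainTheorem3:
  fixes X :: "'a topology" and A :: "'a chart set" and n p :: nat
  assumes "complex_manifold n X A" and "compact_space X" and "p \<le> n"
  shows "int (h_BC n A (int p) 0) =
    int (h_delbar n A (int p) 0) -
    (\<Sum>j=1..p. (-1) ^ (p + j) * (int (h_delbar n A (int j) 0) - int (h_2 n A (int j) 0)))"
proof -
  interpret complex_mfd n X A by unfold_locales (rule assms)
  show ?thesis by (rule h_BC_formula[OF assms(2)])
qed

end
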